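(* Let $b>0$, $\mu>0$ and $\gamma,\nu\in\mathbb{R}$ be fixed with $2\mu-\gamma>\tfrac12$ and $\gamma+\nu\notin\{-1,-3,-5,\ldots\}$. Put $\chi=b^2/4$ and, for $a>0$, $$S_\nu(a,b)=\sum_{n=1}^\infty \frac{n^\gamma J_\nu(nb/a)}{(n^2+a^2)^\mu}.$$ Then, as $a\to+\infty$, one has the asymptotic expansion $$S_\nu(a,b)-a^{\gamma-2\mu+1}H(1)\sim \frac{a^{-\nu-2\mu}(b/2)^\nu}{\Gamma(1+\nu)}\sum_{k=0}^\infty\frac{(-1)^k}{k!}(\mu)_k\,\zeta(-\omega_k)\,F_k\,a^{-2k},$$ where $\omega_k=\gamma+\nu+2k$, and $H(1)$ and $F_k$ are as defined in the context.
   Context: $J_\nu$ is the Bessel function of the first kind, $\zeta$ the Riemann zeta function, and $(\alpha)_n=\Gamma(\alpha+n)/\Gamma(\alpha)$ the Pochhammer symbol. Regularized hypergeometric function: $${}_1\mathbf{F}_2\left(\begin{array}{c}\alpha\\ \beta,\delta\end{array}\Big|\,z\right)=\sum_{n=0}^\infty\frac{(\alpha)_n}{\Gamma(\beta+n)\Gamma(\delta+n)}\frac{z^n}{n!},$$ which is entire in all its parameters and in $z$ (it equals ${}_1F_2/(\Gamma(\beta)\Gamma(\delta))$ when that makes sense). With $\lambda=\lambda(s)=\tfrac12(s+\gamma+\nu)$, $\chi=b^2/4$ and $B=\dfrac{(b/2)^\nu}{2\Gamma(\mu)}$, the function $H$ is $$H(s)=\frac{\pi B}{\sin\pi(\mu-\lambda)}\left\{\Gamma(\lambda)\,{}_1\mathbf{F}_2\left(\begin{array}{c}\lambda\\1+\lambda-\mu,\,1+\nu\end{array}\Big|\,\chi\right)-\chi^{\mu-\lambda}\Gamma(\mu)\,{}_1\mathbf{F}_2\left(\begin{array}{c}\mu\\1-\lambda+\mu,\,1-\lambda+\mu+\nu\end{array}\Big|\,\chi\right)\right\},$$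 the points where $\mu-\lambda$ is an integer (and $\lambda$ is not a non-positive integer) being removable singularities, at which $H$ is defined by continuity. In the strip $-\gamma-\nu<\Re(s)<2\mu-\gamma+\tfrac12$ it equals the Mellin transform $\int_0^\infty x^{s-1}\frac{x^\gamma J_\nu(bx)}{(1+x^2)^\mu}\,dx$. The $F_k$ are the polynomials of degree $k$ in $\chi$ $$F_k={}_1F_2\left(\begin{array}{c}-k\\1-\mu-k,\,1+\nu\end{array}\Big|\,\chi\right)=\sum_{j=0}^k\frac{(-k)_j}{(1-\mu-k)_j(1+\nu)_j}\frac{\chi^j}{j!}.$$ If $\nu$ is a negative integer, $F_k/\Gamma(1+\nu)$ is understood as $\sum_{j=0}^k\frac{(-k)_j}{(1-\mu-k)_j\Gamma(1+\nu+j)}\frac{\chi^j}{j!}$. The symbol $\sim$ is in the Poincaré sense: for each $K\ge0$, the left side minus the prefactor times $\sum_{k=0}^{K-1}$ of the series is $O(a^{-\nu-2\mu-2K})$ as $a\to+\infty$, all other parameters fixed. *)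

theory Defs
  imports "HOL-Complex_Analysis.Complex_Analysis" "HOL-Library.Landau_Symbols"
begin

text \<open>
  The power series below is the Bessel function of the first kind for real order and
  \<open>x > 0\<close>, the only arguments that are used. Throughout, \<open>1/\<Gamma>\<close> is the entire function
  \<^const>\<open>rGamma\<close>, which vanishes at the poles of \<open>\<Gamma>\<close>.
\<close>

definition bessel_J :: "real \<Rightarrow> real \<Rightarrow> real" where
  "bessel_J \<nu> x =
     (\<Sum>m. (-1) ^ m * rGamma (real m + \<nu> + 1) / fact m * (x / 2) powr (2 * real m + \<nu>))"

text \<open>
  The Riemann zeta function as the analytic continuation of its Dirichlet series to
  \<open>\<complex> - {1}\<close>. By the identity theorem the value is determined at every \<open>s \<noteq> 1\<close>; at the pole
  \<open>s = 1\<close> it is unspecified.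
\<close>

definition riemann_zeta :: "complex \<Rightarrow> complex" where
  "riemann_zeta = (SOME f. f holomorphic_on (- {1}) \<and>
     (\<forall>s. Re s > 1 \<longrightarrow> (\<lambda>n. 1 / of_nat (Suc n) powr s) sums f s))"

definition reg_hypergeom_1F2 :: "complex \<Rightarrow> complex \<Rightarrow> complex \<Rightarrow> complex \<Rightarrow> complex" where
  "reg_hypergeom_1F2 \<alpha> \<beta> \<delta> z =
     (\<Sum>n. pochhammer \<alpha> n * rGamma (\<beta> + of_nat n) * rGamma (\<delta> + of_nat n) * z ^ n / fact n)"

definition H_lambda :: "real \<Rightarrow> real \<Rightarrow> complex \<Rightarrow> complex" where
  "H_lambda \<gamma> \<nu> s = (s + of_real \<gamma> + of_real \<nu>) / 2"

definition H_formula :: "real \<Rightarrow> real \<Rightarrow> real \<Rightarrow> real \<Rightarrow> complex \<Rightarrow> complex" where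
  "H_formula b \<mu> \<gamma> \<nu> s =
     (let lam = H_lambda \<gamma> \<nu> s;
          m = complex_of_real \<mu>;
          chi = complex_of_real (b\<^sup>2 / 4);
          B = complex_of_real ((b / 2) powr \<nu> / (2 * Gamma \<mu>))
      in of_real pi * B / sin (of_real pi * (m - lam)) *
           (Gamma lam * reg_hypergeom_1F2 lam (1 + lam - m) (1 + of_real \<nu>) chi
            - chi powr (m - lam) * Gamma m
                * reg_hypergeom_1F2 m (1 - lam + m) (1 - lam + m + of_real \<nu>) chi))"

text \<open>
  Where \<open>\<mu> - \<lambda>(s)\<close> is an integer the formula is \<open>0/0\<close> and the value is the limit. If
  \<open>\<lambda>(s)\<close> is a non-positive integer, \<open>H\<close> has a pole and the value below is meaningless.
\<close>

definition H_fun :: "real \<Rightarrow> real \<Rightarrow> real \<Rightarrow> real \<Rightarrow> complex \<Rightarrow> complex" where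
  "H_fun b \<mu> \<gamma> \<nu> s =
     (if of_real \<mu> - H_lambda \<gamma> \<nu> s \<in> \<int>
      then Lim (at s) (H_formula b \<mu> \<gamma> \<nu>)
      else H_formula b \<mu> \<gamma> \<nu> s)"

definition F_poly :: "real \<Rightarrow> real \<Rightarrow> nat \<Rightarrow> real \<Rightarrow> real" where
  "F_poly \<mu> \<nu> k chi =
     (\<Sum>j\<le>k. pochhammer (- real k) j
        / (pochhammer (1 - \<mu> - real k) j * pochhammer (1 + \<nu>) j) * (chi ^ j / fact j))"

text \<open>
  The quotient \<open>F\<^sub>k / \<Gamma>(1 + \<nu>)\<close>; the first case, \<open>\<nu>\<close> a negative integer, is its
  continuous extension in \<open>\<nu>\<close>.
\<close>

definition F_over_Gamma :: "real \<Rightarrow> real \<Rightarrow> nat \<Rightarrow> real \<Rightarrow> real" where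
  "F_over_Gamma \<mu> \<nu> k chi =
     (if 1 + \<nu> \<in> \<int>\<^sub>\<le>\<^sub>0
      then (\<Sum>j\<le>k. pochhammer (- real k) j * rGamma (1 + \<nu> + real j)
              / pochhammer (1 - \<mu> - real k) j * (chi ^ j / fact j))
      else F_poly \<mu> \<nu> k chi / Gamma (1 + \<nu>))"

definition S_sum :: "real \<Rightarrow> real \<Rightarrow> real \<Rightarrow> real \<Rightarrow> real \<Rightarrow> real" where
  "S_sum \<mu> \<gamma> \<nu> a b =
     (\<Sum>n. real (Suc n) powr \<gamma> * bessel_J \<nu> (real (Suc n) * b / a)
        / ((real (Suc n))\<^sup>2 + a\<^sup>2) powr \<mu>)"

end

theory Submission
  imports Defs
begin

text \<open>
  Put \<open>h = 1/a\<close> and \<open>\<xi> = b\<^sup>2/4\<close>. Since \<open>J\<^sub>\<nu>(x) = (x/2)\<^sup>\<nu> E\<^sub>\<nu>(x\<^sup>2/4)\<close> with an entire function \<open>E\<^sub>\<nu>\<close>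
  (\<open>bessel_clifford\<close>), the sum \<open>S\<^sub>\<nu>(a, b)\<close> is, up to a power of \<open>a\<close> and the factor
  \<open>(b/2)\<^sup>\<nu>\<close>, the Riemann sum \<open>\<Sum>\<^sub>n h f(n h)\<close> of the single function
  \<open>f(y) = y\<^sup>\<omega> E\<^sub>\<nu>(\<xi> y\<^sup>2) (1 + y\<^sup>2) powr -\<mu>\<close>, where \<open>\<omega> = \<gamma> + \<nu>\<close>. At the origin
  \<open>f(y) = \<Sum>\<^sub>k g\<^sub>k y powr (\<omega> + 2 k)\<close>, and at infinity \<open>f\<close> and all its derivatives are
  \<open>O(y powr (\<gamma> - 2 \<mu> - 1/2))\<close>, which is integrable because \<open>2 \<mu> - \<gamma> > 1/2\<close>.

  For such a function the Euler--Maclaurin formula still holds in the form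
  \<open>\<Sum>\<^sub>n h f(n h) \<sim> I + \<Sum>\<^sub>k g\<^sub>k \<zeta>(-\<omega> - 2 k) h powr (\<omega> + 2 k + 1)\<close>, where \<open>I\<close> is the finite part of the
  integral of \<open>f\<close> over the positive half-line (\<open>generalized_euler_maclaurin\<close>). The reason is that the
  Euler--Maclaurin error term is linear in \<open>f\<close> and is small once finitely many powers
  \<open>y powr (\<omega> + 2 k)\<close> have been subtracted, while on a pure power it scales exactly in \<open>h\<close>, and its value
  there is the Euler--Maclaurin expression for the continued zeta function (\<open>zeta_em\<close>).
  The hypothesis \<open>\<gamma> + \<nu> \<notin> {-1, -3, \<dots>}\<close> keeps \<open>\<zeta>\<close> away from its pole and \<open>I\<close> free of logarithms. The
  coefficients \<open>g\<^sub>k\<close>, a Cauchy product of the series of \<open>E\<^sub>\<nu>\<close> and of the binomial series, are the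
  polynomials \<open>F\<^sub>k\<close> up to the stated factors (\<open>profile_coeff_eq_F_over_Gamma\<close>).

  It remains to see that \<open>I\<close> is \<open>H(1)\<close> divided by \<open>(b/2)\<^sup>\<nu>\<close>. With \<open>x = y\<^sup>2\<close>, \<open>2 I\<close> is the finite part of
  \<open>\<integral> x powr (q - 1) (1 + x) powr -\<mu> E\<^sub>\<nu>(\<xi> x) dx\<close> at \<open>q = (1 + \<omega>)/2\<close> (\<open>mellin_fp\<close>). For generic \<open>q\<close> the
  integral is cut at 2. On the part next to the origin \<open>E\<^sub>\<nu>\<close> is expanded in powers of \<open>x\<close>, on the part
  next to infinity \<open>(1 + x) powr -\<mu>\<close> is expanded in powers of \<open>1/x\<close>. Completing each term to a finite
  part over the whole half-line gives a continued Beta integral in the first case and the continued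
  Mellin transform of \<open>E\<^sub>\<nu>\<close>, a quotient of Gamma functions, in the second; the added pieces form one and
  the same double series with opposite signs and cancel (\<open>mellin_fp_split\<close>). The two resulting series
  are the two hypergeometric series in the definition of \<open>H\<close>, by the reflection formula. When
  \<open>\<mu> - q\<close> is an integer both sides are limits from generic \<open>q\<close>, and the finite part is continuous
  (\<open>mellin_fp_tendsto\<close>).

  The decay of \<open>E\<^sub>\<nu>\<close> at infinity, the only asymptotic information on Bessel functions that enters, comes
  from an energy estimate for the Bessel equation (\<open>bessel_clifford_bound\<close>).
\<close>

section \<open>The Bessel--Clifford function\<close>

definition bcoef :: "real \<Rightarrow> nat \<Rightarrow> real" where
  "bcoef \<nu> m = (-1) ^ m * rGamma (\<nu> + 1 + real m) / fact m"

text \<open>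
  The sum \<open>\<Sum>\<^sub>m (-1)\<^sup>m w\<^sup>m / (m! \<Gamma>(\<nu> + 1 + m))\<close>: a Bessel function with its branch point removed. Unlike
  \<open>J\<^sub>\<nu>\<close> it is entire in the argument for every real \<open>\<nu>\<close>. It is polymorphic because decay is needed
  on the real line and Taylor estimates are needed in the complex plane.
\<close>

definition bessel_clifford :: "real \<Rightarrow> 'a \<Rightarrow> 'a::{real_normed_field,banach}" where
  "bessel_clifford \<nu> w = (\<Sum>m. of_real (bcoef \<nu> m) * w ^ m)"

lemma bcoef_Suc: "real (Suc m) * bcoef \<nu> (Suc m) = - bcoef (\<nu> + 1) m"
proof -
  have 1: "\<nu> + 1 + real (Suc m) = \<nu> + 1 + 1 + real m" by simp
  have 2: "fact (Suc m) = real (Suc m) * fact m" by simp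
  show ?thesis unfolding bcoef_def 1 2 by (simp del: of_nat_Suc fact_Suc)
qed

lemma bcoef_recurrence:
  "bcoef \<nu> m = (\<nu> + 1) * bcoef (\<nu> + 1) m + real m * bcoef (\<nu> + 1) m"
proof -
  have "rGamma (\<nu> + 1 + real m) = (\<nu> + 1 + real m) * rGamma (\<nu> + 1 + real m + 1)"
    by (rule rGamma_plus1[symmetric])
  then show ?thesis by (simp add: bcoef_def field_simps)
qed

lemma summable_bcoef_norm: "summable (\<lambda>m. \<bar>bcoef \<nu> m\<bar> * x ^ m)" if "x \<ge> 0" for x :: real
proof -
  obtain N :: nat where N: "real N \<ge> 2 * x + \<bar>\<nu>\<bar> + 1" using real_arch_simple by blast
  show ?thesis
  proof (rule summable_ratio_test[of "1/2" N])
    fix m assume m: "m \<ge> N"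
    hence mN: "real m \<ge> 2 * x + \<bar>\<nu>\<bar> + 1" using N by linarith
    let ?s = "\<nu> + 1 + real m"
    have s: "?s \<ge> 1" using mN that by (simp add: abs_if split: if_splits)
    have "\<bar>rGamma ?s\<bar> = ?s * \<bar>rGamma (?s + 1)\<bar>"
      unfolding rGamma_plus1[of ?s, symmetric] using s by (simp add: abs_mult)
    also have "\<dots> \<ge> 1 * \<bar>rGamma (?s + 1)\<bar>" using s by (intro mult_right_mono) auto
    finally have r: "\<bar>rGamma (?s + 1)\<bar> \<le> \<bar>rGamma ?s\<bar>" by simp
    have e: "?s + 1 = \<nu> + 1 + real (Suc m)" by simp
    have h: "x / real (Suc m) \<le> 1 / 2" using mN by (simp add: field_simps)
    have "\<bar>bcoef \<nu> (Suc m)\<bar> * x ^ Suc m = (x / real (Suc m)) * (\<bar>rGamma (?s + 1)\<bar> / fact m * x ^ m)"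
      unfolding bcoef_def e by (simp add: abs_mult field_simps)
    also have "\<dots> \<le> (1/2) * (\<bar>rGamma ?s\<bar> / fact m * x ^ m)"
      using h r that by (intro mult_mono divide_right_mono mult_nonneg_nonneg) (auto simp: mult_right_mono divide_right_mono)
    also have "\<dots> = 1/2 * (\<bar>bcoef \<nu> m\<bar> * x ^ m)" by (simp add: bcoef_def abs_mult)
    finally show "norm (\<bar>bcoef \<nu> (Suc m)\<bar> * x ^ Suc m) \<le> 1/2 * norm (\<bar>bcoef \<nu> m\<bar> * x ^ m)"
      using that by (simp add: abs_mult)
  qed simp
qed

lemma summable_norm_bessel_clifford:
  "summable (\<lambda>m. norm (of_real (bcoef \<nu> m) * w ^ m))" for w :: "'a::{real_normed_field,banach}"
  using summable_bcoef_norm[of "norm w" \<nu>] by (simp add: norm_mult norm_power)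

lemma bessel_clifford_sums:
  "(\<lambda>m. of_real (bcoef \<nu> m) * w ^ m) sums bessel_clifford \<nu> w" for w :: "'a::{real_normed_field,banach}"
  unfolding bessel_clifford_def
  by (rule summable_sums[OF summable_norm_cancel[OF summable_norm_bessel_clifford]])

lemma bessel_clifford_of_real: "bessel_clifford \<nu> (of_real x) = (of_real (bessel_clifford \<nu> x) :: 'a::{real_normed_field,banach})"
proof -
  have "(\<lambda>m. of_real (of_real (bcoef \<nu> m) * x ^ m) :: 'a) sums of_real (bessel_clifford \<nu> x)"
    using bessel_clifford_sums[of \<nu> x] by (simp only: sums_of_real_iff)
  then have "(\<lambda>m. of_real (bcoef \<nu> m) * of_real x ^ m :: 'a) sums of_real (bessel_clifford \<nu> x)" by simp
  from sums_unique2[OF bessel_clifford_sums this] show ?thesis .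
qed

lemma DERIV_bessel_clifford:
  "(bessel_clifford \<nu> has_field_derivative - bessel_clifford (\<nu> + 1) w) (at w)"
  for w :: "'a::{real_normed_field,banach}"
proof -
  have "(\<lambda>n. diffs (\<lambda>m. of_real (bcoef \<nu> m)) n * w ^ n) = (\<lambda>n. - (of_real (bcoef (\<nu> + 1) n) * w ^ n))"
  proof
    fix n
    have "of_nat (Suc n) * of_real (bcoef \<nu> (Suc n)) = (of_real (real (Suc n) * bcoef \<nu> (Suc n)) :: 'a)"
      by (simp del: of_nat_Suc)
    also have "\<dots> = - of_real (bcoef (\<nu> + 1) n)"
      unfolding bcoef_Suc by simp
    finally show "diffs (\<lambda>m. of_real (bcoef \<nu> m)) n * w ^ n = - (of_real (bcoef (\<nu> + 1) n) * w ^ n)"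
      unfolding diffs_def by simp
  qed
  moreover have "((\<lambda>x. \<Sum>n. of_real (bcoef \<nu> n) * x^n) has_field_derivative
      (\<Sum>n. diffs (\<lambda>m. of_real (bcoef \<nu> m)) n * w ^ n)) (at w)"
    by (rule termdiffs_strong_converges_everywhere) (rule sums_summable[OF bessel_clifford_sums])
  ultimately show ?thesis
    unfolding bessel_clifford_def[abs_def]
    using suminf_minus[OF sums_summable[OF bessel_clifford_sums[of "\<nu> + 1" w]]] by simp
qed

lemmas DERIV_bessel_clifford' [derivative_intros] =
  DERIV_chain2[OF DERIV_bessel_clifford]

lemma bessel_clifford_recurrence:
  "bessel_clifford \<nu> w = of_real (\<nu> + 1) * bessel_clifford (\<nu> + 1) w - w * bessel_clifford (\<nu> + 2) w"
  for w :: "'a::{real_normed_field,banach}"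
proof -
  let ?f = "\<lambda>m. of_real (real m * bcoef (\<nu> + 1) m) * w ^ m"
  have "(\<lambda>m. ?f (Suc m)) sums (- (w * bessel_clifford (\<nu> + 2) w))"
  proof -
    have e: "?f (Suc m) = - (w * (of_real (bcoef (\<nu> + 2) m) * w ^ m))" for m
    proof -
      have "real (Suc m) * bcoef (\<nu> + 1) (Suc m) = - bcoef (\<nu> + 2) m"
        using bcoef_Suc[of m "\<nu> + 1"] by (simp add: add.assoc del: of_nat_Suc)
      then have "of_real (real (Suc m) * bcoef (\<nu> + 1) (Suc m)) = (- of_real (bcoef (\<nu> + 2) m) :: 'a)"
        by (simp only: of_real_minus)
      then show ?thesis by (simp only: power_Suc) (simp only: mult_minus_left mult_minus_right mult_ac)
    qed
    show ?thesis unfolding e by (intro sums_minus sums_mult bessel_clifford_sums)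
  qed
  then have 1: "?f sums (- (w * bessel_clifford (\<nu> + 2) w))"
    by (subst (asm) sums_Suc_iff) simp
  have "(\<lambda>m. of_real (\<nu> + 1) * (of_real (bcoef (\<nu> + 1) m) * w ^ m) + ?f m) sums
     (of_real (\<nu> + 1) * bessel_clifford (\<nu> + 1) w + (- (w * bessel_clifford (\<nu> + 2) w)))"
    by (intro sums_add sums_mult bessel_clifford_sums 1)
  moreover have "of_real (\<nu> + 1) * (of_real (bcoef (\<nu> + 1) m) * w ^ m) + ?f m = of_real (bcoef \<nu> m) * w ^ m" for m
    unfolding bcoef_recurrence[of \<nu> m] by (simp add: algebra_simps)
  ultimately have "(\<lambda>m. of_real (bcoef \<nu> m) * w ^ m) sums
     (of_real (\<nu> + 1) * bessel_clifford (\<nu> + 1) w + (- (w * bessel_clifford (\<nu> + 2) w)))"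
    by simp
  from sums_unique2[OF bessel_clifford_sums this] show ?thesis by simp
qed

lemma bessel_J_eq: "bessel_J \<nu> x = (x / 2) powr \<nu> * bessel_clifford \<nu> (x\<^sup>2 / 4)" if "x > 0"
proof -
  have "(\<lambda>m. (x / 2) powr \<nu> * (of_real (bcoef \<nu> m) * (x\<^sup>2 / 4) ^ m)) sums ((x / 2) powr \<nu> * bessel_clifford \<nu> (x\<^sup>2 / 4))"
    by (rule sums_mult[OF bessel_clifford_sums])
  moreover have "(x / 2) powr \<nu> * (of_real (bcoef \<nu> m) * (x\<^sup>2 / 4) ^ m)
      = (-1) ^ m * rGamma (real m + \<nu> + 1) / fact m * (x / 2) powr (2 * real m + \<nu>)" for m
  proof -
    have "(x / 2) powr (2 * real m + \<nu>) = (x / 2) powr \<nu> * (x / 2) powr (real (2 * m))"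
      by (simp add: powr_add)
    also have "(x / 2) powr (real (2 * m)) = (x\<^sup>2 / 4) ^ m"
      using that by (subst powr_realpow) (auto simp: power_mult power_divide)
    finally show ?thesis by (simp add: bcoef_def add_ac)
  qed
  ultimately show ?thesis unfolding bessel_J_def by (simp add: sums_iff)
qed

text \<open>
  The bound \<open>J\<^sub>\<nu>(x) = O(x powr -1/2)\<close> by an energy argument. The function
  \<open>u(x) = x powr (\<nu> + 1/2) E\<^sub>\<nu>(x\<^sup>2/4)\<close> solves \<open>u'' = (\<kappa>/x\<^sup>2 - 1) u\<close>, so the energy \<open>u\<^sup>2 + u'\<^sup>2\<close> has derivative
  \<open>2 \<kappa> u u' / x\<^sup>2 \<le> \<bar>\<kappa>\<bar> (u\<^sup>2 + u'\<^sup>2) / x\<^sup>2\<close>. As \<open>1/x\<^sup>2\<close> is integrable at infinity, the energy, and with it \<open>u\<close>,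
  stays bounded.
\<close>

lemma bessel_clifford_bound:
  assumes "\<delta> > 0"
  shows "\<exists>K\<ge>0. \<forall>w\<ge>\<delta>. \<bar>bessel_clifford \<nu> w\<bar> \<le> K * w powr (- \<nu> / 2 - 1 / 4)"
proof -
  define \<alpha> \<kappa> where "\<alpha> = \<nu> + 1 / 2" and "\<kappa> = \<alpha> * (\<alpha> - 1)"
  define u where "u = (\<lambda>x::real. x powr \<alpha> * bessel_clifford \<nu> (x\<^sup>2 / 4))"
  define u1 where "u1 = (\<lambda>x::real. \<alpha> * x powr (\<alpha> - 1) * bessel_clifford \<nu> (x\<^sup>2 / 4)
                      - x powr \<alpha> * (x / 2) * bessel_clifford (\<nu> + 1) (x\<^sup>2 / 4))"
  have de: "((\<lambda>x. bessel_clifford n (x\<^sup>2 / 4)) has_real_derivative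
      - bessel_clifford (n + 1) (x\<^sup>2 / 4) * (x / 2)) (at x)" for n x
    by (rule DERIV_bessel_clifford') (auto intro!: derivative_eq_intros)
  have du: "(u has_real_derivative u1 x) (at x)" if "x > 0" for x
    unfolding u_def u1_def
    using DERIV_mult[OF has_real_derivative_powr[OF that] de, of \<alpha> \<nu>]
    by (rule DERIV_cong) (simp add: mult.assoc)
  have du1: "(u1 has_real_derivative (- u x + \<kappa> / x\<^sup>2 * u x)) (at x)" if x: "x > 0" for x
  proof -
    let ?e = "bessel_clifford \<nu> (x\<^sup>2 / 4)" and ?e1 = "bessel_clifford (\<nu> + 1) (x\<^sup>2 / 4)"
    and ?e2 = "bessel_clifford (\<nu> + 2) (x\<^sup>2 / 4)"
    have "(u1 has_real_derivative
       (\<alpha> * ((\<alpha> - 1) * x powr (\<alpha> - 1 - 1)) * ?e - \<alpha> * x powr (\<alpha> - 1) * (x / 2) * ?e1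
        - ((\<alpha> * x powr (\<alpha> - 1)) * (x / 2) * ?e1 + x powr \<alpha> * (1 / 2) * ?e1
            - x powr \<alpha> * (x / 2) * (x / 2) * bessel_clifford (\<nu> + 1 + 1) (x\<^sup>2 / 4)))) (at x)"
      unfolding u1_def
      by (rule DERIV_cong, rule DERIV_diff[OF
          DERIV_mult[OF DERIV_cmult[OF has_real_derivative_powr[OF x]] de]
          DERIV_mult[OF DERIV_mult[OF has_real_derivative_powr[OF x] DERIV_cdivide[OF DERIV_ident]] de]])
        (simp add: algebra_simps)
    also have "\<nu> + 1 + 1 = \<nu> + 2" by simp
    also have "x powr (\<alpha> - 1 - 1) = x powr \<alpha> / x\<^sup>2"
      using x powr_diff[of x \<alpha> 2] by (simp add: powr_realpow)
    also have "x powr (\<alpha> - 1) = x powr \<alpha> / x" using x by (simp add: powr_diff)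
    also have "(\<alpha> * ((\<alpha> - 1) * (x powr \<alpha> / x\<^sup>2)) * ?e - \<alpha> * (x powr \<alpha> / x) * (x / 2) * ?e1
        - ((\<alpha> * (x powr \<alpha> / x)) * (x / 2) * ?e1 + x powr \<alpha> * (1 / 2) * ?e1
            - x powr \<alpha> * (x / 2) * (x / 2) * ?e2))
      = x powr \<alpha> * (\<kappa> / x\<^sup>2 * ?e - ((\<alpha> + 1 / 2) * ?e1 - x\<^sup>2 / 4 * ?e2))"
      using x by (simp add: \<kappa>_def field_simps power2_eq_square)
    also have "(\<alpha> + 1 / 2) * ?e1 - x\<^sup>2 / 4 * ?e2 = ?e"
      using bessel_clifford_recurrence[of \<nu> "x\<^sup>2/4"] by (simp add: \<alpha>_def)
    finally show ?thesis by (simp add: u_def algebra_simps)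
  qed
  \<comment> \<open>The exponential factor absorbs the growth rate of the energy, so that this product decreases.\<close>
  define En where "En = (\<lambda>x. ((u x)\<^sup>2 + (u1 x)\<^sup>2) * exp (\<bar>\<kappa>\<bar> / x))"
  define x0 where "x0 = 2 * sqrt \<delta>"
  have x0: "x0 > 0" using assms by (simp add: x0_def)
  have En: "En x \<le> En x0" if "x \<ge> x0" for x
  proof (rule DERIV_nonpos_imp_nonincreasing[OF that])
    fix y assume y: "x0 \<le> y" "y \<le> x"
    hence y0: "y > 0" using x0 by simp
    have "(En has_real_derivative
        ((2 * u y * u1 y + 2 * u1 y * (- u y + \<kappa> / y\<^sup>2 * u y)) * exp (\<bar>\<kappa>\<bar> / y)
         + ((u y)\<^sup>2 + (u1 y)\<^sup>2) * (exp (\<bar>\<kappa>\<bar> / y) * (- \<bar>\<kappa>\<bar> / y\<^sup>2)))) (at y)"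
    proof -
      have "((\<lambda>x. \<bar>\<kappa>\<bar> / x) has_real_derivative - \<bar>\<kappa>\<bar> / y\<^sup>2) (at y)"
        using y0 by (auto intro!: derivative_eq_intros simp: power2_eq_square)
      note d = DERIV_chain2[OF DERIV_exp this]
      show ?thesis unfolding En_def
        by (rule DERIV_cong, rule DERIV_mult[OF DERIV_add[OF DERIV_power[OF du[OF y0]] DERIV_power[OF du1[OF y0]]] d])
          (simp add: algebra_simps)
    qed
    also have "((2 * u y * u1 y + 2 * u1 y * (- u y + \<kappa> / y\<^sup>2 * u y)) * exp (\<bar>\<kappa>\<bar> / y)
         + ((u y)\<^sup>2 + (u1 y)\<^sup>2) * (exp (\<bar>\<kappa>\<bar> / y) * (- \<bar>\<kappa>\<bar> / y\<^sup>2))) = (((2 * (u y * u1 y) * \<kappa> - ((u y)\<^sup>2 + (u1 y)\<^sup>2) * \<bar>\<kappa>\<bar>) / y\<^sup>2) * exp (\<bar>\<kappa>\<bar> / y))" (is "?l = ?r")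
      using y0 by (simp add: field_simps)
    finally have d: "(En has_real_derivative ?r) (at y)" .
    have "2 * (u y * u1 y) * \<kappa> \<le> \<bar>2 * (u y * u1 y)\<bar> * \<bar>\<kappa>\<bar>" by (metis abs_ge_self abs_mult)
    also have "\<dots> \<le> ((u y)\<^sup>2 + (u1 y)\<^sup>2) * \<bar>\<kappa>\<bar>"
      using sum_squares_bound[of "\<bar>u y\<bar>" "\<bar>u1 y\<bar>"] by (intro mult_right_mono) (auto simp: abs_mult)
    finally have "?r \<le> 0" by (intro mult_nonpos_nonneg divide_nonpos_nonneg) auto
    with d show "\<exists>z. (En has_real_derivative z) (at y) \<and> z \<le> 0" by blast
  qed
  define K where "K = sqrt (En x0) * 2 powr (- \<alpha>)"
  have K0: "K \<ge> 0" by (simp add: K_def En_def)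
  have "\<bar>bessel_clifford \<nu> w\<bar> \<le> K * w powr (- \<nu> / 2 - 1 / 4)" if w: "w \<ge> \<delta>" for w
  proof -
    define x where "x = 2 * sqrt w"
    have w0: "w > 0" using w assms by simp
    have x: "x \<ge> x0" using w by (simp add: x_def x0_def)
    have "(u x)\<^sup>2 * 1 \<le> ((u x)\<^sup>2 + (u1 x)\<^sup>2) * exp (\<bar>\<kappa>\<bar> / x)" using x x0 by (intro mult_mono) auto
    also have "\<dots> \<le> En x0" using En[OF x] by (simp add: En_def)
    finally have "\<bar>u x\<bar> \<le> sqrt (En x0)" by (simp add: real_le_rsqrt)
    moreover have "x\<^sup>2 / 4 = w" using w0 by (simp add: x_def power_mult_distrib)
    ultimately have "x powr \<alpha> * \<bar>bessel_clifford \<nu> w\<bar> \<le> sqrt (En x0)"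
      by (simp add: u_def abs_mult)
    then have "\<bar>bessel_clifford \<nu> w\<bar> \<le> sqrt (En x0) * x powr (- \<alpha>)"
      using x x0 by (simp add: powr_minus field_simps)
    also have "x powr (- \<alpha>) = 2 powr (- \<alpha>) * w powr (- \<nu> / 2 - 1 / 4)"
    proof -
      have "1 / 2 * (- \<alpha>) = - \<nu> / 2 - 1 / 4" by (simp add: \<alpha>_def)
      then show ?thesis using w0 by (simp only: x_def powr_mult powr_powr powr_half_sqrt[symmetric])
    qed
    finally show ?thesis by (simp add: K_def)
  qed
  with K0 show ?thesis by blast
qed

section \<open>The Euler--Maclaurin defect\<close>

text \<open>
  These are \<open>B\<^sub>k/k!\<close> for the Bernoulli numbers with \<open>B\<^sub>1 = 1/2\<close>: the recursion says that their
  generating function times \<open>(e\<^sup>t - 1)/t\<close> is \<open>e\<^sup>t\<close>.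
\<close>

fun em_coeff :: "nat \<Rightarrow> real" where
  "em_coeff k = 1 / fact k - (\<Sum>j<k. em_coeff j / fact (Suc k - j))"

declare em_coeff.simps [simp del]

lemma em_coeff_0 [simp]: "em_coeff 0 = 1"
  by (subst em_coeff.simps) simp

lemma em_coeff_sum: "(\<Sum>j\<le>k. em_coeff j / fact (Suc k - j)) = 1 / fact k"
proof -
  have "(\<Sum>j\<le>k. em_coeff j / fact (Suc k - j)) = em_coeff k + (\<Sum>j<k. em_coeff j / fact (Suc k - j))"
    unfolding ivl_disj_un_singleton(2)[symmetric] by simp
  also have "em_coeff k = 1 / fact k - (\<Sum>j<k. em_coeff j / fact (Suc k - j))"
    by (rule em_coeff.simps)
  finally show ?thesis by simp
qed

text \<open>
  The error of the Euler--Maclaurin formula of order \<open>N\<close> on the single interval from \<open>x\<close> to \<open>x + h\<close>. The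
  argument \<open>G\<close> is a sequence in which each function is the derivative of the preceding one; the summand
  is \<open>G 1\<close> and \<open>G 0\<close> is a primitive of it.
\<close>

definition em_defect :: "nat \<Rightarrow> real \<Rightarrow> (nat \<Rightarrow> complex \<Rightarrow> complex) \<Rightarrow> real \<Rightarrow> complex" where
  "em_defect N h G x = of_real h * G 1 (of_real (x + h))
     - (\<Sum>j<N. of_real (em_coeff j * h ^ j) * (G j (of_real (x + h)) - G j (of_real x)))"

text \<open>
  Every \<open>G j\<close> is replaced by its Taylor polynomial at \<open>x\<close> whose remainder is of order \<open>N\<close> in total. The
  polynomial parts cancel by the defining property of the coefficients, and each of the remainders is
  at most \<open>h\<^sup>N B\<close>.
\<close>

lemma em_defect_bound:
  assumes N: "N \<ge> 2" and h: "h \<ge> 0"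
    and deriv: "\<And>j t. j < N \<Longrightarrow> t \<in> {x..x+h} \<Longrightarrow> (G j has_field_derivative G (Suc j) (of_real t)) (at (of_real t))"
    and bound: "\<And>t. t \<in> {x..x+h} \<Longrightarrow> cmod (G N (of_real t)) \<le> B"
  shows "cmod (em_defect N h G x) \<le> (1 + (\<Sum>j<N. \<bar>em_coeff j\<bar>)) * h ^ N * B"
proof -
  \<comment> \<open>Scaled Taylor coefficients at the left end, and the scaled Taylor remainders.\<close>
  define D where "D = (\<lambda>k. of_real (h ^ k) * G k (of_real x))"
  define T where "T = (\<lambda>j. of_real (h ^ j) * G j (of_real (x + h)) - (\<Sum>i\<le>N-1-j. D (j+i) / fact i))"
  have B0: "B \<ge> 0" using order_trans[OF norm_ge_zero bound[of x]] h by simp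
  have T: "cmod (T j) \<le> h ^ N * B" if j: "j < N" for j
  proof -
    let ?S = "closed_segment (of_real x) (of_real (x + h)) :: complex set"
    have S: "\<exists>t\<in>{x..x+h}. z = of_real t" if "z \<in> ?S" for z
      using that h closed_segment_of_real[of x "x+h"] by (auto simp: closed_segment_eq_real_ivl)
    have e: "j + Suc (N-1-j) = N" using j by simp
    have "cmod (G (j+0) (of_real (x+h)) - (\<Sum>i\<le>N-1-j. G (j+i) (of_real x) * (of_real (x+h) - of_real x) ^ i / fact i))
        \<le> B * cmod (of_real (x+h) - of_real x) ^ Suc (N-1-j) / fact (N-1-j)"
    proof (rule complex_Taylor[where S = ?S])
      fix i z assume z: "z \<in> ?S" and i: "i \<le> N-1-j"
      obtain t where t: "t \<in> {x..x+h}" "z = of_real t" using S[OF z] by blast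
      have "(G (j+i) has_field_derivative G (Suc (j+i)) z) (at z)"
        unfolding t(2) using i j by (intro deriv t(1)) simp
      then show "(G (j+i) has_field_derivative G (j + Suc i) z) (at z within ?S)"
        by (simp add: has_field_derivative_at_within)
    next
      fix z assume z: "z \<in> ?S"
      obtain t where t: "t \<in> {x..x+h}" "z = of_real t" using S[OF z] by blast
      show "cmod (G (j + Suc (N-1-j)) z) \<le> B" unfolding e t(2) by (rule bound[OF t(1)])
    qed auto
    also have "cmod (of_real (x+h) - of_real x) = h" using h by simp
    also have "B * h ^ Suc (N-1-j) / fact (N-1-j) \<le> B * h ^ Suc (N-1-j) / 1"
      using B0 h by (intro divide_left_mono) auto
    also have "Suc (N-1-j) = N - j" using j by simp
    finally have 1: "cmod (G j (of_real (x+h)) - (\<Sum>i\<le>N-1-j. G (j+i) (of_real x) * of_real h ^ i / fact i)) \<le> B * h ^ (N-j)"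
      by simp
    have "T j = of_real (h^j) * (G j (of_real (x+h)) - (\<Sum>i\<le>N-1-j. G (j+i) (of_real x) * of_real h ^ i / fact i))"
      unfolding T_def D_def by (simp add: right_diff_distrib sum_distrib_left power_add mult_ac)
    then have "cmod (T j) \<le> h ^ j * (B * h ^ (N-j))"
      using 1 h by (simp add: norm_mult norm_power mult_left_mono)
    also have "\<dots> = h ^ N * B" using j by (simp flip: power_add)
    finally show ?thesis .
  qed
  have a: "of_real h * G 1 (of_real (x+h)) = T 1 + (\<Sum>k\<in>{1..<N}. D k / fact (k-1))"
  proof -
    have "(\<Sum>i\<le>N-1-1. D (1+i) / fact i) = (\<Sum>k\<in>{1..<N}. D k / fact (k-1))"
      using N by (intro sum.reindex_bij_witness[of _ "\<lambda>k. k-1" "\<lambda>i. 1+i"]) auto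
    then show ?thesis unfolding T_def by simp
  qed
  have b: "of_real (h ^ j) * (G j (of_real (x+h)) - G j (of_real x)) = T j + (\<Sum>k\<in>{j<..<N}. D k / fact (k-j))" if "j < N" for j
  proof -
    have "(\<Sum>i\<le>N-1-j. D (j+i) / fact i) = (\<Sum>k\<in>{j..<N}. D k / fact (k-j))"
      using that by (intro sum.reindex_bij_witness[of _ "\<lambda>k. k-j" "\<lambda>i. j+i"]) auto
    also have "\<dots> = D j + (\<Sum>k\<in>{j<..<N}. D k / fact (k-j))"
    proof -
      have "{j..<N} = insert j {j<..<N}" using that by auto
      then show ?thesis by simp
    qed
    finally show ?thesis unfolding T_def by (simp add: right_diff_distrib D_def)
  qed
  have "(\<Sum>j<N. of_real (em_coeff j) * (\<Sum>k\<in>{j<..<N}. D k / fact (k-j)))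
      = (\<Sum>j<N. \<Sum>k\<in>{k. k < N \<and> j < k}. of_real (em_coeff j) * (D k / fact (k-j)))"
    by (intro sum.cong refl) (auto simp: sum_distrib_left intro!: sum.cong)
  also have "\<dots> = (\<Sum>k<N. \<Sum>j\<in>{j. j < N \<and> j < k}. of_real (em_coeff j) * (D k / fact (k-j)))"
    using sum.swap_restrict[of "{..<N}" "{..<N}" "\<lambda>j k. of_real (em_coeff j) * (D k / fact (k-j))" "\<lambda>j k. j < k"]
    by simp
  also have "\<dots> = (\<Sum>k<N. D k * of_real (\<Sum>j<k. em_coeff j / fact (k-j)))"
    by (intro sum.cong refl) (auto simp: sum_distrib_left mult_ac intro!: sum.cong)
  also have "\<dots> = (\<Sum>k\<in>{1..<N}. D k * of_real (\<Sum>j<k. em_coeff j / fact (k-j)))"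
    by (rule sum.mono_neutral_right) (auto simp: Suc_le_eq)
  also have "\<dots> = (\<Sum>k\<in>{1..<N}. D k / fact (k-1))"
  proof (intro sum.cong refl)
    fix k assume "k \<in> {1..<N}"
    then obtain k' where k': "k = Suc k'" by (cases k) auto
    show "D k * of_real (\<Sum>j<k. em_coeff j / fact (k-j)) = D k / fact (k-1)"
      unfolding k' lessThan_Suc_atMost em_coeff_sum by simp
  qed
  finally have c: "(\<Sum>j<N. of_real (em_coeff j) * (\<Sum>k\<in>{j<..<N}. D k / fact (k-j))) = (\<Sum>k\<in>{1..<N}. D k / fact (k-1))" .
  have "em_defect N h G x = T 1 + (\<Sum>k\<in>{1..<N}. D k / fact (k-1))
     - (\<Sum>j<N. of_real (em_coeff j) * (of_real (h ^ j) * (G j (of_real (x+h)) - G j (of_real x))))"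
    unfolding em_defect_def a by (simp add: mult_ac)
  also have "(\<Sum>j<N. of_real (em_coeff j) * (of_real (h ^ j) * (G j (of_real (x+h)) - G j (of_real x))))
     = (\<Sum>j<N. of_real (em_coeff j) * (T j + (\<Sum>k\<in>{j<..<N}. D k / fact (k-j))))"
    by (intro sum.cong refl) (simp only: b lessThan_iff)
  also have "\<dots> = (\<Sum>j<N. of_real (em_coeff j) * T j) + (\<Sum>k\<in>{1..<N}. D k / fact (k-1))"
    unfolding c[symmetric] by (simp add: ring_distribs sum.distrib)
  finally have "em_defect N h G x = T 1 - (\<Sum>j<N. of_real (em_coeff j) * T j)" by simp
  then have "cmod (em_defect N h G x) \<le> cmod (T 1) + cmod (\<Sum>j<N. of_real (em_coeff j) * T j)"
    by (simp add: norm_triangle_ineq4)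
  also have "\<dots> \<le> h ^ N * B + (\<Sum>j<N. \<bar>em_coeff j\<bar> * (h ^ N * B))"
    using N by (intro add_mono T order.trans[OF norm_sum] sum_mono) (auto simp: norm_mult intro!: mult_left_mono T)
  also have "\<dots> = (1 + (\<Sum>j<N. \<bar>em_coeff j\<bar>)) * h ^ N * B"
    by (simp add: algebra_simps sum_distrib_left)
  finally show ?thesis .
qed

lemma sum_em_defect:
  "(\<Sum>n<X. em_defect N h G (real (Suc n) * h)) = (\<Sum>n<X. of_real h * G 1 (of_real (real (Suc (Suc n)) * h)))
    - (\<Sum>j<N. of_real (em_coeff j * h ^ j) * (G j (of_real (real (Suc X) * h)) - G j (of_real h)))"
proof -
  have e: "real (Suc n) * h + h = real (Suc (Suc n)) * h" for n by (simp add: algebra_simps)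
  have "(\<Sum>n<X. em_defect N h G (real (Suc n) * h)) = (\<Sum>n<X. of_real h * G 1 (of_real (real (Suc (Suc n)) * h)))
    - (\<Sum>j<N. of_real (em_coeff j * h ^ j) * (\<Sum>n<X. G j (of_real (real (Suc (Suc n)) * h)) - G j (of_real (real (Suc n) * h))))"
  proof -
    have "(\<Sum>n<X. \<Sum>j<N. of_real (em_coeff j * h ^ j) * (G j (of_real (real (Suc (Suc n)) * h)) - G j (of_real (real (Suc n) * h))))
      = (\<Sum>j<N. of_real (em_coeff j * h ^ j) * (\<Sum>n<X. G j (of_real (real (Suc (Suc n)) * h)) - G j (of_real (real (Suc n) * h))))"
      by (subst sum.swap) (simp only: sum_distrib_left)
    then show ?thesis unfolding em_defect_def e by (subst sum_subtractf) (simp only:)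
  qed
  moreover have "(\<Sum>n<X. G j (of_real (real (Suc (Suc n)) * h)) - G j (of_real (real (Suc n) * h)))
     = G j (of_real (real (Suc X) * h)) - G j (of_real h)" for j
    using sum_lessThan_telescope[of "\<lambda>n. G j (of_real (real (Suc n) * h))" X] by simp
  ultimately show ?thesis by (simp only:)
qed

text \<open>
  The \<open>j\<close>-th derivative of \<open>z\<^sup>\<rho>/\<rho>\<close>. The normalization makes entry 1 of the sequence the plain power
  \<open>z powr (\<rho> - 1)\<close>; it requires \<open>\<rho> \<noteq> 0\<close>, which for \<open>\<rho> = 1 - s\<close> is the exclusion of the pole of zeta.
\<close>

definition powr_jet :: "complex \<Rightarrow> nat \<Rightarrow> complex \<Rightarrow> complex" where
  "powr_jet \<rho> j z = (\<Prod>i<j. \<rho> - of_nat i) / \<rho> * z powr (\<rho> - of_nat j)"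

lemma powr_jet_1: "\<rho> \<noteq> 0 \<Longrightarrow> powr_jet \<rho> 1 z = z powr (\<rho> - 1)"
  by (simp add: powr_jet_def)

lemma DERIV_powr_jet:
  assumes "z \<notin> \<real>\<^sub>\<le>\<^sub>0"
  shows "(powr_jet \<rho> j has_field_derivative powr_jet \<rho> (Suc j) z) (at z)"
proof -
  have "((\<lambda>z. (\<Prod>i<j. \<rho> - of_nat i) / \<rho> * z powr (\<rho> - of_nat j)) has_field_derivative
      (\<Prod>i<j. \<rho> - of_nat i) / \<rho> * ((\<rho> - of_nat j) * z powr (\<rho> - of_nat j - 1))) (at z)"
    by (rule DERIV_cmult[OF has_field_derivative_powr[OF assms]])
  also have "(\<Prod>i<j. \<rho> - of_nat i) / \<rho> * ((\<rho> - of_nat j) * z powr (\<rho> - of_nat j - 1)) = powr_jet \<rho> (Suc j) z"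
    by (simp add: powr_jet_def diff_diff_eq add_ac)
  finally show ?thesis by (simp add: powr_jet_def[abs_def])
qed

lemma norm_powr_jet:
  "x > 0 \<Longrightarrow> cmod (powr_jet \<rho> j (of_real x)) = cmod ((\<Prod>i<j. \<rho> - of_nat i) / \<rho>) * x powr (Re \<rho> - real j)"
  by (subst powr_jet_def, subst norm_mult) (simp add: norm_powr_real_powr)

lemma powr_jet_scale:
  assumes "h > 0" "x > 0"
  shows "of_real (h ^ j) * powr_jet \<rho> j (of_real (x * h)) = of_real h powr \<rho> * powr_jet \<rho> j (of_real x)"
proof -
  have "of_real (x * h) powr (\<rho> - of_nat j) = of_real x powr (\<rho> - of_nat j) * (of_real h powr \<rho> / of_real h ^ j)"
    using assms by (simp add: powr_times_real powr_diff powr_nat power_mult_distrib)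
  then show ?thesis using assms by (simp add: powr_jet_def)
qed

text \<open>
  Powers are homogeneous, so the step \<open>h\<close> can be scaled to 1. This is what turns the contribution of a
  power to the sum into an exact multiple of \<open>h\<^sup>\<rho>\<close>.
\<close>

lemma em_defect_powr_jet_scale:
  assumes "h > 0" "x > 0"
  shows "em_defect N h (powr_jet \<rho>) (x * h) = of_real h powr \<rho> * em_defect N 1 (powr_jet \<rho>) x"
proof -
  have e: "x * h + h = (x + 1) * h" by (simp add: algebra_simps)
  have s1: "of_real (h ^ j) * powr_jet \<rho> j (of_real ((x+1) * h)) = of_real h powr \<rho> * powr_jet \<rho> j (of_real (x + 1))" for j
    using assms by (intro powr_jet_scale) auto
  have "of_real (em_coeff j * h ^ j) * (powr_jet \<rho> j (of_real ((x+1) * h)) - powr_jet \<rho> j (of_real (x * h)))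
     = of_real h powr \<rho> * (of_real (em_coeff j) * (powr_jet \<rho> j (of_real (x+1)) - powr_jet \<rho> j (of_real x)))" for j
    using s1[of j] powr_jet_scale[OF assms, of j \<rho>] by (simp add: algebra_simps)
  then show ?thesis using s1[of 1] unfolding em_defect_def e
    by (simp add: right_diff_distrib sum_distrib_left)
qed

lemma em_defect_powr_jet_bound:
  assumes N: "N \<ge> 2" and x: "x > 0" and s: "Re \<rho> \<le> real N"
  shows "cmod (em_defect N 1 (powr_jet \<rho>) x)
    \<le> (1 + (\<Sum>j<N. \<bar>em_coeff j\<bar>)) * cmod ((\<Prod>i<N. \<rho> - of_nat i) / \<rho>) * x powr (Re \<rho> - real N)"
proof -
  have "cmod (em_defect N 1 (powr_jet \<rho>) x)
    \<le> (1 + (\<Sum>j<N. \<bar>em_coeff j\<bar>)) * 1 ^ N * (cmod ((\<Prod>i<N. \<rho> - of_nat i) / \<rho>) * x powr (Re \<rho> - real N))"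
  proof (rule em_defect_bound[OF N])
    fix t assume t: "t \<in> {x..x+1}"
    then have "t > 0" using x by auto
    then show "cmod (powr_jet \<rho> N (of_real t)) \<le> cmod ((\<Prod>i<N. \<rho> - of_nat i) / \<rho>) * x powr (Re \<rho> - real N)"
      using t x s by (simp add: norm_powr_jet powr_mono2' mult_left_mono)
    fix j :: nat
    show "(powr_jet \<rho> j has_field_derivative powr_jet \<rho> (Suc j) (of_real t)) (at (of_real t))"
      using \<open>t > 0\<close> by (intro DERIV_powr_jet) auto
  qed auto
  then show ?thesis by (simp add: mult_ac)
qed

section \<open>The Riemann zeta function by Euler--Maclaurin summation\<close>

text \<open>
  The zeta function by Euler--Maclaurin summation of \<open>n powr -s\<close> from \<open>n = 1\<close>. The terms are written so
  that the boundary values at infinity have been dropped; for \<open>Re s > 1\<close> they vanish, and elsewhere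
  dropping them is the analytic continuation.
\<close>

definition zeta_em :: "nat \<Rightarrow> complex \<Rightarrow> complex" where
  "zeta_em N s = 1 - (\<Sum>j<N. of_real (em_coeff j) * powr_jet (1 - s) j 1)
     + (\<Sum>n. em_defect N 1 (powr_jet (1 - s)) (real (Suc n)))"

lemma summable_Suc_powr: "c < -1 \<Longrightarrow> summable (\<lambda>n. real (Suc n) powr c)"
  using summable_real_powr_iff[of c] summable_Suc_iff[of "\<lambda>n. real n powr c"] by simp

lemma summable_em_defect_powr_jet:
  assumes "N \<ge> 2" "Re s > 2 - real N"
  shows "summable (\<lambda>n. cmod (em_defect N 1 (powr_jet (1 - s)) (real (Suc n))))"
proof (rule summable_comparison_test)
  show "\<exists>M. \<forall>n\<ge>M. norm (cmod (em_defect N 1 (powr_jet (1 - s)) (real (Suc n)))) \<le>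
     (1 + (\<Sum>j<N. \<bar>em_coeff j\<bar>)) * cmod ((\<Prod>i<N. (1-s) - of_nat i) / (1-s)) * real (Suc n) powr (Re (1-s) - real N)"
    using assms by (intro exI[of _ 0] allI impI) (simp only: real_norm_def abs_norm_cancel, rule em_defect_powr_jet_bound, auto)
  show "summable (\<lambda>n. (1 + (\<Sum>j<N. \<bar>em_coeff j\<bar>)) * cmod ((\<Prod>i<N. (1-s) - of_nat i) / (1-s)) * real (Suc n) powr (Re (1-s) - real N))"
    using assms by (intro summable_mult summable_Suc_powr) simp
qed

text \<open>
  The expression is a regularized sum: the partial sums of the Dirichlet series minus the boundary
  terms at the upper end. In this form it can be compared for different orders \<open>N\<close>.
\<close>

lemma zeta_em_partial_sums:
  assumes N: "N \<ge> 2" and s: "Re s > 2 - real N" "s \<noteq> 1"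
  shows "(\<lambda>X. (\<Sum>n<Suc X. 1 / of_nat (Suc n) powr s)
      - (\<Sum>j<N. of_real (em_coeff j) * powr_jet (1 - s) j (of_nat (Suc X)))) \<longlonglongrightarrow> zeta_em N s"
proof -
  let ?J = "powr_jet (1 - s)"
  have "(\<lambda>X. \<Sum>n<X. em_defect N 1 ?J (real (Suc n) * 1)) \<longlonglongrightarrow> (\<Sum>n. em_defect N 1 ?J (real (Suc n)))"
    using summable_norm_cancel[OF summable_em_defect_powr_jet[OF N s(1)]] by (simp add: summable_LIMSEQ)
  from tendsto_add[OF tendsto_const this, of "1 - (\<Sum>j<N. of_real (em_coeff j) * ?J j 1)"]
  have "(\<lambda>X. 1 - (\<Sum>j<N. of_real (em_coeff j) * ?J j 1) + (\<Sum>n<X. em_defect N 1 ?J (real (Suc n) * 1))) \<longlonglongrightarrow> zeta_em N s"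
    by (simp add: zeta_em_def)
  also have "(\<lambda>X. 1 - (\<Sum>j<N. of_real (em_coeff j) * ?J j 1) + (\<Sum>n<X. em_defect N 1 ?J (real (Suc n) * 1)))
    = (\<lambda>X. (\<Sum>n<Suc X. 1 / of_nat (Suc n) powr s) - (\<Sum>j<N. of_real (em_coeff j) * ?J j (of_nat (Suc X))))"
  proof
    fix X
    have "?J 1 (of_real (real (Suc (Suc n)) * 1)) = 1 / of_nat (Suc (Suc n)) powr s" for n
      using s by (simp add: powr_jet_def powr_minus_divide)
    then have "(\<Sum>n<X. of_real 1 * ?J 1 (of_real (real (Suc (Suc n)) * 1))) = (\<Sum>n<X. 1 / of_nat (Suc (Suc n)) powr s)"
      by simp
    moreover have "(\<Sum>n<Suc X. 1 / of_nat (Suc n) powr s :: complex) = 1 + (\<Sum>n<X. 1 / of_nat (Suc (Suc n)) powr s)"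
      by (subst sum.lessThan_Suc_shift) simp
    ultimately show "1 - (\<Sum>j<N. of_real (em_coeff j) * ?J j 1) + (\<Sum>n<X. em_defect N 1 ?J (real (Suc n) * 1))
      = (\<Sum>n<Suc X. 1 / of_nat (Suc n) powr s) - (\<Sum>j<N. of_real (em_coeff j) * ?J j (of_nat (Suc X)))"
      unfolding sum_em_defect by (simp add: algebra_simps sum_subtractf)
  qed
  finally show ?thesis .
qed

lemma powr_jet_tendsto_0:
  assumes "Re \<rho> < real j"
  shows "(\<lambda>X. powr_jet \<rho> j (of_nat (Suc X))) \<longlonglongrightarrow> 0"
proof (rule tendsto_norm_zero_cancel)
  have "((\<lambda>X. real (Suc X) powr (Re \<rho> - real j)) \<longlongrightarrow> 0) sequentially"
    using assms by (intro tendsto_neg_powr filterlim_compose[OF filterlim_real_sequentially filterlim_Suc]) auto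
  from tendsto_mult_right_zero[OF this]
  show "(\<lambda>X. cmod (powr_jet \<rho> j (of_nat (Suc X)))) \<longlonglongrightarrow> 0"
    using norm_powr_jet[of "real (Suc _)" \<rho> j] by (simp del: of_nat_Suc)
qed

text \<open>
  The boundary terms of order \<open>j \<ge> N\<close> tend to 0 on the half-plane where the order \<open>N\<close> is admissible, so
  they do not change the limit.
\<close>

lemma zeta_em_mono:
  assumes N: "2 \<le> N" "N \<le> M" and s: "Re s > 2 - real N" "s \<noteq> 1"
  shows "zeta_em N s = zeta_em M s"
proof -
  let ?J = "powr_jet (1 - s)"
  have "(\<lambda>X. (\<Sum>j\<in>{N..<M}. of_real (em_coeff j) * ?J j (of_nat (Suc X)))) \<longlonglongrightarrow> (\<Sum>j\<in>{N..<M}. of_real (em_coeff j) * 0)"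
    using s by (intro tendsto_sum tendsto_mult tendsto_const powr_jet_tendsto_0) auto
  from tendsto_diff[OF zeta_em_partial_sums[OF N(1) s] this]
  have "(\<lambda>X. (\<Sum>n<Suc X. 1 / of_nat (Suc n) powr s)
      - ((\<Sum>j\<in>{0..<N}. of_real (em_coeff j) * ?J j (of_nat (Suc X))) + (\<Sum>j\<in>{N..<M}. of_real (em_coeff j) * ?J j (of_nat (Suc X))))) \<longlonglongrightarrow> zeta_em N s"
    by (simp add: diff_diff_eq lessThan_atLeast0)
  then have "(\<lambda>X. (\<Sum>n<Suc X. 1 / of_nat (Suc n) powr s)
      - (\<Sum>j<M. of_real (em_coeff j) * ?J j (of_nat (Suc X)))) \<longlonglongrightarrow> zeta_em N s"
    using N by (subst (asm) sum.atLeastLessThan_concat) (auto simp: lessThan_atLeast0)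
  moreover have "(\<lambda>X. (\<Sum>n<Suc X. 1 / of_nat (Suc n) powr s)
      - (\<Sum>j<M. of_real (em_coeff j) * ?J j (of_nat (Suc X)))) \<longlonglongrightarrow> zeta_em M s"
    using N s by (intro zeta_em_partial_sums) auto
  ultimately show ?thesis by (rule LIMSEQ_unique)
qed

lemma zeta_em_sums:
  assumes "N \<ge> 2" "Re s > 1"
  shows "(\<lambda>n. 1 / of_nat (Suc n) powr s) sums zeta_em N s"
proof -
  let ?J = "powr_jet (1 - s)"
  have s: "s \<noteq> 1" "Re s > 2 - real N" using assms by auto
  have "(\<lambda>X. (\<Sum>j<N. of_real (em_coeff j) * ?J j (of_nat (Suc X)))) \<longlonglongrightarrow> (\<Sum>j<N. of_real (em_coeff j) * 0)"
    using assms by (intro tendsto_sum tendsto_mult tendsto_const powr_jet_tendsto_0) auto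
  from tendsto_add[OF zeta_em_partial_sums[OF assms(1) s(2,1)] this]
  have "(\<lambda>X. \<Sum>n<Suc X. 1 / of_nat (Suc n) powr s) \<longlonglongrightarrow> zeta_em N s" by simp
  then show ?thesis unfolding sums_def by (rule LIMSEQ_offset[of _ 1, unfolded Suc_eq_plus1[symmetric]])
qed

text \<open>
  The defects decay like a power of \<open>n\<close> with an exponent that is bounded away from \<open>-1\<close> locally
  uniformly in \<open>s\<close>, so the series converges locally uniformly.
\<close>

lemma holomorphic_zeta_em:
  assumes N: "N \<ge> 2"
  shows "zeta_em N holomorphic_on ({s. Re s > 2 - real N} - {1})"
proof -
  let ?U = "{s. Re s > 2 - real N} - {1::complex}"
  have U: "open ?U" by (intro open_Diff open_halfspace_Re_gt) auto
  have hJ: "(\<lambda>s. powr_jet (1 - s) j (of_real x)) holomorphic_on ?U" if "x > 0" for j x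
    unfolding powr_jet_def using that by (intro holomorphic_intros) auto
  have hE: "(\<lambda>s. em_defect N 1 (powr_jet (1 - s)) (real (Suc n))) holomorphic_on ?U" for n
    unfolding em_defect_def by (intro holomorphic_intros hJ) auto
  have "(\<lambda>s. \<Sum>n. em_defect N 1 (powr_jet (1 - s)) (real (Suc n))) holomorphic_on ?U"
  proof (rule holomorphic_uniform_sequence[OF U, where f = "\<lambda>X s. \<Sum>n<X. em_defect N 1 (powr_jet (1 - s)) (real (Suc n))"])
    fix s0 assume s0: "s0 \<in> ?U"
    obtain d where d: "d > 0" "cball s0 d \<subseteq> ?U" using open_contains_cball U s0 by blast
    have "s0 - of_real d \<in> cball s0 d" using d by (simp add: dist_norm)
    from subsetD[OF d(2) this] have c: "1 - (Re s0 - d) - real N < -1" by simp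
    have "continuous_on (cball s0 d) (\<lambda>s. cmod ((\<Prod>i<N. (1-s) - of_nat i) / (1-s)))"
      using d by (intro continuous_intros) auto
    then have "compact ((\<lambda>s. cmod ((\<Prod>i<N. (1-s) - of_nat i) / (1-s))) ` cball s0 d)"
      by (intro compact_continuous_image) auto
    from compact_imp_bounded[OF this]
    obtain B where B: "\<And>s. s \<in> cball s0 d \<Longrightarrow> cmod ((\<Prod>i<N. (1-s) - of_nat i) / (1-s)) \<le> B"
      unfolding bounded_iff ball_simps real_norm_def abs_norm_cancel by blast
    let ?C = "(1 + (\<Sum>j<N. \<bar>em_coeff j\<bar>))"
    have C: "?C \<ge> 0" by (simp add: sum_nonneg)
    have B0: "B \<ge> 0" using order_trans[OF norm_ge_zero B[of s0]] d by simp
    have "uniform_limit (cball s0 d) (\<lambda>X s. \<Sum>n<X. em_defect N 1 (powr_jet (1 - s)) (real (Suc n)))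
       (\<lambda>s. \<Sum>n. em_defect N 1 (powr_jet (1 - s)) (real (Suc n))) sequentially"
    proof (rule Weierstrass_m_test[where M = "\<lambda>n. ?C * B * real (Suc n) powr (1 - (Re s0 - d) - real N)"])
      show "summable (\<lambda>n. ?C * B * real (Suc n) powr (1 - (Re s0 - d) - real N))"
        by (intro summable_mult summable_Suc_powr c)
      fix n s assume s: "s \<in> cball s0 d"
      have "\<bar>Re (s0 - s)\<bar> \<le> d" using s abs_Re_le_cmod[of "s0 - s"] by (simp add: dist_norm)
      then have re: "Re s \<ge> Re s0 - d" by simp
      have "cmod (em_defect N 1 (powr_jet (1 - s)) (real (Suc n)))
         \<le> ?C * cmod ((\<Prod>i<N. (1-s) - of_nat i) / (1-s)) * real (Suc n) powr (Re (1-s) - real N)"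
        using N s d by (intro em_defect_powr_jet_bound) auto
      also have "\<dots> \<le> ?C * B * real (Suc n) powr (1 - (Re s0 - d) - real N)"
        using re C B0 by (intro mult_mono[OF mult_left_mono[OF B[OF s]] powr_mono]) auto
      finally show "cmod (em_defect N 1 (powr_jet (1 - s)) (real (Suc n))) \<le> ?C * B * real (Suc n) powr (1 - (Re s0 - d) - real N)" .
    qed
    with d show "\<exists>d>0. cball s0 d \<subseteq> ?U \<and> uniform_limit (cball s0 d) (\<lambda>X s. \<Sum>n<X. em_defect N 1 (powr_jet (1 - s)) (real (Suc n)))
       (\<lambda>s. \<Sum>n. em_defect N 1 (powr_jet (1 - s)) (real (Suc n))) sequentially" by blast
  qed (intro holomorphic_intros hE)
  moreover have "(\<lambda>s. powr_jet (1 - s) j 1) holomorphic_on ?U" for j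
    using hJ[of 1 j] by simp
  ultimately show ?thesis unfolding zeta_em_def[abs_def] by (intro holomorphic_intros) auto
qed

text \<open>
  The choice in the definition of \<^const>\<open>riemann_zeta\<close> is not vacuous: the functions \<open>zeta_em N\<close> agree
  where two of them are defined, and they glue to a function on the whole punctured plane.
\<close>

lemma riemann_zeta_spec:
  "riemann_zeta holomorphic_on (- {1}) \<and>
     (\<forall>s. Re s > 1 \<longrightarrow> (\<lambda>n. 1 / of_nat (Suc n) powr s) sums riemann_zeta s)"
proof -
  \<comment> \<open>An order that is admissible near \<open>s\<close>; the offset 4 leaves room for the inequality \<open>Re s > 2 - N s\<close>.\<close>
  define N where "N = (\<lambda>s::complex. nat \<lceil>\<bar>Re s\<bar>\<rceil> + 4)"
  define f where "f = (\<lambda>s. zeta_em (N s) s)"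
  have Nb: "real (N s) \<ge> \<bar>Re s\<bar> + 4" for s unfolding N_def by linarith
  have f: "f s = zeta_em M s" if "M \<ge> 2" "Re s > 2 - real M" "s \<noteq> 1" for M s
  proof (cases "M \<le> N s")
    case True
    then show ?thesis unfolding f_def using that zeta_em_mono[of M "N s" s] by simp
  next
    case False
    have "N s \<ge> 2" by (simp add: N_def)
    then have "zeta_em (N s) s = zeta_em M s" using False that Nb[of s] by (intro zeta_em_mono) auto
    then show ?thesis by (simp add: f_def)
  qed
  have "f holomorphic_on (-{1})"
    unfolding holomorphic_on_def
  proof
    fix s :: complex assume s: "s \<in> -{1}"
    let ?M = "N s" and ?U = "{z. Re z > 2 - real (N s)} - {1::complex}"
    have U: "open ?U" by (intro open_Diff open_halfspace_Re_gt) auto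
    have M: "?M \<ge> 2" by (simp add: N_def)
    have sU: "s \<in> ?U" using Nb[of s] s by auto
    have "f holomorphic_on ?U"
      using holomorphic_zeta_em[OF M] by (rule holomorphic_transform) (auto simp: f[OF M])
    then have "f field_differentiable at s" using U sU holomorphic_on_imp_differentiable_at by blast
    then show "f field_differentiable at s within - {1}" by (rule field_differentiable_at_within)
  qed
  moreover have "(\<lambda>n. 1 / of_nat (Suc n) powr s) sums f s" if "Re s > 1" for s
  proof -
    have "f s = zeta_em 2 s" using that by (intro f) auto
    then show ?thesis using zeta_em_sums[of 2 s] that by simp
  qed
  ultimately have "\<exists>f. f holomorphic_on (- {1}) \<and> (\<forall>s. Re s > 1 \<longrightarrow> (\<lambda>n. 1 / of_nat (Suc n) powr s) sums f s)"
    by blast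
  from someI_ex[OF this] show ?thesis unfolding riemann_zeta_def .
qed

lemma riemann_zeta_eq_zeta_em:
  assumes N: "N \<ge> 2" and s: "Re s > 2 - real N" "s \<noteq> 1"
  shows "riemann_zeta s = zeta_em N s"
proof (rule analytic_continuation_open[of "{s. Re s > 1}" "{s. Re s > 2 - real N} - {1}" riemann_zeta "zeta_em N"])
  show "connected ({s. Re s > 2 - real N} - {1::complex})"
    by (intro connected_open_delete open_halfspace_Re_gt convex_connected convex_halfspace_Re_gt) auto
  have "2 \<in> {s. Re s > 1}" by simp
  then show "{s. Re s > 1} \<noteq> {}" by blast
  show "riemann_zeta holomorphic_on {s. Re s > 2 - real N} - {1}"
    using riemann_zeta_spec by (auto intro: holomorphic_on_subset)
  show "riemann_zeta z = zeta_em N z" if "z \<in> {s. Re s > 1}" for z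
    using riemann_zeta_spec zeta_em_sums[OF N, of z] that sums_unique2 by blast
qed (use N s in \<open>auto intro: holomorphic_zeta_em open_halfspace_Re_gt\<close>)

section \<open>Euler--Maclaurin summation with power singularities at the origin\<close>

lemma em_defect_diff_sum:
  "em_defect N h (\<lambda>j z. G j z - (\<Sum>k<M. a k * P k j z)) x
     = em_defect N h G x - (\<Sum>k<M. a k * em_defect N h (P k) x)"
proof -
  have 1: "(\<Sum>k<M. a k * em_defect N h (P k) x) = (\<Sum>k<M. a k * (of_real h * P k 1 (of_real (x+h))))
     - (\<Sum>j<N. of_real (em_coeff j * h ^ j) * (\<Sum>k<M. a k * P k j (of_real (x + h)) - a k * P k j (of_real x)))"
    unfolding em_defect_def right_diff_distrib sum_subtractf sum_distrib_left
    by (subst (1 2) sum.swap[of _ "{..<N}"]) (simp only: mult_ac)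
  have "(\<Sum>j<N. of_real (em_coeff j * h ^ j) * ((G j (of_real (x+h)) - (\<Sum>k<M. a k * P k j (of_real (x+h)))) - (G j (of_real x) - (\<Sum>k<M. a k * P k j (of_real x)))))
    = (\<Sum>j<N. of_real (em_coeff j * h ^ j) * (G j (of_real (x+h)) - G j (of_real x))) - (\<Sum>j<N. of_real (em_coeff j * h ^ j) * (\<Sum>k<M. a k * P k j (of_real (x + h)) - a k * P k j (of_real x)))"
    by (simp only: sum_subtractf[symmetric] right_diff_distrib[symmetric]) (simp add: sum_subtractf algebra_simps)
  then show ?thesis unfolding 1 unfolding em_defect_def
    by (simp add: right_diff_distrib sum_distrib_left mult_ac)
qed

text \<open>
  The summand is \<open>G 1\<close>, and \<open>a k\<close> is the coefficient of \<open>x powr (om + 2 k)\<close> in its expansion at the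
  origin. The primitive \<open>G 0\<close> is the one that vanishes at infinity; by \<open>small0\<close> it equals
  \<open>-I\<close> plus powers near the origin, which says that \<open>I\<close> is the finite part of the integral of
  \<open>G 1\<close>. Let \<open>r\<close> be \<open>G\<close> minus the powers. The defects of \<open>r\<close> sum to \<open>O(h powr \<epsilon>)\<close>: close to the origin
  \<open>r N\<close> is small by construction, far out it decays. The defects of the powers sum to \<open>h\<^sup>\<rho>\<close> times a
  part of the Euler--Maclaurin expression of zeta. What is left after telescoping are boundary terms at
  \<open>x = h\<close>, where again the powers complete the zeta values and \<open>r\<close> contributes only \<open>O(h powr \<epsilon>)\<close> and \<open>I\<close>.
\<close>

lemma generalized_euler_maclaurin:
  fixes G :: "nat \<Rightarrow> complex \<Rightarrow> complex" and a :: "nat \<Rightarrow> complex" and I :: complex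
    and om \<sigma> \<epsilon> C1 :: real and N M :: nat
  defines "r \<equiv> \<lambda>j z. G j z - (\<Sum>k<M. a k * powr_jet (of_real (om + 2 * real k + 1)) j z)"
  defines "\<epsilon> \<equiv> om + 2 * real M + 1"
  assumes N: "N \<ge> 2" "\<epsilon> - real N < -1" "real N + \<sigma> \<ge> \<epsilon>" and \<sigma>: "\<sigma> < -1"
    and nz: "\<And>k. k < M \<Longrightarrow> om + 2 * real k + 1 \<noteq> 0"
    and deriv: "\<And>j t. t > 0 \<Longrightarrow> (G j has_field_derivative G (Suc j) (of_real t)) (at (of_real t))"
    and dec: "\<And>j. j < N \<Longrightarrow> ((\<lambda>x::real. G j (of_real x)) \<longlongrightarrow> 0) at_top"
    and small: "\<And>j x. 1 \<le> j \<Longrightarrow> j < N \<Longrightarrow> 0 < x \<Longrightarrow> x \<le> 1 / 2 \<Longrightarrow> cmod (r j (of_real x)) \<le> C1 * x powr (\<epsilon> - real j)"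
    and small0: "\<And>x. 0 < x \<Longrightarrow> x \<le> 1 / 2 \<Longrightarrow> cmod (r 0 (of_real x) + I) \<le> C1 * x powr \<epsilon>"
    and big: "\<And>x. 0 < x \<Longrightarrow> cmod (r N (of_real x)) \<le> C1 * (x powr (\<epsilon> - real N) + x powr \<sigma>)"
    and C1: "C1 \<ge> 0"
  shows "\<exists>C. \<forall>h. 0 < h \<and> h \<le> 1 / 2 \<longrightarrow>
    (\<exists>s. (\<lambda>n. of_real h * G 1 (of_real (real (Suc n) * h))) sums s \<and>
       cmod (s - I - (\<Sum>k<M. a k * of_real (h powr (om + 2 * real k + 1)) * riemann_zeta (- of_real (om + 2 * real k))))
         \<le> C * h powr \<epsilon>)"
proof -
  define \<rho> where "\<rho> = (\<lambda>k. complex_of_real (om + 2 * real k + 1))"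
  define P where "P = (\<lambda>k. powr_jet (\<rho> k))"
  define A where "A = 1 + (\<Sum>j<N. \<bar>em_coeff j\<bar>)"
  define Q where "Q = (\<Sum>n. real (Suc n) powr (\<epsilon> - real N) + real (Suc n) powr \<sigma>)"
  have A: "A \<ge> 0" by (simp add: A_def sum_nonneg)
  have r: "r = (\<lambda>j z. G j z - (\<Sum>k<M. a k * P k j z))" by (simp add: r_def P_def \<rho>_def)
  have sQ: "summable (\<lambda>n. real (Suc n) powr (\<epsilon> - real N) + real (Suc n) powr \<sigma>)"
    using N \<sigma> by (intro summable_add summable_Suc_powr) auto
  have \<rho>0: "\<rho> k \<noteq> 0" if "k < M" for k using nz[OF that] unfolding \<rho>_def of_real_eq_0_iff .
  have sP: "summable (\<lambda>n. cmod (em_defect N 1 (P k) (real (Suc n))))" if "k < M" for k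
  proof -
    have "Re (1 - \<rho> k) > 2 - real N" using that N by (simp add: \<rho>_def \<epsilon>_def)
    from summable_em_defect_powr_jet[OF N(1) this] show ?thesis by (simp add: P_def)
  qed
  have zeta: "riemann_zeta (- of_real (om + 2 * real k))
      = 1 - (\<Sum>j<N. of_real (em_coeff j) * P k j 1) + (\<Sum>n. em_defect N 1 (P k) (real (Suc n)))" if "k < M" for k
  proof -
    have e: "- of_real (om + 2 * real k) = 1 - \<rho> k" by (simp add: \<rho>_def)
    have "riemann_zeta (1 - \<rho> k) = zeta_em N (1 - \<rho> k)"
    proof (rule riemann_zeta_eq_zeta_em[OF N(1)])
      show "Re (1 - \<rho> k) > 2 - real N" using that N by (simp add: \<rho>_def \<epsilon>_def)
      show "1 - \<rho> k \<noteq> 1" using \<rho>0[OF that] by simp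
    qed
    then show ?thesis unfolding e zeta_em_def by (simp add: P_def)
  qed
  have dr: "(r j has_field_derivative r (Suc j) (of_real t)) (at (of_real t))" if "t > 0" for j t
    unfolding r P_def using that
    by (intro DERIV_diff deriv DERIV_sum DERIV_cmult DERIV_powr_jet) auto
  show ?thesis
  proof (intro exI[of _ "C1 * (1 + A + A * Q)"] allI impI)
    fix h :: real assume h: "0 < h \<and> h \<le> 1 / 2"
    have hP: "em_defect N h (P k) (real (Suc n) * h) = of_real h powr \<rho> k * em_defect N 1 (P k) (real (Suc n))" for k n
      unfolding P_def using h by (intro em_defect_powr_jet_scale) auto
    have db: "cmod (em_defect N h r (real (Suc n) * h))
        \<le> C1 * A * h powr \<epsilon> * (real (Suc n) powr (\<epsilon> - real N) + real (Suc n) powr \<sigma>)" for n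
    proof -
      let ?x = "real (Suc n) * h"
      have x: "?x > 0" using h by simp
      have "cmod (em_defect N h r ?x) \<le> A * h ^ N * (C1 * (?x powr (\<epsilon> - real N) + ?x powr \<sigma>))"
        unfolding A_def
      proof (rule em_defect_bound[OF N(1)])
        fix t assume t: "t \<in> {?x..?x + h}"
        have t0: "t > 0" using t x by (meson atLeastAtMost_iff less_le_trans)
        show "(r j has_field_derivative r (Suc j) (of_real t)) (at (of_real t))" for j using dr t0 by blast
        have "cmod (r N (of_real t)) \<le> C1 * (t powr (\<epsilon> - real N) + t powr \<sigma>)" using big t0 by blast
        also have "\<dots> \<le> C1 * (?x powr (\<epsilon> - real N) + ?x powr \<sigma>)"
          using t x N \<sigma> C1 by (intro mult_left_mono add_mono powr_mono2') auto
        finally show "cmod (r N (of_real t)) \<le> C1 * (?x powr (\<epsilon> - real N) + ?x powr \<sigma>)" .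
      qed (use h in auto)
      also have "\<dots> = C1 * A * (real (Suc n) powr (\<epsilon> - real N) * (h powr real N * h powr (\<epsilon> - real N)) + real (Suc n) powr \<sigma> * (h powr real N * h powr \<sigma>))"
        using h by (simp add: powr_mult powr_realpow algebra_simps del: of_nat_Suc)
      also have "\<dots> \<le> C1 * A * (real (Suc n) powr (\<epsilon> - real N) * h powr \<epsilon> + real (Suc n) powr \<sigma> * h powr \<epsilon>)"
        unfolding powr_add[symmetric] using h N C1 A
        by (intro mult_left_mono add_mono powr_mono') auto
      finally show ?thesis by (simp add: algebra_simps)
    qed
    have sb: "summable (\<lambda>n. C1 * A * h powr \<epsilon> * (real (Suc n) powr (\<epsilon> - real N) + real (Suc n) powr \<sigma>))"
      by (rule summable_mult[OF sQ])
    have sr: "summable (\<lambda>n. cmod (em_defect N h r (real (Suc n) * h)))"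
      by (rule summable_comparison_test'[OF sb, of 0]) (use db in simp)
    define E where "E = (\<Sum>n. em_defect N h r (real (Suc n) * h))"
    have E: "cmod E \<le> C1 * A * h powr \<epsilon> * Q"
    proof -
      have "cmod E \<le> (\<Sum>n. cmod (em_defect N h r (real (Suc n) * h)))" unfolding E_def by (rule summable_norm[OF sr])
      also have "\<dots> \<le> (\<Sum>n. C1 * A * h powr \<epsilon> * (real (Suc n) powr (\<epsilon> - real N) + real (Suc n) powr \<sigma>))"
        by (rule suminf_le[OF db sr sb])
      also have "\<dots> = C1 * A * h powr \<epsilon> * Q" unfolding Q_def by (rule suminf_mult[OF sQ])
      finally show ?thesis .
    qed
    define Z where "Z = (\<lambda>k. \<Sum>n. em_defect N 1 (P k) (real (Suc n)))"
    have Z: "(\<lambda>n. em_defect N 1 (P k) (real (Suc n))) sums Z k" if "k < M" for k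
      unfolding Z_def by (rule summable_sums[OF summable_norm_cancel[OF sP[OF that]]])
    have "(\<lambda>n. em_defect N h r (real (Suc n) * h) + (\<Sum>k<M. a k * (of_real h powr \<rho> k * em_defect N 1 (P k) (real (Suc n)))))
        sums (E + (\<Sum>k<M. a k * (of_real h powr \<rho> k * Z k)))"
      unfolding E_def by (intro sums_add summable_sums[OF summable_norm_cancel[OF sr]] sums_sum sums_mult Z) auto
    moreover have "em_defect N h r (real (Suc n) * h) + (\<Sum>k<M. a k * (of_real h powr \<rho> k * em_defect N 1 (P k) (real (Suc n))))
      = em_defect N h G (real (Suc n) * h)" for n
      unfolding r em_defect_diff_sum hP by simp
    ultimately have "(\<lambda>n. em_defect N h G (real (Suc n) * h)) sums (E + (\<Sum>k<M. a k * (of_real h powr \<rho> k * Z k)))"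
      by simp
    then have 1: "(\<lambda>X. \<Sum>n<X. em_defect N h G (real (Suc n) * h)) \<longlonglongrightarrow> E + (\<Sum>k<M. a k * (of_real h powr \<rho> k * Z k))"
      by (simp add: sums_def)
    have lim: "filterlim (\<lambda>X. real (Suc X) * h) at_top sequentially"
      using filterlim_tendsto_pos_mult_at_top[OF tendsto_const[of h] _ filterlim_compose[OF filterlim_real_sequentially filterlim_Suc]] h
      by (simp add: mult.commute)
    have 2: "(\<lambda>X. \<Sum>j<N. of_real (em_coeff j * h ^ j) * (G j (of_real (real (Suc X) * h)) - G j (of_real h)))
       \<longlonglongrightarrow> (\<Sum>j<N. of_real (em_coeff j * h ^ j) * (0 - G j (of_real h)))"
      by (intro tendsto_sum tendsto_mult tendsto_diff tendsto_const filterlim_compose[OF dec lim]) auto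
    \<comment> \<open>The sum without its first term, which the defects do not reach.\<close>
  define s0 where "s0 = E + (\<Sum>k<M. a k * (of_real h powr \<rho> k * Z k)) - (\<Sum>j<N. of_real (em_coeff j * h ^ j) * G j (of_real h))"
    have "(\<lambda>X. \<Sum>n<X. of_real h * G 1 (of_real (real (Suc (Suc n)) * h))) \<longlonglongrightarrow> s0"
      using tendsto_add[OF 1 2] unfolding sum_em_defect s0_def by (simp add: sum_negf)
    then have "(\<lambda>n. of_real h * G 1 (of_real (real (Suc (Suc n)) * h))) sums s0" by (simp add: sums_def)
    then have s: "(\<lambda>n. of_real h * G 1 (of_real (real (Suc n) * h))) sums (s0 + of_real h * G 1 (of_real h))"
      using sums_Suc_iff[of "\<lambda>n. of_real h * G 1 (of_real (real (Suc n) * h))" "s0"]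
      by (simp add: sums_Suc)
    have ph: "of_real h powr \<rho> k * P k j 1 = of_real (h ^ j) * P k j (of_real h)" for k j
      using powr_jet_scale[of h 1 j "\<rho> k"] h by (simp add: P_def)
    have p1: "of_real h powr \<rho> k = of_real h * P k 1 (of_real h)" if "k < M" for k
      using ph[of k 1] powr_jet_1[OF \<rho>0[OF that], of 1] by (simp add: P_def)
    have hr: "complex_of_real (h powr (om + 2 * real k + 1)) = of_real h powr \<rho> k" for k
      unfolding \<rho>_def using h by (intro powr_of_real[symmetric]) auto
    \<comment> \<open>The zeta term is the summed defect of a power together with its boundary terms at \<open>h\<close>.\<close>
    have za: "a k * of_real (h powr (om + 2 * real k + 1)) * riemann_zeta (- of_real (om + 2 * real k))
       = of_real h * (a k * P k 1 (of_real h)) - (\<Sum>j<N. of_real (em_coeff j * h ^ j) * (a k * P k j (of_real h))) + a k * (of_real h powr \<rho> k * Z k)"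
      if "k < M" for k
    proof -
      have "a k * (of_real h powr \<rho> k * (\<Sum>j<N. of_real (em_coeff j) * P k j 1))
         = (\<Sum>j<N. of_real (em_coeff j) * (a k * (of_real h powr \<rho> k * P k j 1)))"
        by (simp add: sum_distrib_left mult_ac)
      also have "\<dots> = (\<Sum>j<N. of_real (em_coeff j * h ^ j) * (a k * P k j (of_real h)))"
        unfolding ph by (simp add: mult_ac)
      finally have e: "a k * (of_real h powr \<rho> k * (\<Sum>j<N. of_real (em_coeff j) * P k j 1)) = (\<Sum>j<N. of_real (em_coeff j * h ^ j) * (a k * P k j (of_real h)))" .
      have "a k * of_real (h powr (om + 2 * real k + 1)) * riemann_zeta (- of_real (om + 2 * real k))
        = a k * of_real h powr \<rho> k - a k * (of_real h powr \<rho> k * (\<Sum>j<N. of_real (em_coeff j) * P k j 1)) + a k * (of_real h powr \<rho> k * Z k)"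
        unfolding zeta[OF that] hr Z_def by (simp only: ring_distribs right_diff_distrib mult_1_right mult.assoc)
      then show ?thesis unfolding e using p1[OF that] by simp
    qed
    have "(\<Sum>k<M. a k * of_real (h powr (om + 2 * real k + 1)) * riemann_zeta (- of_real (om + 2 * real k)))
      = (\<Sum>k<M. of_real h * (a k * P k 1 (of_real h))) - (\<Sum>k<M. \<Sum>j<N. of_real (em_coeff j * h ^ j) * (a k * P k j (of_real h))) + (\<Sum>k<M. a k * (of_real h powr \<rho> k * Z k))"
      unfolding sum.distrib[symmetric] sum_subtractf[symmetric] by (intro sum.cong refl za) simp
    also have "(\<Sum>k<M. \<Sum>j<N. of_real (em_coeff j * h ^ j) * (a k * P k j (of_real h)))
       = (\<Sum>j<N. of_real (em_coeff j * h ^ j) * (\<Sum>k<M. a k * P k j (of_real h)))"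
      by (subst sum.swap) (simp add: sum_distrib_left)
    finally have sz: "(\<Sum>k<M. a k * of_real (h powr (om + 2 * real k + 1)) * riemann_zeta (- of_real (om + 2 * real k)))
      = of_real h * (\<Sum>k<M. a k * P k 1 (of_real h)) - (\<Sum>j<N. of_real (em_coeff j * h ^ j) * (\<Sum>k<M. a k * P k j (of_real h))) + (\<Sum>k<M. a k * (of_real h powr \<rho> k * Z k))"
      by (simp add: sum_distrib_left)
    let ?err = "(s0 + of_real h * G 1 (of_real h)) - I - (\<Sum>k<M. a k * of_real (h powr (om + 2 * real k + 1)) * riemann_zeta (- of_real (om + 2 * real k)))"
    have "?err = E + of_real h * r 1 (of_real h) - (\<Sum>j<N. of_real (em_coeff j * h ^ j) * r j (of_real h)) - I"
      unfolding sz s0_def r right_diff_distrib sum_subtractf by (simp add: algebra_simps)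
    also have "(\<Sum>j<N. of_real (em_coeff j * h ^ j) * r j (of_real h)) + I
       = (\<Sum>j<N. of_real (em_coeff j * h ^ j) * (r j (of_real h) + (if j = 0 then I else 0)))"
    proof -
      have "(\<Sum>j<N. of_real (em_coeff j * h ^ j) * (if j = 0 then I else 0)) = I"
        using N by (simp add: if_distrib sum.delta cong: if_cong)
      then show ?thesis by (simp add: ring_distribs sum.distrib)
    qed
    then have "E + of_real h * r 1 (of_real h) - (\<Sum>j<N. of_real (em_coeff j * h ^ j) * r j (of_real h)) - I
        = E + of_real h * r 1 (of_real h) - (\<Sum>j<N. of_real (em_coeff j * h ^ j) * (r j (of_real h) + (if j = 0 then I else 0)))"
      by (simp add: algebra_simps)
    finally have err: "?err = E + of_real h * r 1 (of_real h) - (\<Sum>j<N. of_real (em_coeff j * h ^ j) * (r j (of_real h) + (if j = 0 then I else 0)))" .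
    have rj: "h ^ j * cmod (r j (of_real h) + (if j = 0 then I else 0)) \<le> C1 * h powr \<epsilon>" if "j < N" for j
    proof -
      have "cmod (r j (of_real h) + (if j = 0 then I else 0)) \<le> C1 * h powr (\<epsilon> - real j)"
        using small[of j h] small0[of h] h that by (cases "j = 0") auto
      then have "h ^ j * cmod (r j (of_real h) + (if j = 0 then I else 0)) \<le> h ^ j * (C1 * h powr (\<epsilon> - real j))"
        using h by (intro mult_left_mono) auto
      also have "\<dots> = C1 * (h powr real j * h powr (\<epsilon> - real j))" using h by (simp add: powr_realpow)
      also have "h powr real j * h powr (\<epsilon> - real j) = h powr \<epsilon>" by (simp flip: powr_add)
      finally show ?thesis .
    qed
    have "cmod ?err \<le> cmod E + cmod (of_real h * r 1 (of_real h)) + cmod (\<Sum>j<N. of_real (em_coeff j * h ^ j) * (r j (of_real h) + (if j = 0 then I else 0)))"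
      unfolding err by (meson add_right_mono norm_triangle_ineq norm_triangle_ineq4 order_trans)
    also have "\<dots> \<le> C1 * A * h powr \<epsilon> * Q + C1 * h powr \<epsilon> + (\<Sum>j<N. \<bar>em_coeff j\<bar> * (C1 * h powr \<epsilon>))"
    proof (intro add_mono E order.trans[OF norm_sum] sum_mono)
      show "cmod (of_real h * r 1 (of_real h)) \<le> C1 * h powr \<epsilon>"
        using rj[of 1] N h by (simp add: norm_mult)
      fix j assume "j \<in> {..<N}"
      then have "\<bar>em_coeff j\<bar> * (h ^ j * cmod (r j (of_real h) + (if j = 0 then I else 0))) \<le> \<bar>em_coeff j\<bar> * (C1 * h powr \<epsilon>)"
        by (intro mult_left_mono rj) auto
      then show "cmod (of_real (em_coeff j * h ^ j) * (r j (of_real h) + (if j = 0 then I else 0))) \<le> \<bar>em_coeff j\<bar> * (C1 * h powr \<epsilon>)"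
        using h by (simp only: norm_mult norm_of_real abs_mult power_abs mult.assoc) auto
    qed
    also have "\<dots> = C1 * (A + A * Q) * h powr \<epsilon>"
      unfolding A_def sum_distrib_right[symmetric] by (simp add: algebra_simps)
    also have "\<dots> \<le> C1 * (1 + A + A * Q) * h powr \<epsilon>"
      using C1 by (intro mult_right_mono mult_left_mono) auto
    finally show "\<exists>s. (\<lambda>n. of_real h * G 1 (of_real (real (Suc n) * h))) sums s \<and>
       cmod (s - I - (\<Sum>k<M. a k * of_real (h powr (om + 2 * real k + 1)) * riemann_zeta (- of_real (om + 2 * real k))))
         \<le> C1 * (1 + A + A * Q) * h powr \<epsilon>"
      using s by blast
  qed
qed

section \<open>Integrals over half-lines\<close>

lemma set_integrable_lborel_of_lebesgue:
  fixes f :: "real \<Rightarrow> 'b::{banach, second_countable_topology}"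
  assumes "set_integrable lebesgue S f" "S \<in> sets borel" "continuous_on S f"
  shows "set_integrable lborel S f"
proof -
  have "(\<lambda>x. indicator S x *\<^sub>R f x) \<in> borel_measurable lborel"
    using borel_measurable_continuous_on_indicator[OF assms(2,3)] by simp
  from integrable_completion[OF this] assms(1) show ?thesis by (simp add: set_integrable_def)
qed

lemma set_integrable_bound_continuous:
  fixes f :: "real \<Rightarrow> 'b::{banach, second_countable_topology}" and g :: "real \<Rightarrow> real"
  assumes g: "set_integrable lborel S g" and S: "S \<in> sets borel" and f: "continuous_on S f"
    and le: "\<And>x. x \<in> S \<Longrightarrow> norm (f x) \<le> g x"
  shows "set_integrable lborel S f"
proof (rule set_integrable_bound[OF g])
  show "set_borel_measurable lborel S f"
    unfolding set_borel_measurable_def using borel_measurable_continuous_on_indicator[OF S f] by simp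
  have "norm (f x) \<le> norm (g x)" if "x \<in> S" for x
    using le[OF that] abs_ge_self[of "g x"] by (simp only: real_norm_def)
  then show "AE x in lborel. x \<in> S \<longrightarrow> norm (f x) \<le> norm (g x)" by simp
qed

lemma set_integrable_powr_Ici:
  fixes c :: real
  assumes "c < -1" "A > 0"
  shows "set_integrable lborel {A..} (\<lambda>x. x powr c)"
proof (rule set_integrable_lborel_of_lebesgue)
  show "set_integrable lebesgue {A..} (\<lambda>x. x powr c)"
    using has_integral_powr_to_inf[OF assms]
    by (intro nonnegative_absolutely_integrable_1) (auto simp: integrable_on_def)
  show "continuous_on {A..} (\<lambda>x. x powr c)" using assms by (intro continuous_intros) auto
qed simp

lemma set_integrable_powr_0:
  fixes c :: real
  assumes "c > -1" "A \<ge> 0"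
  shows "set_integrable lborel {0<..A} (\<lambda>x. x powr c)"
proof (rule set_integrable_lborel_of_lebesgue)
  show "set_integrable lebesgue {0<..A} (\<lambda>x. x powr c)"
    using integrable_on_powr_from_0'[OF assms]
    by (intro nonnegative_absolutely_integrable_1) auto
  show "continuous_on {0<..A} (\<lambda>x. x powr c)" by (intro continuous_intros) auto
qed simp

lemma LINT_FTC_Ici:
  fixes F f :: "real \<Rightarrow> complex"
  assumes int: "set_integrable lborel {A..} f" and cont: "continuous_on {A..} f"
    and F: "\<And>x. x \<ge> A \<Longrightarrow> (F has_vector_derivative f x) (at x)"
    and lim: "(F \<longlongrightarrow> L) at_top"
  shows "(LINT x:{A..}|lborel. f x) = L - F A"
proof -
  have "((\<lambda>b. LINT x:{A..b}|lborel. f x) \<longlongrightarrow> (LINT x:{A..}|lborel. f x)) at_top"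
    by (rule tendsto_set_lebesgue_integral_at_top[OF _ int]) simp
  moreover have "((\<lambda>b. LINT x:{A..b}|lborel. f x) \<longlongrightarrow> L - F A) at_top"
  proof (rule Lim_transform_eventually)
    show "((\<lambda>b. F b - F A) \<longlongrightarrow> L - F A) at_top" by (intro tendsto_intros lim)
    show "\<forall>\<^sub>F b in at_top. F b - F A = (LINT x:{A..b}|lborel. f x)"
      using eventually_ge_at_top[of A]
    proof eventually_elim
      case (elim b)
      have "set_integrable lborel {A..b} f"
        by (rule set_integrable_subset[OF int]) auto
      from set_borel_integral_eq_integral(2)[OF this]
      have "(LINT x:{A..b}|lborel. f x) = integral {A..b} f" .
      also have "(f has_integral (F b - F A)) {A..b}"
        using elim by (intro fundamental_theorem_of_calculus has_vector_derivative_at_within[OF F]) auto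
      then have "integral {A..b} f = F b - F A" by (rule integral_unique)
      finally show ?case by simp
    qed
  qed
  ultimately show ?thesis using tendsto_unique[OF trivial_limit_at_top_linorder] by blast
qed

lemma has_vector_derivative_powr_complex:
  fixes p :: complex
  assumes "x > 0"
  shows "((\<lambda>x. of_real x powr p) has_vector_derivative p * of_real x powr (p - 1)) (at x)"
proof -
  have "((\<lambda>z. z powr p) has_field_derivative p * of_real x powr (p - 1)) (at (of_real x))"
    using assms by (intro has_field_derivative_powr) auto
  from has_vector_derivative_real_field[OF this] show ?thesis .
qed

lemma norm_of_real_powr: "x > 0 \<Longrightarrow> cmod (of_real x powr p) = x powr Re p"
  by (simp add: norm_powr_real_powr)

lemma continuous_on_of_real_powr: "(\<And>x. x \<in> S \<Longrightarrow> 0 < x) \<Longrightarrow> continuous_on S (\<lambda>x::real. complex_of_real x powr p)"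
  by (intro continuous_intros) (auto simp: less_imp_le)

lemma LINT_powr_Ici:
  fixes p :: complex
  assumes "Re p < 0" "A > 0"
  shows "set_integrable lborel {A..} (\<lambda>x. of_real x powr (p - 1))"
    and "(LINT x:{A..}|lborel. of_real x powr (p - 1)) = - (of_real A powr p / p)"
proof -
  have c: "continuous_on {A..} (\<lambda>x. complex_of_real x powr (p - 1))"
    using assms by (intro continuous_on_of_real_powr) auto
  show i: "set_integrable lborel {A..} (\<lambda>x. of_real x powr (p - 1))"
    using assms by (intro set_integrable_bound_continuous[OF set_integrable_powr_Ici[of "Re p - 1" A]] c)
      (auto simp: norm_of_real_powr)
  have p0: "p \<noteq> 0" using assms by auto
  have "(LINT x:{A..}|lborel. of_real x powr (p - 1)) = 0 - of_real A powr p / p"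
  proof (rule LINT_FTC_Ici[OF i c])
    fix x assume "x \<ge> A"
    then have "((\<lambda>x. of_real x powr p / p) has_vector_derivative (p * of_real x powr (p - 1)) / p) (at x)"
      using assms by (intro has_vector_derivative_divide has_vector_derivative_powr_complex) auto
    then show "((\<lambda>x. of_real x powr p / p) has_vector_derivative of_real x powr (p - 1)) (at x)"
      using p0 by simp
  next
    have "((\<lambda>x::real. x powr Re p / cmod p) \<longlongrightarrow> 0) at_top"
      using assms by (intro tendsto_divide_zero tendsto_neg_powr filterlim_ident)
    then show "((\<lambda>x::real. complex_of_real x powr p / p) \<longlongrightarrow> 0) at_top"
    proof (rule tendsto_norm_zero_cancel[OF Lim_transform_eventually])
      show "\<forall>\<^sub>F x in at_top. x powr Re p / cmod p = cmod (of_real x powr p / p)"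
        using eventually_gt_at_top[of 0] by eventually_elim (simp add: norm_divide norm_of_real_powr)
    qed
  qed
  then show "(LINT x:{A..}|lborel. of_real x powr (p - 1)) = - (of_real A powr p / p)" by simp
qed

lemma LINT_powr_0:
  fixes p :: complex
  assumes "Re p > 0" "A > 0"
  shows "set_integrable lborel {0<..A} (\<lambda>x. of_real x powr (p - 1))"
    and "(LINT x:{0<..A}|lborel. of_real x powr (p - 1)) = of_real A powr p / p"
proof -
  have c: "continuous_on {0<..A} (\<lambda>x. complex_of_real x powr (p - 1))"
    by (intro continuous_on_of_real_powr) auto
  show i: "set_integrable lborel {0<..A} (\<lambda>x. of_real x powr (p - 1))"
    using assms by (intro set_integrable_bound_continuous[OF set_integrable_powr_0[of "Re p - 1" A]] c)
      (auto simp: norm_of_real_powr)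
  have p0: "p \<noteq> 0" using assms by auto
  have "(LINT x:{0<..A}|lborel. of_real x powr (p - 1)) = integral {0<..A} (\<lambda>x. of_real x powr (p - 1))"
    by (rule set_borel_integral_eq_integral(2)[OF i])
  also have "\<dots> = integral {0..A} (\<lambda>x. of_real x powr (p - 1))"
    by (rule integral_spike_set; rule negligible_subset[of "{0}"]) auto
  also have "((\<lambda>x. of_real x powr (p - 1)) has_integral (of_real A powr p / p - of_real 0 powr p / p)) {0..A}"
  proof (rule fundamental_theorem_of_calculus_interior)
    show "continuous_on {0..A} (\<lambda>x. complex_of_real x powr p / p)"
      using assms p0 by (intro continuous_intros) auto
    fix x assume "x \<in> {0<..<A}"
    then have "((\<lambda>x. of_real x powr p / p) has_vector_derivative (p * of_real x powr (p - 1)) / p) (at x)"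
      using assms by (intro has_vector_derivative_divide has_vector_derivative_powr_complex) auto
    then show "((\<lambda>x. of_real x powr p / p) has_vector_derivative of_real x powr (p - 1)) (at x)"
      using p0 by simp
  qed (use assms in auto)
  then have "integral {0..A} (\<lambda>x. of_real x powr (p - 1)) = of_real A powr p / p" using p0 by (simp add: integral_unique)
  finally show "(LINT x:{0<..A}|lborel. of_real x powr (p - 1)) = of_real A powr p / p" .
qed

lemma LINT_Gamma:
  fixes p :: complex
  assumes p: "Re p > 0" and c: "c > 0"
  shows "set_integrable lborel {0<..} (\<lambda>x. of_real x powr (p - 1) * of_real (exp (- (c * x))))"
    and "(LINT x:{0<..}|lborel. of_real x powr (p - 1) * of_real (exp (- (c * x)))) = Gamma p * of_real c powr (- p)"
proof -
  have i: "set_integrable lborel {0<..} (\<lambda>x. of_real x powr (p - 1) * of_real (exp (- (c * x))))" if "c > 0" for c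
  proof (rule set_integrable_lborel_of_lebesgue)
    show "set_integrable lebesgue {0<..} (\<lambda>x. of_real x powr (p - 1) * of_real (exp (- (c * x))))"
      using absolutely_integrable_Gamma_integral[OF p that] by (simp add: exp_minus divide_inverse)
    show "continuous_on {0<..} (\<lambda>x. of_real x powr (p - 1) * complex_of_real (exp (- (c * x))))"
      by (intro continuous_intros continuous_on_of_real_powr) auto
  qed simp
  show "set_integrable lborel {0<..} (\<lambda>x. of_real x powr (p - 1) * of_real (exp (- (c * x))))" by (rule i[OF c])
  let ?f = "\<lambda>x. indicator {0<..} x *\<^sub>R (of_real x powr (p - 1) * complex_of_real (exp (- (1 * x))))"
  have "integral\<^sup>L lborel ?f = Gamma p"
  proof -
    have "integral\<^sup>L lborel ?f = (LINT x:{0<..}|lborel. of_real x powr (p - 1) * of_real (exp (- (1 * x))))"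
      by (simp add: set_lebesgue_integral_def)
    also have "\<dots> = integral {0<..} (\<lambda>x. of_real x powr (p - 1) * of_real (exp (- (1 * x))))"
      by (rule set_borel_integral_eq_integral(2)[OF i]) simp
    also have "\<dots> = integral {0..} (\<lambda>x. of_real x powr (p - 1) * of_real (exp (- (1 * x))))"
      by (rule integral_spike_set; rule negligible_subset[of "{0}"]) auto
    also have "\<dots> = Gamma p"
      using Gamma_integral_complex[OF p] by (intro integral_unique) (simp add: exp_minus divide_inverse)
    finally show ?thesis .
  qed
  moreover have "integral\<^sup>L lborel ?f = \<bar>c\<bar> *\<^sub>R (\<integral>x. ?f (0 + c * x) \<partial>lborel)"
    using c by (intro lborel_integral_real_affine) auto
  moreover have "?f (0 + c * x) = of_real c powr (p - 1) * (indicator {0<..} x *\<^sub>R (of_real x powr (p - 1) * of_real (exp (- (c * x)))))" for x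
    using c by (auto simp: indicator_def powr_times_real zero_less_mult_iff)
  ultimately have "Gamma p = \<bar>c\<bar> *\<^sub>R (\<integral>x. of_real c powr (p - 1) * (indicator {0<..} x *\<^sub>R (of_real x powr (p - 1) * of_real (exp (- (c * x))))) \<partial>lborel)"
    by (simp only:)
  then have "Gamma p = of_real c * (of_real c powr (p - 1) * (LINT x:{0<..}|lborel. of_real x powr (p - 1) * of_real (exp (- (c * x)))))"
    using c unfolding integral_mult_right_zero set_lebesgue_integral_def by (simp add: scaleR_conv_of_real)
  also have "\<dots> = of_real c powr p * (LINT x:{0<..}|lborel. of_real x powr (p - 1) * of_real (exp (- (c * x))))"
    using c by (simp add: powr_diff)
  finally show "(LINT x:{0<..}|lborel. of_real x powr (p - 1) * of_real (exp (- (c * x)))) = Gamma p * of_real c powr (- p)"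
    using c by (simp add: powr_minus field_simps)
qed

lemma LINT_Gamma_real:
  fixes p c :: real
  assumes p: "p > 0" and c: "c > 0"
  shows "set_integrable lborel {0<..} (\<lambda>x. x powr (p - 1) * exp (- (c * x)))"
    and "(LINT x:{0<..}|lborel. x powr (p - 1) * exp (- (c * x))) = Gamma p * c powr (- p)"
proof -
  have e: "indicator {0<..} x *\<^sub>R (of_real x powr (of_real p - 1) * of_real (exp (- (c * x))))
     = complex_of_real (indicator {0<..} x *\<^sub>R (x powr (p - 1) * exp (- (c * x))))" for x
    using powr_of_real[of x "p - 1"] by (auto simp: indicator_def)
  have p': "Re (of_real p) > 0" using p by simp
  show "set_integrable lborel {0<..} (\<lambda>x. x powr (p - 1) * exp (- (c * x)))"
    using LINT_Gamma(1)[OF p' c] unfolding set_integrable_def e complex_of_real_integrable_eq .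
  have "complex_of_real (LINT x:{0<..}|lborel. x powr (p - 1) * exp (- (c * x))) = Gamma (of_real p) * of_real c powr (- of_real p)"
    using LINT_Gamma(2)[OF p' c] unfolding set_lebesgue_integral_def e integral_complex_of_real .
  also have "\<dots> = of_real (Gamma p * c powr (- p))"
    using c powr_of_real[of c "- p"] by (simp add: Gamma_complex_of_real)
  finally have "complex_of_real (LINT x:{0<..}|lborel. x powr (p - 1) * exp (- (c * x))) = of_real (Gamma p * c powr (- p))" .
  then show "(LINT x:{0<..}|lborel. x powr (p - 1) * exp (- (c * x))) = Gamma p * c powr (- p)"
    using of_real_eq_iff by blast
qed

lemma LINT_inverse_real:
  fixes f :: "real \<Rightarrow> real"
  assumes int: "set_integrable lborel {0<..} f" and cont: "continuous_on {0<..} f"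
  shows "set_integrable lborel {0<..} (\<lambda>t. 1 / t\<^sup>2 * f (1 / t))"
    and "(LINT t:{0<..}|lborel. 1 / t\<^sup>2 * f (1 / t)) = (LINT x:{0<..}|lborel. f x)"
proof -
  have img: "(\<lambda>t. 1 / t) ` {0<..} = ({0<..} :: real set)"
  proof safe
    fix x :: real assume "x > 0"
    then show "x \<in> (\<lambda>t. 1 / t) ` {0<..}" by (intro image_eqI[of _ _ "1 / x"]) auto
  qed auto
  have "set_integrable lebesgue {0<..} f"
    using int unfolding set_integrable_def by (simp add: integrable_completion borel_measurable_integrable)
  then have "f absolutely_integrable_on (\<lambda>t. 1 / t) ` {0<..} \<and> integral ((\<lambda>t. 1 / t) ` {0<..}) f = integral {0<..} f"
    unfolding img by simp
  then have *: "(\<lambda>x. \<bar>- (1 / x\<^sup>2)\<bar> * f (1 / x)) absolutely_integrable_on {0<..} \<and>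
      integral {0<..} (\<lambda>x. \<bar>- (1 / x\<^sup>2)\<bar> * f (1 / x)) = integral {0<..} f"
  proof (subst has_absolute_integral_change_of_variables_1'[where g = "\<lambda>t. 1 / t"])
    show "((\<lambda>t. 1 / t) has_real_derivative - (1 / x\<^sup>2)) (at x within {0<..})" if "x \<in> {0<..}" for x :: real
      using that by (auto intro!: derivative_eq_intros simp: power2_eq_square)
  qed (auto simp: inj_on_def)
  have c: "continuous_on {0<..} (\<lambda>t. 1 / t\<^sup>2 * f (1 / t))"
    by (intro continuous_intros continuous_on_compose2[OF cont]) auto
  show i: "set_integrable lborel {0<..} (\<lambda>t. 1 / t\<^sup>2 * f (1 / t))"
    using * by (intro set_integrable_lborel_of_lebesgue c) auto
  show "(LINT t:{0<..}|lborel. 1 / t\<^sup>2 * f (1 / t)) = (LINT x:{0<..}|lborel. f x)"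
    using * unfolding set_borel_integral_eq_integral(2)[OF i] set_borel_integral_eq_integral(2)[OF int] by simp
qed

text \<open>
  Substitution of \<open>1/t\<close>, reduced to the preceding real case by taking real and imaginary parts.
\<close>

lemma LINT_inverse:
  fixes f :: "real \<Rightarrow> complex"
  assumes int: "set_integrable lborel {0<..} f" and cont: "continuous_on {0<..} f"
  shows "(LINT t:{0<..}|lborel. of_real (1 / t\<^sup>2) * f (1 / t)) = (LINT x:{0<..}|lborel. f x)"
proof -
  have iR: "set_integrable lborel {0<..} (\<lambda>x. Re (f x))" and iI: "set_integrable lborel {0<..} (\<lambda>x. Im (f x))"
    using int unfolding set_integrable_def by (auto dest: integrable_Re integrable_Im)
  have cR: "continuous_on {0<..} (\<lambda>x. Re (f x))" and cI: "continuous_on {0<..} (\<lambda>x. Im (f x))"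
    using cont by (auto intro: continuous_intros)
  have split: "(LINT t:{0<..}|lborel. g t) = of_real (LINT t:{0<..}|lborel. Re (g t)) + \<i> * of_real (LINT t:{0<..}|lborel. Im (g t))"
    if "set_integrable lborel {0<..} (\<lambda>t. Re (g t))" "set_integrable lborel {0<..} (\<lambda>t. Im (g t))" for g :: "real \<Rightarrow> complex"
  proof -
    have r: "integrable lborel (\<lambda>t. complex_of_real (indicator {0<..} t *\<^sub>R Re (g t)))"
      and im: "integrable lborel (\<lambda>t. complex_of_real (indicator {0<..} t *\<^sub>R Im (g t)))"
      using that unfolding set_integrable_def complex_of_real_integrable_eq by auto
    have "(LINT t:{0<..}|lborel. g t) = (\<integral>t. complex_of_real (indicator {0<..} t *\<^sub>R Re (g t)) + \<i> * complex_of_real (indicator {0<..} t *\<^sub>R Im (g t)) \<partial>lborel)"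
      unfolding set_lebesgue_integral_def
      by (intro Bochner_Integration.integral_cong refl) (auto simp: indicator_def complex_eq_iff)
    also have "\<dots> = of_real (LINT t:{0<..}|lborel. Re (g t)) + \<i> * of_real (LINT t:{0<..}|lborel. Im (g t))"
      unfolding set_lebesgue_integral_def using r im
      by (subst Bochner_Integration.integral_add) (auto simp del: of_real_mult real_scaleR_def)
    finally show ?thesis .
  qed
  have "(LINT t:{0<..}|lborel. of_real (1 / t\<^sup>2) * f (1 / t))
     = of_real (LINT t:{0<..}|lborel. 1 / t\<^sup>2 * Re (f (1 / t))) + \<i> * of_real (LINT t:{0<..}|lborel. 1 / t\<^sup>2 * Im (f (1 / t)))"
  proof -
    have "Re (of_real (1 / t\<^sup>2) * f (1 / t)) = 1 / t\<^sup>2 * Re (f (1 / t))" for t by simp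
    moreover have "Im (of_real (1 / t\<^sup>2) * f (1 / t)) = 1 / t\<^sup>2 * Im (f (1 / t))" for t by simp
    ultimately show ?thesis
      using split[of "\<lambda>t. of_real (1 / t\<^sup>2) * f (1 / t)"] LINT_inverse_real(1)[OF iR cR] LINT_inverse_real(1)[OF iI cI]
      by (simp only:)
  qed
  also have "\<dots> = (LINT x:{0<..}|lborel. f x)"
    unfolding LINT_inverse_real(2)[OF iR cR] LINT_inverse_real(2)[OF iI cI] using split[OF iR iI] by simp
  finally show ?thesis .
qed

lemma LINT_fubini_pos:
  fixes f :: "real \<Rightarrow> real \<Rightarrow> complex"
  assumes cont: "continuous_on ({0<..} \<times> {0<..}) (\<lambda>z. f (fst z) (snd z))"
    and inner: "\<And>x. x > 0 \<Longrightarrow> set_integrable lborel {0<..} (f x)"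
    and outer: "set_integrable lborel {0<..} (\<lambda>x. LINT y:{0<..}|lborel. cmod (f x y))"
  shows "(LINT x:{0<..}|lborel. LINT y:{0<..}|lborel. f x y) = (LINT y:{0<..}|lborel. LINT x:{0<..}|lborel. f x y)"
proof -
  let ?g = "\<lambda>z. indicator ({0<..} \<times> {0<..}) z *\<^sub>R f (fst z) (snd z)"
  have m: "?g \<in> borel_measurable (lborel \<Otimes>\<^sub>M lborel)"
    unfolding lborel_prod using borel_measurable_continuous_on_indicator[OF _ cont] by (simp add: open_Times)
  have g: "?g (x, y) = indicator {0<..} x *\<^sub>R (indicator {0<..} y *\<^sub>R f x y)" for x y
    by (simp add: indicator_def)
  have "integrable (lborel \<Otimes>\<^sub>M lborel) ?g"
  proof (rule lborel_pair.Fubini_integrable[OF m])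
    have "(\<integral>y. norm (?g (x, y)) \<partial>lborel) = indicator {0<..} x *\<^sub>R (LINT y:{0<..}|lborel. cmod (f x y))" for x
      unfolding g set_lebesgue_integral_def by (cases "x > 0") (auto simp: indicator_def)
    then show "integrable lborel (\<lambda>x. \<integral>y. norm (?g (x, y)) \<partial>lborel)"
      using outer by (simp add: set_integrable_def)
    have "integrable lborel (\<lambda>y. ?g (x, y))" for x
      unfolding g using inner[of x] by (cases "x > 0") (auto simp: set_integrable_def)
    then show "AE x in lborel. integrable lborel (\<lambda>y. ?g (x, y))" by simp
  qed
  then have "integrable (lborel \<Otimes>\<^sub>M lborel) (case_prod (\<lambda>x y. ?g (x, y)))" by (simp add: case_prod_beta')
  from lborel_pair.Fubini_integral[OF this]
  have "(\<integral>y. (\<integral>x. ?g (x, y) \<partial>lborel) \<partial>lborel) = (\<integral>x. (\<integral>y. ?g (x, y) \<partial>lborel) \<partial>lborel)" .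
  moreover have "(\<integral>x. ?g (x, y) \<partial>lborel) = indicator {0<..} y *\<^sub>R (LINT x:{0<..}|lborel. f x y)" for y
    unfolding g set_lebesgue_integral_def by (cases "y > 0") auto
  moreover have "(\<integral>y. ?g (x, y) \<partial>lborel) = indicator {0<..} x *\<^sub>R (LINT y:{0<..}|lborel. f x y)" for x
    unfolding g set_lebesgue_integral_def by (cases "x > 0") auto
  ultimately show ?thesis unfolding set_lebesgue_integral_def by simp
qed

lemma LINT_sums:
  fixes f :: "nat \<Rightarrow> real \<Rightarrow> 'b::{banach, second_countable_topology}"
  assumes int: "\<And>m. set_integrable lborel S (f m)"
    and sn: "summable (\<lambda>m. LINT x:S|lborel. norm (f m x))"
    and sp: "\<And>x. x \<in> S \<Longrightarrow> summable (\<lambda>m. norm (f m x))"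
    and F: "\<And>x. x \<in> S \<Longrightarrow> (\<lambda>m. f m x) sums F x"
  shows "set_integrable lborel S F" and "(\<lambda>m. LINT x:S|lborel. f m x) sums (LINT x:S|lborel. F x)"
proof -
  let ?f = "\<lambda>m x. indicator S x *\<^sub>R f m x"
  have i: "integrable lborel (?f m)" for m using int[of m] by (simp add: set_integrable_def)
  have s: "AE x in lborel. summable (\<lambda>m. norm (?f m x))"
    using sp by (auto simp: indicator_def intro!: AE_I2)
  have n: "summable (\<lambda>m. \<integral>x. norm (?f m x) \<partial>lborel)"
    using sn by (simp add: set_lebesgue_integral_def)
  have e: "(\<Sum>m. ?f m x) = indicator S x *\<^sub>R F x" for x
    using F[of x] by (cases "x \<in> S") (auto simp: sums_iff)
  show "set_integrable lborel S F"
    using integrable_suminf[OF i s n] unfolding e set_integrable_def .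
  show "(\<lambda>m. LINT x:S|lborel. f m x) sums (LINT x:S|lborel. F x)"
    using sums_integral[OF i s n] unfolding e set_lebesgue_integral_def .
qed

text \<open>
  The form of termwise integration used throughout: a bound of the terms by products of a summable
  sequence and one integrable weight.
\<close>

lemma LINT_sums_dominated:
  fixes f :: "nat \<Rightarrow> real \<Rightarrow> 'b::{banach, second_countable_topology}"
  assumes S: "S \<in> sets borel" and cont: "\<And>m. continuous_on S (f m)"
    and w: "set_integrable lborel S w" and M: "summable M" "\<And>m. M m \<ge> (0::real)"
    and le: "\<And>m x. x \<in> S \<Longrightarrow> norm (f m x) \<le> M m * w x"
    and F: "\<And>x. x \<in> S \<Longrightarrow> (\<lambda>m. f m x) sums F x"
  shows "set_integrable lborel S F" and "(\<lambda>m. LINT x:S|lborel. f m x) sums (LINT x:S|lborel. F x)"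
    and "\<And>m. set_integrable lborel S (f m)"
proof -
  have iw: "set_integrable lborel S (\<lambda>x. M m * w x)" for m
    by (rule set_integrable_mult_right) (rule w)
  show i: "set_integrable lborel S (f m)" for m
    by (rule set_integrable_bound_continuous[OF iw[of m] S cont le])
  have i': "set_integrable lborel S (\<lambda>x. norm (f m x))" for m
    using i[of m] by (rule set_integrable_norm)
  have b: "(LINT x:S|lborel. norm (f m x)) \<le> M m * (LINT x:S|lborel. w x)" for m
  proof -
    have "(LINT x:S|lborel. norm (f m x)) \<le> (LINT x:S|lborel. M m * w x)"
      by (rule set_integral_mono[OF i' iw le])
    then show ?thesis by simp
  qed
  have "summable (\<lambda>m. LINT x:S|lborel. norm (f m x))"
  proof (rule summable_comparison_test'[of "\<lambda>m. M m * (LINT x:S|lborel. w x)" 0])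
    show "summable (\<lambda>m. M m * (LINT x:S|lborel. w x))" by (rule summable_mult2[OF M(1)])
    fix m :: nat
    have "0 \<le> (LINT x:S|lborel. norm (f m x))"
      unfolding set_lebesgue_integral_def by (rule Bochner_Integration.integral_nonneg) (simp add: indicator_def)
    then show "norm (LINT x:S|lborel. norm (f m x)) \<le> M m * (LINT x:S|lborel. w x)" using b[of m] by simp
  qed
  note 1 = this
  have 2: "summable (\<lambda>m. norm (f m x))" if "x \<in> S" for x
    by (rule summable_comparison_test'[OF summable_mult2[OF M(1), of "w x"], of 0]) (use le[OF that] in simp)
  show "set_integrable lborel S F" by (rule LINT_sums(1)[OF i 1 2 F])
  show "(\<lambda>m. LINT x:S|lborel. f m x) sums (LINT x:S|lborel. F x)" by (rule LINT_sums(2)[OF i 1 2 F])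
qed

lemma LINT_split_at:
  fixes f :: "real \<Rightarrow> 'b::{banach, second_countable_topology}"
  assumes f: "set_integrable lborel S f" and S: "{A..} \<subseteq> S" "S \<in> sets borel"
  shows "(LINT x:S|lborel. f x) = (LINT x:S \<inter> {..A}|lborel. f x) + (LINT x:{A..}|lborel. f x)"
proof -
  have 1: "S = (S \<inter> {..A}) \<union> {A<..}" using S(1) by auto
  have s1: "S \<inter> {..A} \<in> sets lborel" using S by auto
  have "(LINT x:(S \<inter> {..A}) \<union> {A<..}|lborel. f x) = (LINT x:S \<inter> {..A}|lborel. f x) + (LINT x:{A<..}|lborel. f x)"
  proof (rule set_integral_Un)
    show "set_integrable lborel (S \<inter> {..A}) f"
      by (rule set_integrable_subset[OF f s1]) auto
    show "set_integrable lborel {A<..} f"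
      by (rule set_integrable_subset[OF f]) (use S(1) in auto)
  qed auto
  also have "(LINT x:{A<..}|lborel. f x) = (LINT x:{A..}|lborel. f x)"
  proof (rule set_integral_cong_set)
    have "set_integrable lborel {A<..} f" "set_integrable lborel {A..} f"
      by (rule set_integrable_subset[OF f]; use S(1) in auto)+
    then show "set_borel_measurable lborel {A<..} f" "set_borel_measurable lborel {A..} f"
      unfolding set_integrable_def set_borel_measurable_def by auto
    show "AE x in lborel. (x \<in> {A..}) = (x \<in> {A<..})"
      using AE_lborel_singleton[of A] by eventually_elim auto
  qed
  finally show ?thesis unfolding 1[symmetric] .
qed

lemma LINT_split_pos:
  fixes f :: "real \<Rightarrow> 'b::{banach, second_countable_topology}"
  assumes f: "set_integrable lborel {0<..} f" and A: "A > 0"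
  shows "(LINT x:{0<..}|lborel. f x) = (LINT x:{0<..A}|lborel. f x) + (LINT x:{A..}|lborel. f x)"
proof -
  have "{0<..} \<inter> {..A} = {0<..A}" by auto
  then show ?thesis using LINT_split_at[OF f, of A] A by (simp add: subset_eq)
qed

lemma LINT_split_Ici:
  fixes f :: "real \<Rightarrow> 'b::{banach, second_countable_topology}"
  assumes f: "set_integrable lborel {A..} f" and A: "A \<le> B"
  shows "(LINT x:{A..}|lborel. f x) = (LINT x:{A..B}|lborel. f x) + (LINT x:{B..}|lborel. f x)"
proof -
  have "{A..} \<inter> {..B} = {A..B}" by auto
  then show ?thesis using LINT_split_at[OF f, of B] A by (simp add: subset_eq)
qed

section \<open>Finite parts of integrals at the origin\<close>

text \<open>
  Hadamard's finite part of \<open>\<integral> x powr (p - 1) (\<Sum>\<^sub>m c\<^sub>m x\<^sup>m) dx\<close> over the interval from 0 to \<open>A\<close>: the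
  termwise primitive at \<open>A\<close>, without a contribution from the origin. It is the integral for
  \<open>Re p > 0\<close> and its continuation in \<open>p\<close>, as long as no exponent \<open>p + m\<close> is 0.
\<close>

definition finite_part :: "(nat \<Rightarrow> complex) \<Rightarrow> complex \<Rightarrow> real \<Rightarrow> complex" where
  "finite_part c p A = (\<Sum>m. c m * of_real A powr (p + of_nat m) / (p + of_nat m))"

lemma nonpos_Ints_dist:
  fixes p :: complex
  assumes "p \<notin> \<int>\<^sub>\<le>\<^sub>0"
  obtains \<delta> where "\<delta> > 0" "\<And>m::nat. cmod (p + of_nat m) \<ge> \<delta>"
proof -
  have "open (- (\<int>\<^sub>\<le>\<^sub>0 :: complex set))" by (rule open_Compl[OF closed_nonpos_Ints])
  moreover have "p \<in> - \<int>\<^sub>\<le>\<^sub>0" using assms by simp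
  ultimately obtain \<delta> where \<delta>: "\<delta> > 0" "ball p \<delta> \<subseteq> - \<int>\<^sub>\<le>\<^sub>0"
    by (rule openE)
  have "cmod (p + of_nat m) \<ge> \<delta>" for m :: nat
  proof (rule ccontr)
    assume "\<not> cmod (p + of_nat m) \<ge> \<delta>"
    then have "- of_nat m \<in> ball p \<delta>" by (simp add: dist_norm)
    then show False using \<delta>(2) by auto
  qed
  with \<delta>(1) show ?thesis using that by blast
qed

lemma nonpos_Ints_add_nat: "p \<notin> \<int>\<^sub>\<le>\<^sub>0 \<Longrightarrow> p + of_nat m \<noteq> 0" for p :: complex
proof
  assume "p \<notin> \<int>\<^sub>\<le>\<^sub>0" "p + of_nat m = 0"
  moreover from this have "p = - of_nat m" by (simp add: add_eq_0_iff2)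
  ultimately show False by simp
qed

lemma finite_part_term_bound:
  assumes "A > 0" "\<delta> > 0" "cmod (p + of_nat m) \<ge> \<delta>"
  shows "cmod (c * of_real A powr (p + of_nat m) / (p + of_nat m)) \<le> A powr Re p / \<delta> * (cmod c * A ^ m)"
proof -
  have "cmod (c * of_real A powr (p + of_nat m) / (p + of_nat m)) = cmod c * (A powr Re p * A ^ m) / cmod (p + of_nat m)"
    using assms(1) by (simp add: norm_mult norm_divide norm_of_real_powr norm_power powr_add powr_realpow)
  also have "\<dots> \<le> cmod c * (A powr Re p * A ^ m) / \<delta>"
    using assms by (intro divide_left_mono mult_nonneg_nonneg mult_pos_pos) auto
  finally show ?thesis by (simp add: field_simps)
qed

lemma finite_part_summable:
  assumes p: "p \<notin> \<int>\<^sub>\<le>\<^sub>0" and A: "A > 0" and c: "summable (\<lambda>m. cmod (c m) * A ^ m)"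
  shows "summable (\<lambda>m. cmod (c m * of_real A powr (p + of_nat m) / (p + of_nat m)))"
proof -
  obtain \<delta> where \<delta>: "\<delta> > 0" "\<And>m::nat. cmod (p + of_nat m) \<ge> \<delta>" using nonpos_Ints_dist[OF p] by blast
  show ?thesis
    by (rule summable_comparison_test'[OF summable_mult[OF c, of "A powr Re p / \<delta>"], of 0])
      (simp only: real_norm_def abs_norm_cancel finite_part_term_bound[OF A \<delta>])
qed

lemma finite_part_sums:
  assumes p: "p \<notin> \<int>\<^sub>\<le>\<^sub>0" and A: "A > 0" and c: "summable (\<lambda>m. cmod (c m) * A ^ m)"
  shows "(\<lambda>m. c m * of_real A powr (p + of_nat m) / (p + of_nat m)) sums finite_part c p A"
  unfolding finite_part_def by (rule summable_sums[OF summable_norm_cancel[OF finite_part_summable[OF assms]]])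

text \<open>
  Integration by parts for finite parts: if \<open>\<alpha> c(x) - \<beta> x d(x)\<close> times \<open>x powr (p - 1)\<close> is the derivative
  of \<open>x\<^sup>p u(x)\<close>, which in terms of coefficients is the assumption \<open>id\<close>, then only the boundary value at
  \<open>A\<close> remains.
\<close>

lemma finite_part_shift:
  assumes p: "p \<notin> \<int>\<^sub>\<le>\<^sub>0" and A: "A > 0"
    and c: "summable (\<lambda>m. cmod (c m) * A ^ m)" and d: "summable (\<lambda>m. cmod (d m) * A ^ m)"
    and id: "\<And>m. \<alpha> * c m - \<beta> * (case m of 0 \<Rightarrow> 0 | Suc k \<Rightarrow> d k) = (p + of_nat m) * u m"
    and U: "(\<lambda>m. u m * of_real A ^ m) sums U"
  shows "\<alpha> * finite_part c p A - \<beta> * finite_part d (p + 1) A = of_real A powr p * U"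
proof -
  let ?g = "\<lambda>m. (case m of 0 \<Rightarrow> 0 | Suc k \<Rightarrow> d k) * of_real A powr (p + of_nat m) / (p + of_nat m)"
  have p1: "p + 1 \<notin> \<int>\<^sub>\<le>\<^sub>0" using p plus_one_in_nonpos_Ints_imp by blast
  have "(\<lambda>m. ?g (Suc m)) sums finite_part d (p + 1) A"
    using finite_part_sums[OF p1 A d] by (simp add: add.assoc)
  then have g: "?g sums finite_part d (p + 1) A" by (subst (asm) sums_Suc_iff) simp
  have "(\<lambda>m. \<alpha> * (c m * of_real A powr (p + of_nat m) / (p + of_nat m)) - \<beta> * ?g m) sums
      (\<alpha> * finite_part c p A - \<beta> * finite_part d (p + 1) A)"
    by (intro sums_diff sums_mult g finite_part_sums p A c)
  also have "(\<lambda>m. \<alpha> * (c m * of_real A powr (p + of_nat m) / (p + of_nat m)) - \<beta> * ?g m) = (\<lambda>m. of_real A powr p * (u m * of_real A ^ m))"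
  proof
    fix m
    have nz: "p + of_nat m \<noteq> 0" by (rule nonpos_Ints_add_nat[OF p])
    have "\<alpha> * (c m * of_real A powr (p + of_nat m) / (p + of_nat m)) - \<beta> * ?g m
       = (\<alpha> * c m - \<beta> * (case m of 0 \<Rightarrow> 0 | Suc k \<Rightarrow> d k)) * of_real A powr (p + of_nat m) / (p + of_nat m)"
      by (simp add: left_diff_distrib diff_divide_distrib mult.assoc)
    also have "\<dots> = u m * of_real A powr (p + of_nat m)" unfolding id using nz by simp
    also have "u m * of_real A powr (p + of_nat m) = of_real A powr p * (u m * of_real A ^ m)"
      using A by (simp add: powr_add powr_nat)
    finally show "\<alpha> * (c m * of_real A powr (p + of_nat m) / (p + of_nat m)) - \<beta> * ?g m = of_real A powr p * (u m * of_real A ^ m)"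
      .
  qed
  finally have "(\<lambda>m. of_real A powr p * (u m * of_real A ^ m)) sums (\<alpha> * finite_part c p A - \<beta> * finite_part d (p + 1) A)" .
  from sums_unique2[OF this sums_mult[OF U]] show ?thesis .
qed

text \<open>
  The same integration by parts for two series that multiply the same power of \<open>x\<close>.
\<close>

lemma finite_part_same:
  assumes p: "p \<notin> \<int>\<^sub>\<le>\<^sub>0" and A: "A > 0"
    and c: "summable (\<lambda>m. cmod (c m) * A ^ m)" and d: "summable (\<lambda>m. cmod (d m) * A ^ m)"
    and id: "\<And>m. \<alpha> * c m - \<beta> * d m = (p + of_nat m) * u m"
    and U: "(\<lambda>m. u m * of_real A ^ m) sums U"
  shows "\<alpha> * finite_part c p A - \<beta> * finite_part d p A = of_real A powr p * U"
proof -
  have "(\<lambda>m. \<alpha> * (c m * of_real A powr (p + of_nat m) / (p + of_nat m)) - \<beta> * (d m * of_real A powr (p + of_nat m) / (p + of_nat m))) sums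
      (\<alpha> * finite_part c p A - \<beta> * finite_part d p A)"
    by (intro sums_diff sums_mult finite_part_sums p A c d)
  also have "(\<lambda>m. \<alpha> * (c m * of_real A powr (p + of_nat m) / (p + of_nat m)) - \<beta> * (d m * of_real A powr (p + of_nat m) / (p + of_nat m)))
     = (\<lambda>m. of_real A powr p * (u m * of_real A ^ m))"
  proof
    fix m
    have nz: "p + of_nat m \<noteq> 0" by (rule nonpos_Ints_add_nat[OF p])
    have "\<alpha> * (c m * of_real A powr (p + of_nat m) / (p + of_nat m)) - \<beta> * (d m * of_real A powr (p + of_nat m) / (p + of_nat m))
       = (\<alpha> * c m - \<beta> * d m) * of_real A powr (p + of_nat m) / (p + of_nat m)"
      by (simp add: left_diff_distrib diff_divide_distrib mult.assoc)
    also have "\<dots> = u m * of_real A powr (p + of_nat m)" unfolding id using nz by simp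
    also have "u m * of_real A powr (p + of_nat m) = of_real A powr p * (u m * of_real A ^ m)"
      using A by (simp add: powr_add powr_nat)
    finally show "\<alpha> * (c m * of_real A powr (p + of_nat m) / (p + of_nat m)) - \<beta> * (d m * of_real A powr (p + of_nat m) / (p + of_nat m)) = of_real A powr p * (u m * of_real A ^ m)"
      .
  qed
  finally have "(\<lambda>m. of_real A powr p * (u m * of_real A ^ m)) sums (\<alpha> * finite_part c p A - \<beta> * finite_part d p A)" .
  from sums_unique2[OF this sums_mult[OF U]] show ?thesis .
qed

lemma of_real_powr_add_nat: "x > 0 \<Longrightarrow> complex_of_real x powr (p + of_nat m) = of_real x powr p * of_real x ^ m"
  by (simp add: powr_add powr_nat)

lemma finite_part_eq_LINT:
  assumes p: "Re p > 0" and A: "A > 0" and c: "summable (\<lambda>m. cmod (c m) * A ^ m)"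
    and \<phi>: "\<And>x. 0 < x \<Longrightarrow> x \<le> A \<Longrightarrow> (\<lambda>m. c m * of_real x ^ m) sums \<phi> x"
  shows "set_integrable lborel {0<..A} (\<lambda>x. of_real x powr (p - 1) * \<phi> x)"
    and "(LINT x:{0<..A}|lborel. of_real x powr (p - 1) * \<phi> x) = finite_part c p A"
proof -
  let ?f = "\<lambda>m x. c m * of_real x powr (p + of_nat m - 1)"
  have w: "set_integrable lborel {0<..A} (\<lambda>x. x powr (Re p - 1))"
    using p A by (intro set_integrable_powr_0) auto
  have e: "?f m x = of_real x powr (p - 1) * (c m * of_real x ^ m)" if "x > 0" for m x
  proof -
    have "p + of_nat m - 1 = (p - 1) + of_nat m" by simp
    then show ?thesis using that by (simp only: of_real_powr_add_nat) simp
  qed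
  have le: "cmod (?f m x) \<le> cmod (c m) * A ^ m * x powr (Re p - 1)" if "x \<in> {0<..A}" for m x
  proof -
    have "cmod (?f m x) = x powr (Re p - 1) * (cmod (c m) * x ^ m)"
      using that by (subst e) (auto simp: norm_mult norm_of_real_powr norm_power)
    also have "\<dots> \<le> x powr (Re p - 1) * (cmod (c m) * A ^ m)"
      using that by (intro mult_left_mono power_mono) auto
    finally show ?thesis by (simp add: mult_ac)
  qed
  have F: "(\<lambda>m. ?f m x) sums (of_real x powr (p - 1) * \<phi> x)" if "x \<in> {0<..A}" for x
    using that by (subst e) (auto intro!: sums_mult \<phi>)
  have ct: "continuous_on {0<..A} (?f m)" for m
    by (intro continuous_intros continuous_on_of_real_powr) auto
  have M: "cmod (c m) * A ^ m \<ge> 0" for m using A by simp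
  have sb: "{0<..A} \<in> sets borel" by simp
  note L = LINT_sums_dominated[OF sb ct w c M le F]
  show "set_integrable lborel {0<..A} (\<lambda>x. of_real x powr (p - 1) * \<phi> x)" by (rule L(1))
  have "(LINT x:{0<..A}|lborel. ?f m x) = c m * of_real A powr (p + of_nat m) / (p + of_nat m)" for m
    using LINT_powr_0(2)[of "p + of_nat m" A] p A by simp
  with L(2) have "(\<lambda>m. c m * of_real A powr (p + of_nat m) / (p + of_nat m)) sums (LINT x:{0<..A}|lborel. of_real x powr (p - 1) * \<phi> x)"
    by simp
  then show "(LINT x:{0<..A}|lborel. of_real x powr (p - 1) * \<phi> x) = finite_part c p A"
    unfolding finite_part_def by (simp add: sums_iff)
qed

section \<open>The Mellin transform of the Bessel--Clifford function\<close>

definition scaled_bcoef :: "real \<Rightarrow> real \<Rightarrow> nat \<Rightarrow> complex" where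
  "scaled_bcoef \<nu> \<xi> m = of_real (bcoef \<nu> m * \<xi> ^ m)"

lemma scaled_bcoef_sums:
  "(\<lambda>m. scaled_bcoef \<nu> \<xi> m * of_real x ^ m) sums of_real (bessel_clifford \<nu> (\<xi> * x))"
proof -
  have "(\<lambda>m. complex_of_real (of_real (bcoef \<nu> m) * (\<xi> * x) ^ m)) sums of_real (bessel_clifford \<nu> (\<xi> * x))"
    using bessel_clifford_sums[of \<nu> "\<xi> * x"] by (simp only: sums_of_real_iff)
  then show ?thesis by (simp add: scaled_bcoef_def power_mult_distrib mult.assoc)
qed

lemma summable_scaled_bcoef:
  assumes "\<xi> \<ge> 0" "A \<ge> 0"
  shows "summable (\<lambda>m. cmod (scaled_bcoef \<nu> \<xi> m) * A ^ m)"
proof -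
  have "cmod (scaled_bcoef \<nu> \<xi> m) * A ^ m = \<bar>bcoef \<nu> m\<bar> * (\<xi> * A) ^ m" for m
    using assms(1) unfolding scaled_bcoef_def norm_of_real by (simp add: abs_mult power_mult_distrib)
  then show ?thesis using summable_bcoef_norm[of "\<xi> * A" \<nu>] assms by simp
qed

lemma continuous_on_bessel_clifford [continuous_intros]:
  fixes f :: "'a::topological_space \<Rightarrow> 'b::{real_normed_field,banach}"
  assumes "continuous_on S f"
  shows "continuous_on S (\<lambda>x. bessel_clifford \<nu> (f x))"
proof -
  have "continuous_on UNIV (bessel_clifford \<nu> :: 'b \<Rightarrow> 'b)"
    by (rule DERIV_continuous_on) (rule has_field_derivative_at_within[OF DERIV_bessel_clifford])
  from continuous_on_compose2[OF this assms] show ?thesis by simp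
qed

lemma bessel_clifford_scaled_bound:
  assumes "A > 0" "\<xi> > 0"
  obtains K where "K \<ge> 0" "\<And>x. x \<ge> A \<Longrightarrow> \<bar>bessel_clifford \<nu> (\<xi> * x)\<bar> \<le> K * x powr (- \<nu> / 2 - 1 / 4)"
proof -
  obtain K where K: "K \<ge> 0" "\<And>w. w \<ge> \<xi> * A \<Longrightarrow> \<bar>bessel_clifford \<nu> w\<bar> \<le> K * w powr (- \<nu> / 2 - 1 / 4)"
    using bessel_clifford_bound[of "\<xi> * A" \<nu>] assms by auto
  show ?thesis
  proof
    show "K * \<xi> powr (- \<nu> / 2 - 1 / 4) \<ge> 0" using K(1) by simp
    fix x assume x: "x \<ge> A"
    then have "\<bar>bessel_clifford \<nu> (\<xi> * x)\<bar> \<le> K * (\<xi> * x) powr (- \<nu> / 2 - 1 / 4)"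
      using assms by (intro K(2)) auto
    then show "\<bar>bessel_clifford \<nu> (\<xi> * x)\<bar> \<le> K * \<xi> powr (- \<nu> / 2 - 1 / 4) * x powr (- \<nu> / 2 - 1 / 4)"
      using x assms by (simp add: powr_mult mult.assoc)
  qed
qed

lemma set_integrable_powr_bessel_Ici:
  assumes A: "A > 0" and \<xi>: "\<xi> > 0" and p: "Re p < \<nu> / 2 + 1 / 4"
  shows "set_integrable lborel {A..} (\<lambda>x. of_real x powr (p - 1) * complex_of_real (bessel_clifford \<nu> (\<xi> * x)))"
proof -
  obtain K where K: "K \<ge> 0" "\<And>x. x \<ge> A \<Longrightarrow> \<bar>bessel_clifford \<nu> (\<xi> * x)\<bar> \<le> K * x powr (- \<nu> / 2 - 1 / 4)"
    using bessel_clifford_scaled_bound[OF A \<xi>] by blast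
  show ?thesis
  proof (rule set_integrable_bound_continuous)
    show "set_integrable lborel {A..} (\<lambda>x. K * x powr (Re p - 1 + (- \<nu> / 2 - 1 / 4)))"
      using p A by (intro set_integrable_mult_right set_integrable_powr_Ici) auto
    show "continuous_on {A..} (\<lambda>x. of_real x powr (p - 1) * complex_of_real (bessel_clifford \<nu> (\<xi> * x)))"
      using A by (intro continuous_intros continuous_on_of_real_powr) auto
    fix x assume "x \<in> {A..}"
    then have x: "x \<ge> A" "x > 0" using A by auto
    have "cmod (of_real x powr (p - 1) * complex_of_real (bessel_clifford \<nu> (\<xi> * x))) = x powr (Re p - 1) * \<bar>bessel_clifford \<nu> (\<xi> * x)\<bar>"
      using x by (simp add: norm_mult norm_of_real_powr)
    also have "\<dots> \<le> x powr (Re p - 1) * (K * x powr (- \<nu> / 2 - 1 / 4))"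
      using x by (intro mult_left_mono K) auto
    also have "\<dots> = K * x powr (Re p - 1 + (- \<nu> / 2 - 1 / 4))" by (simp only: powr_add mult_ac)
    finally show "cmod (of_real x powr (p - 1) * complex_of_real (bessel_clifford \<nu> (\<xi> * x))) \<le> K * x powr (Re p - 1 + (- \<nu> / 2 - 1 / 4))" .
  qed simp
qed

text \<open>
  The Laplace transform of \<open>z\<^sup>\<nu> E\<^sub>\<nu>(\<xi> z)\<close>. Termwise integration cancels the factor \<open>1/\<Gamma>(\<nu> + 1 + m)\<close>
  and leaves an exponential series.
\<close>

lemma LINT_exp_powr_bessel:
  assumes \<nu>: "\<nu> > -1" and t: "t > 0" and \<xi>: "\<xi> > 0"
  shows "(LINT z:{0<..}|lborel. exp (- (t * z)) * z powr \<nu> * bessel_clifford \<nu> (\<xi> * z)) = t powr (- \<nu> - 1) * exp (- \<xi> / t)"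
proof -
  let ?f = "\<lambda>m z. bcoef \<nu> m * \<xi> ^ m * (z powr (\<nu> + 1 + real m - 1) * exp (- (t * z)))"
  have G: "set_integrable lborel {0<..} (\<lambda>z. z powr (\<nu> + 1 + real m - 1) * exp (- (t * z)))"
      "(LINT z:{0<..}|lborel. z powr (\<nu> + 1 + real m - 1) * exp (- (t * z))) = Gamma (\<nu> + 1 + real m) * t powr (- (\<nu> + 1 + real m))" for m
    using LINT_Gamma_real[of "\<nu> + 1 + real m" t] \<nu> t by auto
  have i: "set_integrable lborel {0<..} (?f m)" for m
    by (rule set_integrable_mult_right) (rule G)
  have n1: "(LINT z:{0<..}|lborel. norm (?f m z)) = t powr (- \<nu> - 1) * ((\<xi> / t) ^ m / fact m)"
   and n2: "(LINT z:{0<..}|lborel. ?f m z) = t powr (- \<nu> - 1) * ((- \<xi> / t) ^ m / fact m)" for m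
  proof -
    have g0: "Gamma (\<nu> + 1 + real m) > 0" using \<nu> by (intro Gamma_real_pos) auto
    have "rGamma (\<nu> + 1 + real m) * Gamma (\<nu> + 1 + real m) = 1"
      using g0 by (simp add: rGamma_inverse_Gamma)
    then have b: "bcoef \<nu> m * Gamma (\<nu> + 1 + real m) = (-1) ^ m / fact m"
      by (simp add: bcoef_def)
    have "\<bar>bcoef \<nu> m * Gamma (\<nu> + 1 + real m)\<bar> = 1 / fact m" unfolding b by simp
    then have ab: "\<bar>bcoef \<nu> m\<bar> * Gamma (\<nu> + 1 + real m) = 1 / fact m"
      using g0 unfolding abs_mult by simp
    have tp: "t powr (- (\<nu> + 1 + real m)) = t powr (- \<nu> - 1) * (1 / t) ^ m"
    proof -
      have "- (\<nu> + 1 + real m) = (- \<nu> - 1) + - real m" by simp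
      then have "t powr (- (\<nu> + 1 + real m)) = t powr (- \<nu> - 1) * t powr (- real m)" by (simp only: powr_add)
      also have "t powr (- real m) = (1 / t) ^ m" using t by (simp add: powr_minus powr_realpow power_one_over inverse_eq_divide)
      finally show ?thesis .
    qed
    have "(LINT z:{0<..}|lborel. norm (?f m z)) = (LINT z:{0<..}|lborel. \<bar>bcoef \<nu> m\<bar> * \<xi> ^ m * (z powr (\<nu> + 1 + real m - 1) * exp (- (t * z))))"
      using \<xi> by (intro set_lebesgue_integral_cong) (auto simp: abs_mult)
    also have "\<dots> = (\<bar>bcoef \<nu> m\<bar> * Gamma (\<nu> + 1 + real m)) * \<xi> ^ m * (t powr (- \<nu> - 1) * (1 / t) ^ m)"
      unfolding set_integral_mult_right G(2) tp by (simp add: mult_ac)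
    also have "\<dots> = t powr (- \<nu> - 1) * ((\<xi> / t) ^ m / fact m)"
      unfolding ab by (simp add: power_divide mult_ac)
    finally show "(LINT z:{0<..}|lborel. norm (?f m z)) = t powr (- \<nu> - 1) * ((\<xi> / t) ^ m / fact m)" .
    have "(LINT z:{0<..}|lborel. ?f m z) = (bcoef \<nu> m * Gamma (\<nu> + 1 + real m)) * \<xi> ^ m * (t powr (- \<nu> - 1) * (1 / t) ^ m)"
      unfolding set_integral_mult_right G(2) tp by (simp add: mult_ac)
    also have "\<dots> = t powr (- \<nu> - 1) * ((- \<xi> / t) ^ m / fact m)"
      unfolding b by (simp add: power_divide mult_ac power_minus[of "\<xi> / t"] power_minus[of \<xi>])
    finally show "(LINT z:{0<..}|lborel. ?f m z) = t powr (- \<nu> - 1) * ((- \<xi> / t) ^ m / fact m)" .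
  qed
  have ex: "(\<lambda>m. x ^ m / fact m) sums exp x" for x :: real
    using exp_converges[of x] by (simp add: divide_inverse_commute)
  have sn: "summable (\<lambda>m. LINT z:{0<..}|lborel. norm (?f m z))"
    unfolding n1 by (rule summable_mult[OF sums_summable[OF ex]])
  have F: "(\<lambda>m. ?f m z) sums (exp (- (t * z)) * z powr \<nu> * bessel_clifford \<nu> (\<xi> * z))"
   and sp: "summable (\<lambda>m. norm (?f m z))" if "z \<in> {0<..}" for z
  proof -
    have e: "?f m z = exp (- (t * z)) * z powr \<nu> * (of_real (bcoef \<nu> m) * (\<xi> * z) ^ m)" for m
      using that by (simp add: powr_add powr_realpow power_mult_distrib)
    show "(\<lambda>m. ?f m z) sums (exp (- (t * z)) * z powr \<nu> * bessel_clifford \<nu> (\<xi> * z))"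
      unfolding e by (intro sums_mult bessel_clifford_sums)
    have "norm (?f m z) = exp (- (t * z)) * z powr \<nu> * norm (of_real (bcoef \<nu> m) * (\<xi> * z) ^ m)" for m
      unfolding e by (simp add: abs_mult)
    then show "summable (\<lambda>m. norm (?f m z))"
      using summable_mult[OF summable_norm_bessel_clifford[of \<nu> "\<xi> * z"], of "exp (- (t * z)) * z powr \<nu>"] by (simp only:)
  qed
  have "(\<lambda>m. LINT z:{0<..}|lborel. ?f m z) sums (LINT z:{0<..}|lborel. exp (- (t * z)) * z powr \<nu> * bessel_clifford \<nu> (\<xi> * z))"
    by (rule LINT_sums(2)[OF i sn sp F])
  moreover have "(\<lambda>m. LINT z:{0<..}|lborel. ?f m z) sums (t powr (- \<nu> - 1) * exp (- \<xi> / t))"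
    unfolding n2 by (intro sums_mult ex)
  ultimately show ?thesis by (rule sums_unique2)
qed

lemma LINT_Gamma_inverse:
  fixes p :: complex
  assumes p: "Re p > 0" and c: "c > 0"
  shows "(LINT t:{0<..}|lborel. of_real t powr (- p - 1) * of_real (exp (- c / t))) = Gamma p * of_real c powr (- p)"
proof -
  have "(LINT t:{0<..}|lborel. of_real (1 / t\<^sup>2) * (of_real (1 / t) powr (p - 1) * of_real (exp (- (c * (1 / t))))))
     = (LINT x:{0<..}|lborel. of_real x powr (p - 1) * of_real (exp (- (c * x))))"
    by (rule LINT_inverse[OF LINT_Gamma(1)[OF p c]]) (intro continuous_intros continuous_on_of_real_powr, auto)
  also have "\<dots> = Gamma p * of_real c powr (- p)" by (rule LINT_Gamma(2)[OF p c])
  also have "(LINT t:{0<..}|lborel. of_real (1 / t\<^sup>2) * (of_real (1 / t) powr (p - 1) * of_real (exp (- (c * (1 / t))))))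
     = (LINT t:{0<..}|lborel. of_real t powr (- p - 1) * of_real (exp (- c / t)))"
  proof (intro set_lebesgue_integral_cong)
    show "\<forall>t. t \<in> {0<..} \<longrightarrow> of_real (1 / t\<^sup>2) * (of_real (1 / t) powr (p - 1) * of_real (exp (- (c * (1 / t)))))
       = of_real t powr (- p - 1) * complex_of_real (exp (- c / t))"
    proof safe
      fix t :: real assume t: "t > 0"
      have "complex_of_real (1 / t) powr (p - 1) = of_real t powr (- (p - 1))"
        using t by (simp add: powr_def Ln_of_real ln_div algebra_simps flip: of_real_divide of_real_inverse)
      also have "\<dots> = of_real (t\<^sup>2) * of_real t powr (- p - 1)"
      proof -
        have "- (p - 1) = (- p - 1) + of_nat 2" by simp
        then show ?thesis using t by (simp only: of_real_powr_add_nat) simp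
      qed
      finally show "of_real (1 / t\<^sup>2) * (of_real (1 / t) powr (p - 1) * of_real (exp (- (c * (1 / t)))))
       = of_real t powr (- p - 1) * complex_of_real (exp (- c / t))" using t by simp
    qed
  qed simp
  finally show ?thesis .
qed

text \<open>
  The Mellin transform of \<open>E\<^sub>\<nu>(\<xi> x)\<close> at \<open>p\<close>, as a finite part at the origin. The value does not depend on
  the point \<open>A\<close> at which the half-line is divided.
\<close>

definition bessel_mellin :: "real \<Rightarrow> real \<Rightarrow> complex \<Rightarrow> real \<Rightarrow> complex" where
  "bessel_mellin \<nu> \<xi> p A = (LINT x:{A..}|lborel. of_real x powr (p - 1) * of_real (bessel_clifford \<nu> (\<xi> * x)))
     + finite_part (scaled_bcoef \<nu> \<xi>) p A"

text \<open>
  In the strip of convergence, \<open>z powr -s\<close> with \<open>s = \<nu> + 1 - p\<close> is written as a Laplace integral. After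
  exchanging the integrals the inner one is the known Laplace transform, and what remains is a Gamma
  integral in \<open>1/t\<close>.
\<close>

lemma bessel_mellin_base:
  assumes A: "A > 0" and \<xi>: "\<xi> > 0" and p0: "Re p > 0" and p: "Re p < \<nu> / 2 + 1 / 4"
  shows "bessel_mellin \<nu> \<xi> p A = of_real \<xi> powr (- p) * Gamma p * rGamma (of_real \<nu> + 1 - p)"
proof -
  define s where "s = of_real \<nu> + 1 - p"
  define B where "B = (\<lambda>z. bessel_clifford \<nu> (\<xi> * z))"
  have \<nu>: "\<nu> > -1/2" using p0 p by linarith
  have s: "Re s > 0" using p p0 \<nu> by (simp add: s_def)
  have Bc: "continuous_on S B" for S unfolding B_def by (intro continuous_intros)
  note low = finite_part_eq_LINT[OF p0 A summable_scaled_bcoef[of \<xi> A \<nu>] scaled_bcoef_sums]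
  have ih: "set_integrable lborel {A..} (\<lambda>x. of_real x powr (p - 1) * complex_of_real (B x))"
    unfolding B_def by (rule set_integrable_powr_bessel_Ici[OF A \<xi> p])
  have un: "{0<..} = {0<..A} \<union> {A..}" using A by auto
  have il: "set_integrable lborel {0<..A} (\<lambda>x. of_real x powr (p - 1) * complex_of_real (B x))"
    unfolding B_def using low(1) \<xi> A by simp
  have i: "set_integrable lborel {0<..} (\<lambda>x. of_real x powr (p - 1) * complex_of_real (B x))"
    unfolding un using il ih by (rule set_integrable_Un) auto
  define T where "T = (LINT x:{0<..}|lborel. of_real x powr (p - 1) * complex_of_real (B x))"
  have T: "T = bessel_mellin \<nu> \<xi> p A"
    unfolding T_def LINT_split_pos[OF i A] bessel_mellin_def using low(2) \<xi> A by (simp add: B_def)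
  define f where "f = (\<lambda>z t. (of_real t powr (s - 1) * of_real (exp (- (z * t)))) * complex_of_real (z powr \<nu> * B z))"
  have fz: "(LINT t:{0<..}|lborel. f z t) = Gamma s * (of_real z powr (p - 1) * of_real (B z))"
    and fi: "set_integrable lborel {0<..} (f z)"
    and fn: "(LINT t:{0<..}|lborel. cmod (f z t)) = Gamma (Re s) * cmod (of_real z powr (p - 1) * of_real (B z))" if z: "z > 0" for z
  proof -
    have zz: "of_real z powr (- s) * complex_of_real (z powr \<nu>) = of_real z powr (p - 1)"
    proof -
      have "complex_of_real (z powr \<nu>) = of_real z powr of_real \<nu>" using z by (simp add: powr_of_real)
      then have "of_real z powr (- s) * complex_of_real (z powr \<nu>) = of_real z powr (- s + of_real \<nu>)"
        by (simp only: powr_add)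
      then show ?thesis by (simp add: s_def)
    qed
    have "(LINT t:{0<..}|lborel. f z t) = Gamma s * of_real z powr (- s) * complex_of_real (z powr \<nu> * B z)"
      unfolding f_def set_integral_mult_left LINT_Gamma(2)[OF s z] ..
    then show "(LINT t:{0<..}|lborel. f z t) = Gamma s * (of_real z powr (p - 1) * of_real (B z))"
      unfolding zz[symmetric] by simp
    show "set_integrable lborel {0<..} (f z)"
      unfolding f_def using LINT_Gamma(1)[OF s z] by (intro set_integrable_mult_left)
    have "(LINT t:{0<..}|lborel. cmod (f z t)) = (LINT t:{0<..}|lborel. (t powr (Re s - 1) * exp (- (z * t))) * (z powr \<nu> * \<bar>B z\<bar>))"
      unfolding f_def using z by (intro set_lebesgue_integral_cong) (auto simp: norm_mult norm_of_real_powr abs_mult)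
    also have "\<dots> = Gamma (Re s) * z powr (- Re s) * (z powr \<nu> * \<bar>B z\<bar>)"
      unfolding set_integral_mult_left LINT_Gamma_real(2)[OF s z] ..
    also have "\<dots> = Gamma (Re s) * (z powr (- Re s + \<nu>) * \<bar>B z\<bar>)" by (simp only: powr_add mult.assoc)
    also have "- Re s + \<nu> = Re p - 1" by (simp add: s_def)
    finally show "(LINT t:{0<..}|lborel. cmod (f z t)) = Gamma (Re s) * cmod (of_real z powr (p - 1) * of_real (B z))"
      using z by (simp add: norm_mult norm_of_real_powr)
  qed
  have ft: "(LINT z:{0<..}|lborel. f z t) = of_real t powr (- p - 1) * of_real (exp (- \<xi> / t))" if t: "t > 0" for t
  proof -
    have "(LINT z:{0<..}|lborel. f z t) = (LINT z:{0<..}|lborel. of_real t powr (s - 1) * complex_of_real (exp (- (t * z)) * z powr \<nu> * B z))"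
      unfolding f_def by (intro set_lebesgue_integral_cong) (auto simp: mult_ac)
    also have "\<dots> = of_real t powr (s - 1) * of_real (LINT z:{0<..}|lborel. exp (- (t * z)) * z powr \<nu> * B z)"
      unfolding set_integral_mult_right set_integral_complex_of_real ..
    also have "\<dots> = of_real t powr (s - 1) * of_real (t powr (- \<nu> - 1)) * of_real (exp (- \<xi> / t))"
      unfolding B_def using LINT_exp_powr_bessel[OF _ t \<xi>, of \<nu>] \<nu> by simp
    also have "of_real t powr (s - 1) * complex_of_real (t powr (- \<nu> - 1)) = of_real t powr (- p - 1)"
    proof -
      have "complex_of_real (t powr (- \<nu> - 1)) = of_real t powr of_real (- \<nu> - 1)" using t by (intro powr_of_real[symmetric]) simp
      then have "of_real t powr (s - 1) * complex_of_real (t powr (- \<nu> - 1)) = of_real t powr ((s - 1) + of_real (- \<nu> - 1))"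
        by (simp only: powr_add)
      then show ?thesis by (simp add: s_def)
    qed
    finally show ?thesis .
  qed
  have "(LINT z:{0<..}|lborel. LINT t:{0<..}|lborel. f z t) = (LINT t:{0<..}|lborel. LINT z:{0<..}|lborel. f z t)"
  proof (rule LINT_fubini_pos)
    show "continuous_on ({0<..} \<times> {0<..}) (\<lambda>z. f (fst z) (snd z))"
      unfolding f_def by (intro continuous_intros continuous_on_compose2[OF Bc[of UNIV]]) (auto simp: less_imp_le)
    show "set_integrable lborel {0<..} (f x)" if "x > 0" for x by (rule fi[OF that])
    have "set_integrable lborel {0<..} (\<lambda>z. Gamma (Re s) * cmod (of_real z powr (p - 1) * of_real (B z)))"
      using set_integrable_norm[OF i] by (intro set_integrable_mult_right)
    then show "set_integrable lborel {0<..} (\<lambda>z. LINT t:{0<..}|lborel. cmod (f z t))"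
      by (subst set_integrable_cong[OF refl refl fn]) auto
  qed
  also have "(LINT z:{0<..}|lborel. LINT t:{0<..}|lborel. f z t) = (LINT z:{0<..}|lborel. Gamma s * (of_real z powr (p - 1) * of_real (B z)))"
    by (intro set_lebesgue_integral_cong) (auto simp: fz)
  also have "\<dots> = Gamma s * T" by (simp add: T_def)
  also have "(LINT t:{0<..}|lborel. LINT z:{0<..}|lborel. f z t) = (LINT t:{0<..}|lborel. of_real t powr (- p - 1) * of_real (exp (- \<xi> / t)))"
    by (intro set_lebesgue_integral_cong) (auto simp: ft)
  also have "\<dots> = Gamma p * of_real \<xi> powr (- p)" by (rule LINT_Gamma_inverse[OF p0 \<xi>])
  finally have "Gamma s * T = Gamma p * of_real \<xi> powr (- p)" .
  moreover have "Gamma s \<noteq> 0"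
    using s by (auto simp: Gamma_eq_zero_iff elim!: nonpos_Ints_cases)
  ultimately have "T = of_real \<xi> powr (- p) * Gamma p * rGamma s"
    by (simp add: rGamma_inverse_Gamma field_simps)
  then show ?thesis unfolding T s_def .
qed

text \<open>
  Integration by parts of \<open>x\<^sup>p E\<^bsub>\<nu>+1\<^esub>(\<xi> x)\<close> together with the three-term recurrence. It moves \<open>p\<close> to the
  right by 1 and \<open>\<nu>\<close> by 2, and this preserves the condition \<open>Re p < \<nu>/2 + 1/4\<close> for convergence at infinity,
  so that after finitely many steps the strip of convergence is reached.
\<close>

lemma bessel_mellin_step:
  assumes A: "A > 0" and \<xi>: "\<xi> > 0" and pn: "p \<notin> \<int>\<^sub>\<le>\<^sub>0" and p: "Re p < \<nu> / 2 + 1 / 4"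
  shows "bessel_mellin \<nu> \<xi> p A = (of_real \<nu> + 1 - p) / p * of_real \<xi> * bessel_mellin (\<nu> + 2) \<xi> (p + 1) A"
proof -
  define B where "B = (\<lambda>n z. complex_of_real (bessel_clifford n (\<xi> * z)))"
  define \<beta> where "\<beta> = (of_real \<nu> + 1 - p) / p * of_real \<xi>"
  define \<kappa> where "\<kappa> = (of_real \<nu> + 1) / p"
  have p0: "p \<noteq> 0" using pn by auto
  have "1 * finite_part (scaled_bcoef \<nu> \<xi>) p A - \<beta> * finite_part (scaled_bcoef (\<nu> + 2) \<xi>) (p + 1) A
     = of_real A powr p * (\<kappa> * B (\<nu> + 1) A)"
  proof (rule finite_part_shift[OF pn A])
    show "summable (\<lambda>m. cmod (scaled_bcoef \<nu> \<xi> m) * A ^ m)" "summable (\<lambda>m. cmod (scaled_bcoef (\<nu> + 2) \<xi> m) * A ^ m)"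
      using A \<xi> by (auto intro!: summable_scaled_bcoef)
    show "(\<lambda>m. \<kappa> * scaled_bcoef (\<nu> + 1) \<xi> m * of_real A ^ m) sums (\<kappa> * B (\<nu> + 1) A)"
      unfolding mult.assoc B_def by (intro sums_mult scaled_bcoef_sums)
    fix m
    have 1: "bcoef \<nu> m = (\<nu> + 1 + real m) * bcoef (\<nu> + 1) m"
      using bcoef_recurrence[of \<nu> m] by (simp add: algebra_simps)
    have 2: "of_real \<xi> * (case m of 0 \<Rightarrow> 0 | Suc k \<Rightarrow> scaled_bcoef (\<nu> + 2) \<xi> k) = - (of_nat m * scaled_bcoef (\<nu> + 1) \<xi> m)"
    proof (cases m)
      case (Suc k)
      have "- bcoef (\<nu> + 2) k = real (Suc k) * bcoef (\<nu> + 1) (Suc k)"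
        using bcoef_Suc[of k "\<nu> + 1"] by (simp add: add.assoc del: of_nat_Suc)
      then have "bcoef (\<nu> + 2) k = - (real (Suc k) * bcoef (\<nu> + 1) (Suc k))" by linarith
      then have "\<xi> * (bcoef (\<nu> + 2) k * \<xi> ^ k) = - (real m * (bcoef (\<nu> + 1) m * \<xi> ^ m))"
        unfolding Suc by simp
      then have "complex_of_real (\<xi> * (bcoef (\<nu> + 2) k * \<xi> ^ k)) = of_real (- (real m * (bcoef (\<nu> + 1) m * \<xi> ^ m)))" by simp
      then show ?thesis unfolding scaled_bcoef_def by (simp add: Suc)
    qed simp
    have 3: "scaled_bcoef \<nu> \<xi> m = (of_real \<nu> + 1 + of_nat m) * scaled_bcoef (\<nu> + 1) \<xi> m"
      unfolding scaled_bcoef_def 1 by simp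
    have "1 * scaled_bcoef \<nu> \<xi> m - \<beta> * (case m of 0 \<Rightarrow> 0 | Suc k \<Rightarrow> scaled_bcoef (\<nu> + 2) \<xi> k)
       = (of_real \<nu> + 1 + of_nat m) * scaled_bcoef (\<nu> + 1) \<xi> m + (of_real \<nu> + 1 - p) / p * (of_nat m * scaled_bcoef (\<nu> + 1) \<xi> m)"
      unfolding \<beta>_def mult.assoc 2 3 by simp
    also have "\<dots> = (p + of_nat m) * (\<kappa> * scaled_bcoef (\<nu> + 1) \<xi> m)"
      unfolding \<kappa>_def using p0 by (simp add: field_simps)
    finally show "1 * scaled_bcoef \<nu> \<xi> m - \<beta> * (case m of 0 \<Rightarrow> 0 | Suc k \<Rightarrow> scaled_bcoef (\<nu> + 2) \<xi> k)
       = (p + of_nat m) * (\<kappa> * scaled_bcoef (\<nu> + 1) \<xi> m)" .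
  qed
  note low = this
  let ?F = "\<lambda>x. \<kappa> * (of_real x powr p * B (\<nu> + 1) x)"
  let ?f = "\<lambda>x. of_real x powr (p - 1) * B \<nu> x - \<beta> * (of_real x powr (p + 1 - 1) * B (\<nu> + 2) x)"
  have i1: "set_integrable lborel {A..} (\<lambda>x. of_real x powr (p - 1) * B \<nu> x)"
    unfolding B_def by (rule set_integrable_powr_bessel_Ici[OF A \<xi> p])
  have i2: "set_integrable lborel {A..} (\<lambda>x. of_real x powr (p + 1 - 1) * B (\<nu> + 2) x)"
    unfolding B_def using p by (intro set_integrable_powr_bessel_Ici[OF A \<xi>]) (simp add: field_simps)
  have i2': "set_integrable lborel {A..} (\<lambda>x. \<beta> * (of_real x powr (p + 1 - 1) * B (\<nu> + 2) x))"
    by (rule set_integrable_mult_right) (rule i2)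
  have "(LINT x:{A..}|lborel. ?f x) = 0 - ?F A"
  proof (rule LINT_FTC_Ici)
    show "set_integrable lborel {A..} ?f" by (rule set_integral_diff(1)[OF i1 i2'])
    show "continuous_on {A..} ?f"
      unfolding B_def using A by (intro continuous_intros continuous_on_of_real_powr) auto
    show "(?F has_vector_derivative ?f x) (at x)" if "x \<ge> A" for x
    proof -
      have x: "x > 0" using that A by simp
      have "((\<lambda>x. bessel_clifford (\<nu> + 1) (\<xi> * x)) has_real_derivative - bessel_clifford (\<nu> + 1 + 1) (\<xi> * x) * \<xi>) (at x)"
        by (rule DERIV_bessel_clifford') (auto intro!: derivative_eq_intros)
      from has_vector_derivative_of_real[OF this]
      have d: "(B (\<nu> + 1) has_vector_derivative - (of_real \<xi> * B (\<nu> + 2) x)) (at x)"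
        unfolding B_def by (simp add: mult.commute add.assoc)
      have "(?F has_vector_derivative \<kappa> * (of_real x powr p * - (of_real \<xi> * B (\<nu> + 2) x) + p * of_real x powr (p - 1) * B (\<nu> + 1) x)) (at x)"
        by (intro has_vector_derivative_mult_right has_vector_derivative_mult has_vector_derivative_powr_complex x d)
      also have "\<kappa> * (of_real x powr p * - (of_real \<xi> * B (\<nu> + 2) x) + p * of_real x powr (p - 1) * B (\<nu> + 1) x) = ?f x"
      proof -
        have r: "B \<nu> x = (of_real \<nu> + 1) * B (\<nu> + 1) x - of_real \<xi> * of_real x * B (\<nu> + 2) x"
          unfolding B_def using bessel_clifford_recurrence[of \<nu> "\<xi> * x"] by simp
        have pw: "of_real x powr p = of_real x powr (p - 1) * complex_of_real x"
          using x by (simp add: powr_diff)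
        show ?thesis unfolding r \<beta>_def \<kappa>_def add_diff_cancel_right' pw using p0 by (simp add: field_simps)
      qed
      finally show ?thesis .
    qed
    show "(?F \<longlongrightarrow> 0) at_top"
    proof -
      obtain K where K: "K \<ge> 0" "\<And>x. x \<ge> A \<Longrightarrow> \<bar>bessel_clifford (\<nu> + 1) (\<xi> * x)\<bar> \<le> K * x powr (- (\<nu> + 1) / 2 - 1 / 4)"
        using bessel_clifford_scaled_bound[OF A \<xi>] by blast
      have "((\<lambda>x. of_real x powr p * B (\<nu> + 1) x) \<longlongrightarrow> 0) at_top"
      proof (rule Lim_null_comparison)
        show "((\<lambda>x. K * x powr (Re p + (- (\<nu> + 1) / 2 - 1 / 4))) \<longlongrightarrow> 0) at_top"
          using p by (intro tendsto_mult_right_zero tendsto_neg_powr filterlim_ident) (simp add: field_simps)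
        show "\<forall>\<^sub>F x in at_top. norm (of_real x powr p * B (\<nu> + 1) x) \<le> K * x powr (Re p + (- (\<nu> + 1) / 2 - 1 / 4))"
          using eventually_ge_at_top[of A]
        proof eventually_elim
          case (elim x)
          then have x: "x > 0" using A by simp
          have "norm (of_real x powr p * B (\<nu> + 1) x) = x powr Re p * \<bar>bessel_clifford (\<nu> + 1) (\<xi> * x)\<bar>"
            unfolding B_def using x by (simp add: norm_mult norm_of_real_powr)
          also have "\<dots> \<le> x powr Re p * (K * x powr (- (\<nu> + 1) / 2 - 1 / 4))"
            using elim by (intro mult_left_mono K) auto
          also have "\<dots> = K * x powr (Re p + (- (\<nu> + 1) / 2 - 1 / 4))" by (simp only: powr_add mult_ac)
          finally show ?case .
        qed
      qed
      then show ?thesis by (rule tendsto_mult_right_zero)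
    qed
  qed
  moreover have "(LINT x:{A..}|lborel. ?f x) = (LINT x:{A..}|lborel. of_real x powr (p - 1) * B \<nu> x) - \<beta> * (LINT x:{A..}|lborel. of_real x powr (p + 1 - 1) * B (\<nu> + 2) x)"
    unfolding set_integral_diff(2)[OF i1 i2'] set_integral_mult_right ..
  ultimately have "bessel_mellin \<nu> \<xi> p A = \<beta> * bessel_mellin (\<nu> + 2) \<xi> (p + 1) A"
    using low unfolding bessel_mellin_def B_def by (simp add: algebra_simps)
  then show ?thesis by (simp add: \<beta>_def)
qed

lemma bessel_mellin_eq:
  assumes A: "A > 0" and \<xi>: "\<xi> > 0" and pn: "p \<notin> \<int>\<^sub>\<le>\<^sub>0" and p: "Re p < \<nu> / 2 + 1 / 4"
  shows "bessel_mellin \<nu> \<xi> p A = of_real \<xi> powr (- p) * Gamma p * rGamma (of_real \<nu> + 1 - p)"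
proof -
  obtain n :: nat where "- Re p < real n" using reals_Archimedean2[of "- Re p"] by blast
  then have "Re p + real n > 0" by simp
  then show ?thesis using pn p
  proof (induction n arbitrary: \<nu> p)
    case 0
    then show ?case using bessel_mellin_base[OF A \<xi>] by simp
  next
    case (Suc n)
    have p0: "p \<noteq> 0" using Suc.prems by auto
    have IH: "bessel_mellin (\<nu> + 2) \<xi> (p + 1) A = of_real \<xi> powr (- (p + 1)) * Gamma (p + 1) * rGamma (of_real (\<nu> + 2) + 1 - (p + 1))"
      using Suc.prems plus_one_in_nonpos_Ints_imp[of p] by (intro Suc.IH) (auto simp: field_simps)
    have e: "of_real (\<nu> + 2) + 1 - (p + 1) = (of_real \<nu> + 1 - p) + 1" by simp
    have c: "of_real \<xi> powr (- (p + 1)) = of_real \<xi> powr (- p) / of_real \<xi>"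
      using \<xi> by (simp add: powr_diff)
    have "bessel_mellin \<nu> \<xi> p A = of_real \<xi> powr (- p) * Gamma p * ((of_real \<nu> + 1 - p) * rGamma ((of_real \<nu> + 1 - p) + 1))"
      unfolding bessel_mellin_step[OF A \<xi> Suc.prems(2,3)] IH e c Gamma_plus1[OF Suc.prems(2)]
      using p0 \<xi> by (simp add: field_simps)
    then show ?case unfolding rGamma_plus1 .
  qed
qed

section \<open>The Beta integral, continued in both parameters\<close>

definition neg_binomial :: "real \<Rightarrow> nat \<Rightarrow> complex" where
  "neg_binomial \<mu> m = of_real ((- \<mu>) gchoose m)"

lemma neg_binomial_sums: "\<bar>x\<bar> < 1 \<Longrightarrow> (\<lambda>m. neg_binomial \<mu> m * of_real x ^ m) sums of_real ((1 + x) powr (- \<mu>))"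
proof -
  assume "\<bar>x\<bar> < 1"
  then have "(\<lambda>m. complex_of_real (((- \<mu>) gchoose m) * x ^ m)) sums of_real ((1 + x) powr (- \<mu>))"
    unfolding sums_of_real_iff by (rule gen_binomial_real)
  then show ?thesis by (simp add: neg_binomial_def)
qed

lemma summable_neg_binomial:
  assumes "0 \<le> A" "A < 1"
  shows "summable (\<lambda>m. cmod (neg_binomial \<mu> m) * A ^ m)"
proof -
  obtain B where B: "A < B" "B < 1" using dense assms by blast
  have "summable (\<lambda>m. ((- \<mu>) gchoose m) * B ^ m)"
    using gen_binomial_real[of B "- \<mu>"] B assms by (auto simp: sums_iff)
  from powser_insidea[OF this, of A] B assms
  have "summable (\<lambda>m. norm (((- \<mu>) gchoose m) * A ^ m))" by simp
  moreover have "norm (((- \<mu>) gchoose m) * A ^ m) = cmod (neg_binomial \<mu> m) * A ^ m" for m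
    unfolding neg_binomial_def norm_of_real using assms by (simp add: abs_mult)
  ultimately show ?thesis by simp
qed

lemma neg_binomial_absorb: "of_real \<mu> * neg_binomial (\<mu> + 1) m = (of_real \<mu> + of_nat m) * neg_binomial \<mu> m"
proof -
  have "(- \<mu> - real m) * ((- \<mu>) gchoose m) = - \<mu> * ((- \<mu> - 1) gchoose m)"
    by (rule gbinomial_absorb_comp)
  moreover have "(\<mu> + real m) * ((- \<mu>) gchoose m) = - ((- \<mu> - real m) * ((- \<mu>) gchoose m))"
    by (simp add: left_diff_distrib distrib_right)
  ultimately have "\<mu> * ((- (\<mu> + 1)) gchoose m) = (\<mu> + real m) * ((- \<mu>) gchoose m)"
    by simp
  then have "complex_of_real (\<mu> * ((- (\<mu> + 1)) gchoose m)) = of_real ((\<mu> + real m) * ((- \<mu>) gchoose m))"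
    by (simp only:)
  then show ?thesis unfolding neg_binomial_def by simp
qed

lemma neg_binomial_shift:
  "of_real \<mu> * (case m of 0 \<Rightarrow> 0 | Suc k \<Rightarrow> neg_binomial (\<mu> + 1) k) = - (of_nat m * neg_binomial \<mu> m)"
proof (cases m)
  case (Suc k)
  have "of_nat (Suc k) * ((- \<mu>) gchoose Suc k) = - \<mu> * ((- \<mu> - 1) gchoose k)"
    by (rule gbinomial_absorption)
  then have "\<mu> * ((- (\<mu> + 1)) gchoose k) = - (real (Suc k) * ((- \<mu>) gchoose Suc k))"
    by (simp del: of_nat_Suc)
  then have "complex_of_real (\<mu> * ((- (\<mu> + 1)) gchoose k)) = of_real (- (real (Suc k) * ((- \<mu>) gchoose Suc k)))"
    by (simp only:)
  then show ?thesis unfolding neg_binomial_def Suc by (simp del: of_nat_Suc)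
qed simp

lemma neg_binomial_scaled_sums:
  "\<bar>x\<bar> < 1 \<Longrightarrow> (\<lambda>m. k * neg_binomial \<mu> m * of_real x ^ m) sums (k * of_real ((1 + x) powr (- \<mu>)))"
  unfolding mult.assoc by (intro sums_mult neg_binomial_sums)

lemma finite_part_neg_binomial_shift:
  assumes p: "p \<notin> \<int>\<^sub>\<le>\<^sub>0" and A: "0 < A" "A < 1"
  shows "p * finite_part (neg_binomial \<mu>) p A - of_real \<mu> * finite_part (neg_binomial (\<mu> + 1)) (p + 1) A
     = of_real A powr p * of_real ((1 + A) powr (- \<mu>))"
proof (rule finite_part_shift[OF p A(1)])
  show "summable (\<lambda>m. cmod (neg_binomial \<mu> m) * A ^ m)" "summable (\<lambda>m. cmod (neg_binomial (\<mu> + 1) m) * A ^ m)"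
    using A by (auto intro!: summable_neg_binomial)
  show "(\<lambda>m. neg_binomial \<mu> m * of_real A ^ m) sums of_real ((1 + A) powr (- \<mu>))"
    using A by (intro neg_binomial_sums) auto
  show "p * neg_binomial \<mu> m - of_real \<mu> * (case m of 0 \<Rightarrow> 0 | Suc k \<Rightarrow> neg_binomial (\<mu> + 1) k) = (p + of_nat m) * neg_binomial \<mu> m" for m
    unfolding neg_binomial_shift by (simp add: algebra_simps)
qed

lemma finite_part_neg_binomial_same:
  assumes p: "p \<notin> \<int>\<^sub>\<le>\<^sub>0" and A: "0 < A" "A < 1"
  shows "(of_real \<mu> - p) * finite_part (neg_binomial \<mu>) p A - of_real \<mu> * finite_part (neg_binomial (\<mu> + 1)) p A
     = - (of_real A powr p * of_real ((1 + A) powr (- \<mu>)))"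
proof -
  have "(of_real \<mu> - p) * finite_part (neg_binomial \<mu>) p A - of_real \<mu> * finite_part (neg_binomial (\<mu> + 1)) p A
     = of_real A powr p * (-1 * of_real ((1 + A) powr (- \<mu>)))"
  proof (rule finite_part_same[OF p A(1)])
    show "summable (\<lambda>m. cmod (neg_binomial \<mu> m) * A ^ m)" "summable (\<lambda>m. cmod (neg_binomial (\<mu> + 1) m) * A ^ m)"
      using A by (auto intro!: summable_neg_binomial)
    show "(of_real \<mu> - p) * neg_binomial \<mu> m - of_real \<mu> * neg_binomial (\<mu> + 1) m = (p + of_nat m) * (-1 * neg_binomial \<mu> m)" for m
      unfolding neg_binomial_absorb by (simp add: algebra_simps)
    show "(\<lambda>m. -1 * neg_binomial \<mu> m * of_real A ^ m) sums (-1 * of_real ((1 + A) powr (- \<mu>)))"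
      using A by (intro neg_binomial_scaled_sums) auto
  qed
  then show ?thesis by simp
qed

text \<open>
  The integral \<open>\<integral> x powr (p - 1) (1 + x) powr -\<mu> dx\<close> over the positive half-line, as a finite part at both
  ends. The substitution \<open>x \<rightarrow> 1/x\<close> turns the tail beyond 2 into a finite part up to \<open>1/2\<close> at the origin with
  the exponent \<open>\<mu> - p\<close>. The tail is cut off at 2 because the binomial series in \<open>1/x\<close> needs \<open>x\<close> bounded
  away from 1.
\<close>

definition beta_mellin :: "real \<Rightarrow> complex \<Rightarrow> real \<Rightarrow> complex" where
  "beta_mellin \<mu> p A = (LINT x:{A..2}|lborel. of_real x powr (p - 1) * of_real ((1 + x) powr (- \<mu>)))
     + finite_part (neg_binomial \<mu>) p A + finite_part (neg_binomial \<mu>) (of_real \<mu> - p) (1 / 2)"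

lemma set_integrable_beta_Icc:
  assumes "A > 0"
  shows "set_integrable lborel {A..B} (\<lambda>x. of_real x powr p * complex_of_real ((1 + x) powr (- \<mu>)))"
  using assms by (intro borel_integrable_atLeastAtMost' continuous_intros continuous_on_of_real_powr) auto

lemma LINT_beta_parts:
  assumes A: "0 < A" "A \<le> B"
  shows "p * (LINT x:{A..B}|lborel. of_real x powr (p - 1) * complex_of_real ((1 + x) powr (- \<mu>)))
       - of_real \<mu> * (LINT x:{A..B}|lborel. of_real x powr p * complex_of_real ((1 + x) powr (- (\<mu> + 1))))
     = of_real B powr p * of_real ((1 + B) powr (- \<mu>)) - of_real A powr p * of_real ((1 + A) powr (- \<mu>))"
proof -
  let ?f = "\<lambda>x. p * (of_real x powr (p - 1) * complex_of_real ((1 + x) powr (- \<mu>)))"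
  let ?g = "\<lambda>x. of_real \<mu> * (of_real x powr p * complex_of_real ((1 + x) powr (- (\<mu> + 1))))"
  let ?D = "\<lambda>x. of_real x powr p * complex_of_real ((1 + x) powr (- \<mu>))"
  have if_: "set_integrable lborel {A..B} ?f" by (rule set_integrable_mult_right) (rule set_integrable_beta_Icc[OF A(1)])
  have ig: "set_integrable lborel {A..B} ?g" by (rule set_integrable_mult_right) (rule set_integrable_beta_Icc[OF A(1)])
  have "(LINT x:{A..B}|lborel. ?f x - ?g x) = integral {A..B} (\<lambda>x. ?f x - ?g x)"
    by (rule set_borel_integral_eq_integral(2)[OF set_integral_diff(1)[OF if_ ig]])
  also have "\<dots> = ?D B - ?D A"
  proof (rule integral_unique, rule fundamental_theorem_of_calculus[OF A(2)])
    fix x assume "x \<in> {A..B}"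
    then have x: "x > 0" using A by auto
    have "((\<lambda>x. (1 + x) powr (- \<mu>)) has_real_derivative - \<mu> * (1 + x) powr (- \<mu> - 1)) (at x)"
      using x by (auto intro!: derivative_eq_intros)
    from has_vector_derivative_of_real[OF this]
    have d: "((\<lambda>x. complex_of_real ((1 + x) powr (- \<mu>))) has_vector_derivative of_real (- \<mu> * (1 + x) powr (- \<mu> - 1))) (at x)" .
    have "(?D has_vector_derivative (of_real x powr p * of_real (- \<mu> * (1 + x) powr (- \<mu> - 1)) + p * of_real x powr (p - 1) * of_real ((1 + x) powr (- \<mu>)))) (at x)"
      by (intro has_vector_derivative_mult has_vector_derivative_powr_complex x d)
    also have "of_real x powr p * of_real (- \<mu> * (1 + x) powr (- \<mu> - 1)) + p * of_real x powr (p - 1) * of_real ((1 + x) powr (- \<mu>)) = ?f x - ?g x"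
      by simp
    finally show "(?D has_vector_derivative (?f x - ?g x)) (at x within {A..B})"
      by (rule has_vector_derivative_at_within)
  qed
  finally show ?thesis
    unfolding set_integral_diff(2)[OF if_ ig] set_integral_mult_right .
qed

lemma half_powr: "complex_of_real (1 / 2) powr p = of_real 2 powr (- p)"
proof -
  have "Ln (complex_of_real (1 / 2)) = - Ln (of_real 2)"
    by (simp only: Ln_of_real ln_div) (simp add: Ln_of_real[of 2, simplified] ln_div)
  then show ?thesis unfolding powr_def by simp
qed

text \<open>
  The boundary terms at \<open>x = 2\<close> of the middle part and of the substituted tail agree.
\<close>

lemma beta_boundary:
  "complex_of_real (1 / 2) powr (of_real \<mu> - p) * of_real ((1 + 1 / 2) powr (- \<mu>)) = of_real 2 powr p * of_real (3 powr (- \<mu>))"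
proof -
  have a: "complex_of_real (1 / 2) powr (of_real \<mu> - p) = of_real 2 powr (p - of_real \<mu>)"
    unfolding half_powr minus_diff_eq ..
  have "(3 / 2 :: real) powr (- \<mu>) = 3 powr (- \<mu>) * 2 powr \<mu>"
    by (simp add: powr_divide powr_minus divide_simps)
  then have b: "complex_of_real ((1 + 1 / 2) powr (- \<mu>)) = of_real (3 powr (- \<mu>)) * of_real 2 powr of_real \<mu>"
    using powr_of_real[of 2 \<mu>] by simp
  have "of_real 2 powr (p - of_real \<mu>) * of_real 2 powr of_real \<mu> = complex_of_real 2 powr p"
    by (simp only: powr_add[symmetric]) simp
  then show ?thesis unfolding a b by (simp add: mult_ac)
qed

text \<open>
  Integration by parts on all three pieces. The step enlarges \<open>Re p\<close> and keeps \<open>\<mu> - p\<close>.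
\<close>

lemma beta_mellin_raise_both:
  assumes p: "p \<notin> \<int>\<^sub>\<le>\<^sub>0" "of_real \<mu> - p \<notin> \<int>\<^sub>\<le>\<^sub>0" and A: "0 < A" "A < 1"
  shows "p * beta_mellin \<mu> p A = of_real \<mu> * beta_mellin (\<mu> + 1) (p + 1) A"
proof -
  have e: "of_real (\<mu> + 1) - (p + 1) = of_real \<mu> - p" "p + 1 - 1 = p" by simp_all
  have 3: "p * finite_part (neg_binomial \<mu>) (of_real \<mu> - p) (1/2) - of_real \<mu> * finite_part (neg_binomial (\<mu> + 1)) (of_real \<mu> - p) (1/2)
     = - (of_real 2 powr p * of_real (3 powr (- \<mu>)))"
    using finite_part_neg_binomial_same[OF p(2), of "1/2" \<mu>] unfolding beta_boundary by simp
  have 1: "p * (LINT x:{A..2}|lborel. of_real x powr (p - 1) * complex_of_real ((1 + x) powr (- \<mu>)))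
       - of_real \<mu> * (LINT x:{A..2}|lborel. of_real x powr p * complex_of_real ((1 + x) powr (- (\<mu> + 1))))
     = of_real 2 powr p * of_real (3 powr (- \<mu>)) - of_real A powr p * of_real ((1 + A) powr (- \<mu>))"
    using LINT_beta_parts[of A 2 p \<mu>] A by simp
  show ?thesis
    using 1 3 finite_part_neg_binomial_shift[OF p(1) A, of \<mu>] unfolding beta_mellin_def e by (simp only: ring_distribs) algebra
qed

text \<open>
  Integration by parts combined with \<open>(1 + x) powr -\<mu> = (1 + x) (1 + x) powr -(\<mu> + 1)\<close>. The step enlarges
  \<open>\<mu> - p\<close> and keeps \<open>p\<close>.
\<close>

lemma beta_mellin_raise_exponent:
  assumes p: "p \<notin> \<int>\<^sub>\<le>\<^sub>0" "of_real \<mu> - p \<notin> \<int>\<^sub>\<le>\<^sub>0" and A: "0 < A" "A < 1"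
  shows "(of_real \<mu> - p) * beta_mellin \<mu> p A = of_real \<mu> * beta_mellin (\<mu> + 1) p A"
proof -
  have e: "of_real (\<mu> + 1) - p = (of_real \<mu> - p) + 1" by simp
  have 3: "(of_real \<mu> - p) * finite_part (neg_binomial \<mu>) (of_real \<mu> - p) (1/2) - of_real \<mu> * finite_part (neg_binomial (\<mu> + 1)) (of_real \<mu> - p + 1) (1/2)
     = of_real 2 powr p * of_real (3 powr (- \<mu>))"
    using finite_part_neg_binomial_shift[OF p(2), of "1/2" \<mu>] unfolding beta_boundary by simp
  have 1: "p * (LINT x:{A..2}|lborel. of_real x powr (p - 1) * complex_of_real ((1 + x) powr (- \<mu>)))
       - of_real \<mu> * (LINT x:{A..2}|lborel. of_real x powr p * complex_of_real ((1 + x) powr (- (\<mu> + 1))))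
     = of_real 2 powr p * of_real (3 powr (- \<mu>)) - of_real A powr p * of_real ((1 + A) powr (- \<mu>))"
    using LINT_beta_parts[of A 2 p \<mu>] A by simp
  have 2: "(LINT x:{A..2}|lborel. of_real x powr (p - 1) * complex_of_real ((1 + x) powr (- \<mu>)))
     = (LINT x:{A..2}|lborel. of_real x powr (p - 1) * complex_of_real ((1 + x) powr (- (\<mu> + 1))))
       + (LINT x:{A..2}|lborel. of_real x powr p * complex_of_real ((1 + x) powr (- (\<mu> + 1))))"
  proof -
    have "(LINT x:{A..2}|lborel. of_real x powr (p - 1) * complex_of_real ((1 + x) powr (- \<mu>)))
     = (LINT x:{A..2}|lborel. of_real x powr (p - 1) * complex_of_real ((1 + x) powr (- (\<mu> + 1)))
       + of_real x powr p * complex_of_real ((1 + x) powr (- (\<mu> + 1))))"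
    proof (rule set_lebesgue_integral_cong)
      show "\<forall>x. x \<in> {A..2} \<longrightarrow> of_real x powr (p - 1) * complex_of_real ((1 + x) powr (- \<mu>))
        = of_real x powr (p - 1) * complex_of_real ((1 + x) powr (- (\<mu> + 1))) + of_real x powr p * complex_of_real ((1 + x) powr (- (\<mu> + 1)))"
      proof safe
        fix x assume "x \<in> {A..2}"
        then have x: "x > 0" using A by auto
        have pw: "of_real x powr p = of_real x powr (p - 1) * complex_of_real x"
          using x by (simp add: powr_diff)
        have "(1 + x) powr (- \<mu>) = (1 + x) powr (- (\<mu> + 1) + 1)" by simp
        also have "\<dots> = (1 + x) powr (- (\<mu> + 1)) * (1 + x)" using x by (subst powr_add) simp
        finally have q: "(1 + x) powr (- \<mu>) = (1 + x) powr (- (\<mu> + 1)) * (1 + x)" .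
        show "of_real x powr (p - 1) * complex_of_real ((1 + x) powr (- \<mu>))
        = of_real x powr (p - 1) * complex_of_real ((1 + x) powr (- (\<mu> + 1))) + of_real x powr p * complex_of_real ((1 + x) powr (- (\<mu> + 1)))"
          unfolding q pw of_real_mult of_real_add by (simp only: ring_distribs of_real_1 mult_1_left mult_1_right mult_ac)
      qed
    qed simp
    also have "\<dots> = (LINT x:{A..2}|lborel. of_real x powr (p - 1) * complex_of_real ((1 + x) powr (- (\<mu> + 1))))
       + (LINT x:{A..2}|lborel. of_real x powr p * complex_of_real ((1 + x) powr (- (\<mu> + 1))))"
      by (rule set_integral_add(2)[OF set_integrable_beta_Icc[OF A(1)] set_integrable_beta_Icc[OF A(1)]])
    finally show ?thesis .
  qed
  show ?thesis
    using 1 3 2 finite_part_neg_binomial_same[OF p(1) A, of \<mu>] unfolding beta_mellin_def e by (simp only: ring_distribs) algebra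
qed

text \<open>
  On \<open>x \<ge> 2\<close> the factor \<open>(1 + x) powr -\<mu>\<close> is expanded in powers of \<open>1/x\<close>. The weight \<open>W\<close> will be the constant
  1 or the Bessel--Clifford function.
\<close>

lemma LINT_tail_expansion:
  fixes W :: "real \<Rightarrow> complex"
  assumes W: "continuous_on {2..} W" and K: "\<And>x. x \<ge> 2 \<Longrightarrow> cmod (W x) \<le> K * x powr e" and e: "Re p - \<mu> + e < 0"
  shows "set_integrable lborel {2..} (\<lambda>x. of_real x powr (p - 1) * of_real ((1 + x) powr (- \<mu>)) * W x)"
    and "(\<lambda>l. neg_binomial \<mu> l * (LINT x:{2..}|lborel. of_real x powr (p - of_real \<mu> - of_nat l - 1) * W x)) sums
      (LINT x:{2..}|lborel. of_real x powr (p - 1) * of_real ((1 + x) powr (- \<mu>)) * W x)"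
proof -
  let ?f = "\<lambda>l x. neg_binomial \<mu> l * (of_real x powr (p - of_real \<mu> - of_nat l - 1) * W x)"
  let ?w = "\<lambda>x. K * x powr (Re p - \<mu> - 1 + e)"
  have w: "set_integrable lborel {2..} ?w"
    using e by (intro set_integrable_mult_right set_integrable_powr_Ici) auto
  have M: "summable (\<lambda>l. cmod (neg_binomial \<mu> l) * (1/2) ^ l)" "\<And>l. cmod (neg_binomial \<mu> l) * (1/2) ^ l \<ge> 0"
    using summable_neg_binomial[of "1/2" \<mu>] by auto
  have pw: "complex_of_real x powr (p - of_real \<mu> - of_nat l - 1) = of_real x powr (p - of_real \<mu> - 1) * of_real (1 / x) ^ l" if "x > 0" for x l
  proof -
    have "p - of_real \<mu> - 1 = (p - of_real \<mu> - of_nat l - 1) + of_nat l" by simp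
    then have "complex_of_real x powr (p - of_real \<mu> - 1) = of_real x powr (p - of_real \<mu> - of_nat l - 1) * of_real x ^ l"
      using of_real_powr_add_nat[OF that] by metis
    then show ?thesis using that by (simp add: power_divide)
  qed
  have le: "cmod (?f l x) \<le> cmod (neg_binomial \<mu> l) * (1/2) ^ l * ?w x" if "x \<in> {2..}" for l x
  proof -
    have x: "x > 0" "x \<ge> 2" using that by auto
    have "cmod (?f l x) = cmod (neg_binomial \<mu> l) * (x powr (Re p - \<mu> - 1) * (1 / x) ^ l * cmod (W x))"
      unfolding pw[OF x(1)] norm_mult norm_power norm_of_real norm_of_real_powr[OF x(1)] using x by simp
    also have "\<dots> \<le> cmod (neg_binomial \<mu> l) * (x powr (Re p - \<mu> - 1) * (1 / 2) ^ l * (K * x powr e))"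
      using x by (intro mult_left_mono mult_mono power_mono K) (auto simp: field_simps)
    also have "\<dots> = cmod (neg_binomial \<mu> l) * (1/2) ^ l * ?w x" by (simp only: powr_add mult_ac)
    finally show ?thesis .
  qed
  have F: "(\<lambda>l. ?f l x) sums (of_real x powr (p - 1) * of_real ((1 + x) powr (- \<mu>)) * W x)" if "x \<in> {2..}" for x
  proof -
    have x: "x > 0" "x \<ge> 2" using that by auto
    have "(\<lambda>l. (of_real x powr (p - of_real \<mu> - 1) * W x) * (neg_binomial \<mu> l * of_real (1 / x) ^ l)) sums
       ((of_real x powr (p - of_real \<mu> - 1) * W x) * of_real ((1 + 1 / x) powr (- \<mu>)))"
      using x by (intro sums_mult neg_binomial_sums) simp
    also have "(\<lambda>l. (of_real x powr (p - of_real \<mu> - 1) * W x) * (neg_binomial \<mu> l * of_real (1 / x) ^ l)) = (\<lambda>l. ?f l x)"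
      unfolding pw[OF x(1)] by (simp only: mult_ac)
    also have "(of_real x powr (p - of_real \<mu> - 1) * W x) * of_real ((1 + 1 / x) powr (- \<mu>))
       = of_real x powr (p - 1) * of_real ((1 + x) powr (- \<mu>)) * W x"
    proof -
      have q: "x * (1 + 1 / x) = 1 + x" using x by (simp add: distrib_left)
      have "(1 + x) powr (- \<mu>) = (x * (1 + 1 / x)) powr (- \<mu>)" unfolding q ..
      also have "\<dots> = x powr (- \<mu>) * (1 + 1 / x) powr (- \<mu>)" using x by (intro powr_mult)
      finally have 1: "complex_of_real ((1 + x) powr (- \<mu>)) = of_real x powr (- of_real \<mu>) * of_real ((1 + 1 / x) powr (- \<mu>))"
        using x powr_of_real[of x "- \<mu>"] by simp
      have "p - of_real \<mu> - 1 = (p - 1) + (- of_real \<mu>)" by simp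
      then have 2: "complex_of_real x powr (p - of_real \<mu> - 1) = of_real x powr (p - 1) * of_real x powr (- of_real \<mu>)"
        by (simp only: powr_add)
      show ?thesis unfolding 1 2 by (simp only: mult_ac)
    qed
    finally show ?thesis .
  qed
  have ct: "continuous_on {2..} (?f l)" for l
    by (intro continuous_intros continuous_on_of_real_powr W) auto
  have sb: "{2..} \<in> sets (borel :: real measure)" by simp
  note L = LINT_sums_dominated[OF sb ct w M le F]
  show "set_integrable lborel {2..} (\<lambda>x. of_real x powr (p - 1) * of_real ((1 + x) powr (- \<mu>)) * W x)" by (rule L(1))
  show "(\<lambda>l. neg_binomial \<mu> l * (LINT x:{2..}|lborel. of_real x powr (p - of_real \<mu> - of_nat l - 1) * W x)) sums
      (LINT x:{2..}|lborel. of_real x powr (p - 1) * of_real ((1 + x) powr (- \<mu>)) * W x)"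
    using L(2) unfolding set_integral_mult_right .
qed

text \<open>
  The classical case: \<open>(1 + x) powr -\<mu>\<close> is written as a Gamma integral and the order of integration is
  exchanged.
\<close>

lemma beta_mellin_base:
  assumes A: "0 < A" "A < 1" and \<mu>: "\<mu> > 0" and p: "Re p > 0" "Re p < \<mu>"
  shows "beta_mellin \<mu> p A = Gamma p * Gamma (of_real \<mu> - p) / Gamma (of_real \<mu>)"
proof -
  let ?g = "\<lambda>x. of_real x powr (p - 1) * complex_of_real ((1 + x) powr (- \<mu>))"
  have low1: "set_integrable lborel {0<..A} ?g" and low2: "(LINT x:{0<..A}|lborel. ?g x) = finite_part (neg_binomial \<mu>) p A"
    using finite_part_eq_LINT[of p A "neg_binomial \<mu>" "\<lambda>x. of_real ((1 + x) powr (- \<mu>))"] A p summable_neg_binomial[of A \<mu>] neg_binomial_sums[of _ \<mu>] by auto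
  have t: "set_integrable lborel {2..} (\<lambda>x. ?g x * 1)"
      "(\<lambda>l. neg_binomial \<mu> l * (LINT x:{2..}|lborel. of_real x powr (p - of_real \<mu> - of_nat l - 1) * 1)) sums (LINT x:{2..}|lborel. ?g x * 1)"
    by (rule LINT_tail_expansion[of "\<lambda>_. 1" 1 0]; use p in simp)+
  have ih: "set_integrable lborel {A..} ?g"
  proof -
    have "{A..} = {A..2} \<union> {2..}" using A by auto
    then show ?thesis using t(1) set_integrable_beta_Icc[OF A(1), of 2 "p - 1" \<mu>] by (simp add: set_integrable_Un)
  qed
  have un: "{0<..} = {0<..A} \<union> {A..}" using A by auto
  have i: "set_integrable lborel {0<..} ?g"
    unfolding un using low1 ih by (rule set_integrable_Un) auto
  have "(LINT x:{2..}|lborel. of_real x powr (p - of_real \<mu> - of_nat l - 1)) = of_real (1/2) powr (of_real \<mu> - p + of_nat l) / (of_real \<mu> - p + of_nat l)" for l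
  proof -
    have "(LINT x:{2..}|lborel. of_real x powr (p - of_real \<mu> - of_nat l - 1)) = - (of_real 2 powr (p - of_real \<mu> - of_nat l) / (p - of_real \<mu> - of_nat l))"
      using p by (intro LINT_powr_Ici(2)) auto
    also have "\<dots> = of_real 2 powr (p - of_real \<mu> - of_nat l) / (of_real \<mu> - p + of_nat l)"
      unfolding minus_divide_right by (simp add: algebra_simps)
    also have "of_real 2 powr (p - of_real \<mu> - of_nat l) = complex_of_real (1/2) powr (of_real \<mu> - p + of_nat l)"
      unfolding half_powr by (simp add: algebra_simps)
    finally show ?thesis .
  qed
  with t(2) have t2: "(LINT x:{2..}|lborel. ?g x) = finite_part (neg_binomial \<mu>) (of_real \<mu> - p) (1/2)"
    unfolding finite_part_def by (simp add: sums_iff)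
  define T where "T = (LINT x:{0<..}|lborel. ?g x)"
  have A2: "A \<le> 2" using A by simp
  have T: "T = beta_mellin \<mu> p A"
    unfolding T_def LINT_split_pos[OF i A(1)] LINT_split_Ici[OF ih A2] t2 low2 beta_mellin_def by simp
  define f where "f = (\<lambda>x t. (of_real t powr (of_real \<mu> - 1) * of_real (exp (- ((1 + x) * t)))) * complex_of_real x powr (p - 1))"
  have \<mu>': "Re (of_real \<mu>) > 0" using \<mu> by simp
  have fx: "(LINT t:{0<..}|lborel. f x t) = Gamma (of_real \<mu>) * ?g x"
    and fi: "set_integrable lborel {0<..} (f x)"
    and fn: "(LINT t:{0<..}|lborel. cmod (f x t)) = Gamma \<mu> * cmod (?g x)" if x: "x > 0" for x
  proof -
    have x1: "1 + x > 0" using x by simp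
    have "(LINT t:{0<..}|lborel. f x t) = Gamma (of_real \<mu>) * of_real (1 + x) powr (- of_real \<mu>) * of_real x powr (p - 1)"
      unfolding f_def set_integral_mult_left LINT_Gamma(2)[OF \<mu>' x1] ..
    also have "complex_of_real (1 + x) powr (- of_real \<mu>) = of_real ((1 + x) powr (- \<mu>))"
      using x powr_of_real[of "1 + x" "- \<mu>"] by simp
    finally show "(LINT t:{0<..}|lborel. f x t) = Gamma (of_real \<mu>) * ?g x" by (simp only: mult_ac)
    show "set_integrable lborel {0<..} (f x)"
      unfolding f_def using LINT_Gamma(1)[OF \<mu>' x1] by (intro set_integrable_mult_left)
    have "(LINT t:{0<..}|lborel. cmod (f x t)) = (LINT t:{0<..}|lborel. (t powr (\<mu> - 1) * exp (- ((1 + x) * t))) * x powr (Re p - 1))"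
      unfolding f_def using x by (intro set_lebesgue_integral_cong) (auto simp: norm_mult norm_of_real_powr)
    also have "\<dots> = Gamma \<mu> * (1 + x) powr (- \<mu>) * x powr (Re p - 1)"
      unfolding set_integral_mult_left LINT_Gamma_real(2)[OF \<mu> x1] ..
    finally show "(LINT t:{0<..}|lborel. cmod (f x t)) = Gamma \<mu> * cmod (?g x)"
      using x by (simp add: norm_mult norm_of_real_powr)
  qed
  have ft: "(LINT x:{0<..}|lborel. f x t) = Gamma p * (of_real t powr (of_real \<mu> - p - 1) * of_real (exp (- (1 * t))))" if t: "t > 0" for t
  proof -
    have "(LINT x:{0<..}|lborel. f x t) = (LINT x:{0<..}|lborel. (of_real t powr (of_real \<mu> - 1) * of_real (exp (- (1 * t)))) * (of_real x powr (p - 1) * of_real (exp (- (t * x)))))"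
      unfolding f_def by (intro set_lebesgue_integral_cong) (auto simp: mult_ac ring_distribs exp_add exp_diff exp_minus divide_inverse)
    also have "\<dots> = (of_real t powr (of_real \<mu> - 1) * of_real (exp (- (1 * t)))) * (Gamma p * of_real t powr (- p))"
      unfolding set_integral_mult_right LINT_Gamma(2)[OF p(1) t] ..
    also have "\<dots> = Gamma p * ((of_real t powr (of_real \<mu> - 1) * of_real t powr (- p)) * of_real (exp (- (1 * t))))"
      by (simp only: mult_ac)
    also have "of_real t powr (of_real \<mu> - 1) * of_real t powr (- p) = complex_of_real t powr (of_real \<mu> - p - 1)"
      by (simp add: powr_add[symmetric] algebra_simps)
    finally show ?thesis .
  qed
  have "(LINT x:{0<..}|lborel. LINT t:{0<..}|lborel. f x t) = (LINT t:{0<..}|lborel. LINT x:{0<..}|lborel. f x t)"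
  proof (rule LINT_fubini_pos)
    show "continuous_on ({0<..} \<times> {0<..}) (\<lambda>z. f (fst z) (snd z))"
      unfolding f_def by (intro continuous_intros) (auto simp: less_imp_le)
    show "set_integrable lborel {0<..} (f x)" if "x > 0" for x by (rule fi[OF that])
    have "set_integrable lborel {0<..} (\<lambda>x. Gamma \<mu> * cmod (?g x))"
      using set_integrable_norm[OF i] by (intro set_integrable_mult_right)
    then show "set_integrable lborel {0<..} (\<lambda>x. LINT t:{0<..}|lborel. cmod (f x t))"
      by (subst set_integrable_cong[OF refl refl fn]) auto
  qed
  also have "(LINT x:{0<..}|lborel. LINT t:{0<..}|lborel. f x t) = (LINT x:{0<..}|lborel. Gamma (of_real \<mu>) * ?g x)"
    by (intro set_lebesgue_integral_cong) (auto simp: fx)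
  also have "\<dots> = Gamma (of_real \<mu>) * T" by (simp add: T_def)
  also have "(LINT t:{0<..}|lborel. LINT x:{0<..}|lborel. f x t) = (LINT t:{0<..}|lborel. Gamma p * (of_real t powr (of_real \<mu> - p - 1) * of_real (exp (- (1 * t)))))"
    by (intro set_lebesgue_integral_cong) (auto simp: ft)
  also have "\<dots> = Gamma p * Gamma (of_real \<mu> - p)"
    using LINT_Gamma(2)[of "of_real \<mu> - p" 1] p by simp
  finally have "Gamma (of_real \<mu>) * T = Gamma p * Gamma (of_real \<mu> - p)" .
  moreover have "Gamma (complex_of_real \<mu>) \<noteq> 0"
    using Gamma_real_pos[OF \<mu>] by (simp add: Gamma_complex_of_real)
  ultimately have "T = Gamma p * Gamma (of_real \<mu> - p) / Gamma (of_real \<mu>)" by (simp add: field_simps)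
  then show ?thesis unfolding T .
qed

lemma Gamma_of_real_plus1: "\<mu> > 0 \<Longrightarrow> Gamma (complex_of_real (\<mu> + 1)) = of_real \<mu> * Gamma (of_real \<mu>)"
proof -
  assume "\<mu> > 0"
  then have "complex_of_real \<mu> \<notin> \<int>\<^sub>\<le>\<^sub>0"
    unfolding of_real_in_nonpos_Ints_iff using nonpos_Ints_nonpos by fastforce
  then show ?thesis using Gamma_plus1[of "complex_of_real \<mu>"] by simp
qed

lemma beta_mellin_pos:
  assumes A: "0 < A" "A < 1" and \<mu>: "\<mu> > 0" and p: "Re p > 0" "of_real \<mu> - p \<notin> \<int>\<^sub>\<le>\<^sub>0"
  shows "beta_mellin \<mu> p A = Gamma p * Gamma (of_real \<mu> - p) / Gamma (of_real \<mu>)"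
proof -
  obtain n :: nat where "Re p - \<mu> < real n" using reals_Archimedean2[of "Re p - \<mu>"] by blast
  then show ?thesis using \<mu> p(2)
  proof (induction n arbitrary: \<mu>)
    case 0
    then show ?case using beta_mellin_base[OF A _ p(1)] by simp
  next
    case (Suc n)
    have pn: "p \<notin> \<int>\<^sub>\<le>\<^sub>0" using p(1) by (auto elim!: nonpos_Ints_cases)
    have e: "of_real (\<mu> + 1) - p = (of_real \<mu> - p) + 1" by simp
    have nz: "of_real \<mu> - p \<noteq> 0" using Suc.prems(3) by auto
    have "beta_mellin (\<mu> + 1) p A = Gamma p * Gamma (of_real (\<mu> + 1) - p) / Gamma (of_real (\<mu> + 1))"
    proof (rule Suc.IH)
      show "of_real (\<mu> + 1) - p \<notin> \<int>\<^sub>\<le>\<^sub>0"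
        unfolding e using Suc.prems(3) plus_one_in_nonpos_Ints_imp by blast
    qed (use Suc.prems in auto)
    also have "\<dots> = Gamma p * ((of_real \<mu> - p) * Gamma (of_real \<mu> - p)) / (of_real \<mu> * Gamma (of_real \<mu>))"
      unfolding e Gamma_plus1[OF Suc.prems(3)] Gamma_of_real_plus1[OF Suc.prems(2)] ..
    finally have "(of_real \<mu> - p) * beta_mellin \<mu> p A = of_real \<mu> * (Gamma p * ((of_real \<mu> - p) * Gamma (of_real \<mu> - p)) / (of_real \<mu> * Gamma (of_real \<mu>)))"
      unfolding beta_mellin_raise_exponent[OF pn Suc.prems(3) A] by simp
    also have "\<dots> = (of_real \<mu> - p) * (Gamma p * Gamma (of_real \<mu> - p) / Gamma (of_real \<mu>))"
      using Suc.prems(2) by simp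
    finally show ?case using nz by (simp only: mult_cancel_left) simp
  qed
qed

text \<open>
  The two recurrences reduce the general case first to \<open>Re p > 0\<close> and then to \<open>Re p < \<mu>\<close>.
\<close>

lemma beta_mellin_eq:
  assumes A: "0 < A" "A < 1" and \<mu>: "\<mu> > 0" and p: "p \<notin> \<int>\<^sub>\<le>\<^sub>0" "of_real \<mu> - p \<notin> \<int>\<^sub>\<le>\<^sub>0"
  shows "beta_mellin \<mu> p A = Gamma p * Gamma (of_real \<mu> - p) / Gamma (of_real \<mu>)"
proof -
  obtain n :: nat where "- Re p < real n" using reals_Archimedean2[of "- Re p"] by blast
  then show ?thesis using \<mu> p
  proof (induction n arbitrary: \<mu> p)
    case 0
    then show ?case using beta_mellin_pos[OF A] by simp
  next
    case (Suc n)
    have e: "of_real (\<mu> + 1) - (p + 1) = of_real \<mu> - p" by simp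
    have nz: "p \<noteq> 0" using Suc.prems(3) by auto
    have G0: "Gamma (complex_of_real \<mu>) \<noteq> 0"
      using Gamma_real_pos[OF Suc.prems(2)] by (simp add: Gamma_complex_of_real)
    have "beta_mellin (\<mu> + 1) (p + 1) A = Gamma (p + 1) * Gamma (of_real (\<mu> + 1) - (p + 1)) / Gamma (of_real (\<mu> + 1))"
    proof (rule Suc.IH)
      show "p + 1 \<notin> \<int>\<^sub>\<le>\<^sub>0"
        using Suc.prems(3) plus_one_in_nonpos_Ints_imp by blast
      show "of_real (\<mu> + 1) - (p + 1) \<notin> \<int>\<^sub>\<le>\<^sub>0" unfolding e by (rule Suc.prems(4))
    qed (use Suc.prems in auto)
    also have "\<dots> = p * Gamma p * Gamma (of_real \<mu> - p) / (of_real \<mu> * Gamma (of_real \<mu>))"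
      unfolding e Gamma_plus1[OF Suc.prems(3)] Gamma_of_real_plus1[OF Suc.prems(2)] ..
    finally have "p * beta_mellin \<mu> p A = of_real \<mu> * (p * Gamma p * Gamma (of_real \<mu> - p) / (of_real \<mu> * Gamma (of_real \<mu>)))"
      unfolding beta_mellin_raise_both[OF Suc.prems(3,4) A] by simp
    then show ?case using nz G0 Suc.prems(2) by (simp add: field_simps)
  qed
qed

section \<open>The finite-part Mellin transform of the summand\<close>

lemma infsum_nat_eq_suminf:
  fixes f :: "nat \<Rightarrow> 'a::banach"
  assumes "summable (\<lambda>n. norm (f n))"
  shows "infsum f UNIV = suminf f"
  using norm_summable_imp_has_sum[OF assms summable_sums[OF summable_norm_cancel[OF assms]]] infsumI by blast

text \<open>
  Summation by rows, by columns and along diagonals. The first two orders are needed to let the added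
  tails cancel, the last to recognize a Cauchy product.
\<close>

lemma double_sums_dominated:
  fixes a :: "nat \<Rightarrow> nat \<Rightarrow> complex"
  assumes a: "\<And>m l. cmod (a m l) \<le> u m * v l" and u: "summable u" "\<And>m. u m \<ge> 0" and v: "summable v" "\<And>l. v l \<ge> 0"
  obtains S where "(\<lambda>m. \<Sum>l. a m l) sums S" "(\<lambda>l. \<Sum>m. a m l) sums S" "(\<lambda>k. \<Sum>j\<le>k. a j (k - j)) sums S"
proof -
  have uo: "u summable_on UNIV" "v summable_on UNIV"
    using u v by (auto simp: summable_on_UNIV_nonneg_real_iff)
  have "(\<lambda>z. norm (case z of (m, l) \<Rightarrow> u m * v l)) summable_on Sigma UNIV (\<lambda>_. UNIV)"
    unfolding Infinite_Sum.abs_summable_on_Sigma_iff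
  proof (intro conjI ballI)
    fix m
    show "(\<lambda>l. norm (case (m, l) of (m, l) \<Rightarrow> u m * v l)) summable_on UNIV"
      using summable_on_cmult_right[OF uo(2), of "u m"] u v by (simp add: abs_mult)
  next
    have "(\<Sum>\<^sub>\<infinity>l\<in>UNIV. norm (case (m, l) of (m, l) \<Rightarrow> u m * v l)) = u m * infsum v UNIV" for m
      using u v by (simp add: abs_mult infsum_cmult_right')
    moreover have "infsum v UNIV \<ge> 0" using v by (intro infsum_nonneg) auto
    ultimately show "(\<lambda>m. norm (\<Sum>\<^sub>\<infinity>l\<in>UNIV. norm (case (m, l) of (m, l) \<Rightarrow> u m * v l))) summable_on UNIV"
      using summable_on_cmult_left[OF uo(1), of "infsum v UNIV"] u by (simp add: abs_mult)
  qed
  then have abs: "(\<lambda>z. norm (case z of (m, l) \<Rightarrow> a m l)) summable_on Sigma UNIV (\<lambda>_. UNIV)"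
    by (rule Infinite_Sum.abs_summable_on_comparison_test) (use a u v in \<open>auto simp: abs_mult intro: order.trans\<close>)
  have sm: "(\<lambda>(m, l). a m l) summable_on Sigma UNIV (\<lambda>_. UNIV)"
    by (rule abs_summable_summable[OF abs])
  define S where "S = infsum (\<lambda>(m, l). a m l) (Sigma UNIV (\<lambda>_. UNIV))"
  have row: "summable (\<lambda>l. norm (a m l))" for m
    by (rule summable_comparison_test'[OF summable_mult[OF v(1), of "u m"], of 0]) (use a in simp)
  have col: "summable (\<lambda>m. norm (a m l))" for l
    by (rule summable_comparison_test'[OF summable_mult2[OF u(1), of "v l"], of 0]) (use a in simp)
  have "((\<lambda>m. infsum (a m) UNIV) has_sum S) UNIV"
    unfolding S_def infsum_Sigma'_banach[OF sm, symmetric]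
    using summable_on_Sigma_banach[OF sm] by (simp only: summable_iff_has_sum_infsum)
  then have 1: "(\<lambda>m. \<Sum>l. a m l) sums S"
    unfolding infsum_nat_eq_suminf[OF row] by (rule has_sum_imp_sums)
  have hS: "((\<lambda>(m, l). a m l) has_sum S) (Sigma UNIV (\<lambda>_. UNIV))"
    unfolding S_def using sm by (simp only: summable_iff_has_sum_infsum)
  have sw: "((\<lambda>(l, m). a m l) has_sum S) (Sigma UNIV (\<lambda>_. UNIV))"
    using hS by (subst has_sum_reindex_bij_witness[where i = prod.swap and j = prod.swap and h = "\<lambda>(m, l). a m l" and T = "Sigma UNIV (\<lambda>_. UNIV)" and s' = S]) auto
  then have sw': "(\<lambda>(l, m). a m l) summable_on Sigma UNIV (\<lambda>_. UNIV)" "infsum (\<lambda>(l, m). a m l) (Sigma UNIV (\<lambda>_. UNIV)) = S"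
    by (auto simp: summable_on_def infsumI)
  have "((\<lambda>l. infsum (\<lambda>m. a m l) UNIV) has_sum S) UNIV"
    unfolding sw'(2)[symmetric] infsum_Sigma'_banach[OF sw'(1), symmetric]
    using summable_on_Sigma_banach[OF sw'(1)] by (simp only: summable_iff_has_sum_infsum)
  then have 2: "(\<lambda>l. \<Sum>m. a m l) sums S"
    unfolding infsum_nat_eq_suminf[OF col] by (rule has_sum_imp_sums)
  have dg: "((\<lambda>(k, j). a j (k - j)) has_sum S) (Sigma UNIV (\<lambda>k. {..k}))"
    using hS by (subst has_sum_reindex_bij_witness[where i = "\<lambda>(m, l). (m + l, m)" and j = "\<lambda>(k, j). (j, k - j)" and h = "\<lambda>(m, l). a m l" and T = "Sigma UNIV (\<lambda>_. UNIV)" and s' = S]) auto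
  then have dg': "(\<lambda>(k, j). a j (k - j)) summable_on Sigma UNIV (\<lambda>k. {..k})" "infsum (\<lambda>(k, j). a j (k - j)) (Sigma UNIV (\<lambda>k. {..k})) = S"
    by (auto simp: summable_on_def infsumI)
  have "((\<lambda>k. infsum (\<lambda>j. a j (k - j)) {..k}) has_sum S) UNIV"
    unfolding dg'(2)[symmetric] infsum_Sigma'_banach[OF dg'(1), symmetric]
    using summable_on_Sigma_banach[OF dg'(1)] by (simp only: summable_iff_has_sum_infsum)
  then have 3: "(\<lambda>k. \<Sum>j\<le>k. a j (k - j)) sums S"
    by (simp add: has_sum_imp_sums)
  show ?thesis by (rule that[OF 1 2 3])
qed

text \<open>
  The Taylor coefficients of \<open>E\<^sub>\<nu>(\<xi> x) (1 + x) powr -\<mu>\<close> at the origin.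
\<close>

definition profile_coeff :: "real \<Rightarrow> real \<Rightarrow> real \<Rightarrow> nat \<Rightarrow> complex" where
  "profile_coeff \<mu> \<nu> \<xi> k = (\<Sum>j\<le>k. scaled_bcoef \<nu> \<xi> j * neg_binomial \<mu> (k - j))"

lemma summable_profile_coeff:
  assumes x: "0 \<le> x" "x < 1" and \<xi>: "\<xi> \<ge> 0"
  shows "summable (\<lambda>k. cmod (profile_coeff \<mu> \<nu> \<xi> k) * x ^ k)"
proof -
  have s1: "summable (\<lambda>m. norm (cmod (scaled_bcoef \<nu> \<xi> m) * x ^ m))" using summable_scaled_bcoef[OF \<xi> x(1)] x by simp
  have s2: "summable (\<lambda>m. norm (cmod (neg_binomial \<mu> m) * x ^ m))" using summable_neg_binomial[OF x] x by simp
  have "summable (\<lambda>k. \<Sum>j\<le>k. cmod (scaled_bcoef \<nu> \<xi> j) * x ^ j * (cmod (neg_binomial \<mu> (k - j)) * x ^ (k - j)))"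
    by (rule summable_Cauchy_product[OF s1 s2])
  then show ?thesis
  proof (rule summable_comparison_test'[of _ 0])
    fix k
    have "cmod (profile_coeff \<mu> \<nu> \<xi> k) * x ^ k \<le> (\<Sum>j\<le>k. cmod (scaled_bcoef \<nu> \<xi> j) * cmod (neg_binomial \<mu> (k - j))) * x ^ k"
      unfolding profile_coeff_def using x by (intro mult_right_mono order.trans[OF norm_sum]) (auto simp: norm_mult)
    also have "\<dots> = (\<Sum>j\<le>k. cmod (scaled_bcoef \<nu> \<xi> j) * x ^ j * (cmod (neg_binomial \<mu> (k - j)) * x ^ (k - j)))"
      unfolding sum_distrib_right
    proof (intro sum.cong refl)
      fix j assume "j \<in> {..k}"
      then have "x ^ k = x ^ j * x ^ (k - j)" by (simp flip: power_add)
      then show "cmod (scaled_bcoef \<nu> \<xi> j) * cmod (neg_binomial \<mu> (k - j)) * x ^ k = cmod (scaled_bcoef \<nu> \<xi> j) * x ^ j * (cmod (neg_binomial \<mu> (k - j)) * x ^ (k - j))"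
        by (simp only: mult_ac)
    qed
    finally show "norm (cmod (profile_coeff \<mu> \<nu> \<xi> k) * x ^ k) \<le> (\<Sum>j\<le>k. cmod (scaled_bcoef \<nu> \<xi> j) * x ^ j * (cmod (neg_binomial \<mu> (k - j)) * x ^ (k - j)))"
      using x by simp
  qed
qed

text \<open>
  The finite part of \<open>\<integral> x powr (q - 1) (1 + x) powr -\<mu> E\<^sub>\<nu>(\<xi> x) dx\<close> over the positive half-line; \<open>A < 1\<close> keeps the
  interval of the finite part inside the disc of convergence.
\<close>

definition mellin_fp :: "real \<Rightarrow> real \<Rightarrow> real \<Rightarrow> complex \<Rightarrow> real \<Rightarrow> complex" where
  "mellin_fp \<mu> \<nu> \<xi> q A =
     (LINT x:{A..}|lborel. of_real x powr (q - 1) * of_real ((1 + x) powr (- \<mu>)) * of_real (bessel_clifford \<nu> (\<xi> * x)))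
     + finite_part (profile_coeff \<mu> \<nu> \<xi>) q A"

lemma Ints_dist:
  fixes p :: complex
  assumes "p \<notin> \<int>"
  obtains \<delta> where "\<delta> > 0" "\<And>n::int. cmod (p + of_int n) \<ge> \<delta>"
proof -
  have "open (- (\<int> :: complex set))" by (rule open_Compl[OF closed_Ints])
  moreover have "p \<in> - \<int>" using assms by simp
  ultimately obtain \<delta> where \<delta>: "\<delta> > 0" "ball p \<delta> \<subseteq> - \<int>" by (rule openE)
  have "cmod (p + of_int n) \<ge> \<delta>" for n :: int
  proof (rule ccontr)
    assume "\<not> cmod (p + of_int n) \<ge> \<delta>"
    then have "of_int (- n) \<in> ball p \<delta>" by (simp add: dist_norm)
    then have "of_int (- n) \<in> - (\<int> :: complex set)" using \<delta>(2) by blast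
    then show False using Ints_of_int by blast
  qed
  with \<delta>(1) show ?thesis using that by blast
qed

text \<open>
  Up to 2 the Bessel factor is expanded in powers of \<open>x\<close>, and beyond 2 the other factor is expanded in
  powers of \<open>1/x\<close>. To the \<open>m\<close>-th term of the first series the finite part of
  \<open>x powr (q + m - 1) (1 + x) powr -\<mu>\<close> on the tail is added, so that it becomes a Beta integral. To the
  \<open>l\<close>-th term of the second series the finite part of \<open>x powr (q - \<mu> - l - 1) E\<^sub>\<nu>(\<xi> x)\<close> on the interval from 0
  to 2 is added, so that it becomes a Mellin transform of \<open>E\<^sub>\<nu>\<close>. Both additions have the same expansion in
  \<open>m\<close> and \<open>l\<close> except for the sign, because the finite parts of a pure power over the two pieces of the
  half-line add up to 0.
\<close>

lemma mellin_fp_split: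
  assumes A: "0 < A" "A < 1" and \<xi>: "\<xi> > 0" and \<mu>: "\<mu> > 0"
    and q: "q \<notin> \<int>\<^sub>\<le>\<^sub>0" "of_real \<mu> - q \<notin> \<int>" "Re q < \<mu> + \<nu> / 2 + 1 / 4"
  obtains X Y where
    "(\<lambda>m. scaled_bcoef \<nu> \<xi> m * (Gamma (q + of_nat m) * Gamma (of_real \<mu> - (q + of_nat m)) / Gamma (of_real \<mu>))) sums X"
    "(\<lambda>l. neg_binomial \<mu> l * (of_real \<xi> powr (- (q - of_real \<mu> - of_nat l)) * Gamma (q - of_real \<mu> - of_nat l)
        * rGamma (of_real \<nu> + 1 - (q - of_real \<mu> - of_nat l)))) sums Y"
    "mellin_fp \<mu> \<nu> \<xi> q A = X + Y"
proof -
  let ?W = "\<lambda>x. complex_of_real (bessel_clifford \<nu> (\<xi> * x))"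
  let ?G = "\<lambda>x. of_real x powr (q - 1) * of_real ((1 + x) powr (- \<mu>)) * ?W x"
  let ?sb = "scaled_bcoef \<nu> \<xi>"
  have qm: "q + of_nat m \<notin> \<int>\<^sub>\<le>\<^sub>0" for m
    using q(1) nonpos_Ints_diff_Nats[of "q + of_nat m" "of_nat m"] by auto
  have int_p: "q - of_real \<mu> + of_int n \<notin> \<int>" for n :: int
  proof
    assume "q - of_real \<mu> + of_int n \<in> \<int>"
    from Ints_add[OF Ints_minus[OF this] Ints_of_int[of n]]
    have "- (q - of_real \<mu> + of_int n) + of_int n \<in> \<int>" .
    moreover have "- (q - of_real \<mu> + of_int n) + of_int n = of_real \<mu> - q" by simp
    ultimately show False using q(2) by (simp only:)
  qed
  have \<mu>qm: "of_real \<mu> - (q + of_nat m) \<notin> \<int>\<^sub>\<le>\<^sub>0" for m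
  proof
    assume "of_real \<mu> - (q + of_nat m) \<in> \<int>\<^sub>\<le>\<^sub>0"
    then have "- (of_real \<mu> - (q + of_nat m)) \<in> \<int>" by (intro Ints_minus nonpos_Ints_Int)
    moreover have "- (of_real \<mu> - (q + of_nat m)) = q - of_real \<mu> + of_int (int m)" by simp
    ultimately show False using int_p[of "int m"] by (simp only:)
  qed
  have pl: "q - of_real \<mu> - of_nat l \<notin> \<int>\<^sub>\<le>\<^sub>0" for l
    using int_p[of "- int l"] nonpos_Ints_Int[of "q - of_real \<mu> - of_nat l"] by auto
  obtain K where K: "K \<ge> 0" "\<And>x. x \<ge> 2 \<Longrightarrow> \<bar>bessel_clifford \<nu> (\<xi> * x)\<bar> \<le> K * x powr (- \<nu> / 2 - 1 / 4)"
    using bessel_clifford_scaled_bound[of 2 \<xi> \<nu>] \<xi> by auto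
  have cW: "continuous_on S ?W" for S by (intro continuous_intros)
  have K': "cmod (?W x) \<le> K * x powr (- \<nu> / 2 - 1 / 4)" if "x \<ge> 2" for x using K(2)[OF that] by simp
  have eW: "Re q - \<mu> + (- \<nu> / 2 - 1 / 4) < 0" using q(3) by simp
  note tail = LINT_tail_expansion[OF cW K' eW]
  have A2: "A \<le> 2" using A by simp
  have iA2: "set_integrable lborel {A..2} ?G"
    using A by (intro borel_integrable_atLeastAtMost' continuous_intros continuous_on_of_real_powr) auto
  have iA: "set_integrable lborel {A..} ?G"
  proof -
    have "{A..} = {A..2} \<union> {2..}" using A by auto
    then show ?thesis using tail(1) iA2 by (simp add: set_integrable_Un)
  qed
  define I where "I = (\<lambda>l. LINT x:{2..}|lborel. of_real x powr (q - of_real \<mu> - of_nat l - 1) * ?W x)"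
  define L where "L = (\<lambda>l. finite_part ?sb (q - of_real \<mu> - of_nat l) 2)"
  define C where "C = (\<lambda>l. of_real \<xi> powr (- (q - of_real \<mu> - of_nat l)) * Gamma (q - of_real \<mu> - of_nat l)
        * rGamma (of_real \<nu> + 1 - (q - of_real \<mu> - of_nat l)))"
  have IL: "I l + L l = C l" for l
    using bessel_mellin_eq[OF _ \<xi> pl, of 2 l \<nu>] q(3) by (simp add: bessel_mellin_def I_def L_def C_def)
  have T2: "(\<lambda>l. neg_binomial \<mu> l * I l) sums (LINT x:{2..}|lborel. ?G x)"
    unfolding I_def by (rule tail(2))
  define J where "J = (\<lambda>m. LINT x:{A..2}|lborel. of_real x powr (q + of_nat m - 1) * complex_of_real ((1 + x) powr (- \<mu>)))"
  have T1: "(\<lambda>m. ?sb m * J m) sums (LINT x:{A..2}|lborel. ?G x)"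
  proof -
    let ?f = "\<lambda>m x. ?sb m * (of_real x powr (q + of_nat m - 1) * complex_of_real ((1 + x) powr (- \<mu>)))"
    let ?w = "\<lambda>x. x powr (Re q - 1) * (1 + x) powr (- \<mu>)"
    have w: "set_integrable lborel {A..2} ?w"
      using A by (intro borel_integrable_atLeastAtMost' continuous_intros) auto
    have pw: "complex_of_real x powr (q + of_nat m - 1) = of_real x powr (q - 1) * of_real x ^ m" if "x > 0" for x m
    proof -
      have "q + of_nat m - 1 = (q - 1) + of_nat m" by simp
      then show ?thesis using of_real_powr_add_nat[OF that] by metis
    qed
    have M: "summable (\<lambda>m. cmod (?sb m) * 2 ^ m)" "\<And>m. cmod (?sb m) * 2 ^ m \<ge> 0"
      using summable_scaled_bcoef[of \<xi> 2 \<nu>] \<xi> by auto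
    have le: "cmod (?f m x) \<le> cmod (?sb m) * 2 ^ m * ?w x" if "x \<in> {A..2}" for m x
    proof -
      have x: "x > 0" "x \<le> 2" using that A by auto
      have "cmod (?f m x) = cmod (?sb m) * x ^ m * ?w x"
        unfolding pw[OF x(1)] norm_mult norm_power norm_of_real norm_of_real_powr[OF x(1)] using x by simp
      also have "\<dots> \<le> cmod (?sb m) * 2 ^ m * ?w x"
        using x by (intro mult_right_mono mult_left_mono power_mono) auto
      finally show ?thesis .
    qed
    have F: "(\<lambda>m. ?f m x) sums ?G x" if "x \<in> {A..2}" for x
    proof -
      have x: "x > 0" using that A by auto
      have "(\<lambda>m. (of_real x powr (q - 1) * complex_of_real ((1 + x) powr (- \<mu>))) * (?sb m * of_real x ^ m)) sums ?G x"
        by (intro sums_mult scaled_bcoef_sums)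
      then show ?thesis unfolding pw[OF x] by (simp only: mult_ac)
    qed
    have ct: "continuous_on {A..2} (?f m)" for m
      using A by (intro continuous_intros continuous_on_of_real_powr) auto
    have sb: "{A..2} \<in> sets borel" by simp
    show ?thesis using LINT_sums_dominated(2)[OF sb ct w M le F] unfolding set_integral_mult_right J_def .
  qed
  \<comment> \<open>The double series of the finite part at the origin: along diagonals it is the one of the full
    integrand, by rows those of the Beta integrals.\<close>
  obtain \<delta> where \<delta>: "\<delta> > 0" "\<And>m::nat. cmod (q + of_nat m) \<ge> \<delta>" using nonpos_Ints_dist[OF q(1)] by blast
  define a1 where "a1 = (\<lambda>m l. ?sb m * (neg_binomial \<mu> l * of_real A powr (q + of_nat m + of_nat l) / (q + of_nat m + of_nat l)))"
  obtain S1 where S1: "(\<lambda>m. \<Sum>l. a1 m l) sums S1" "(\<lambda>k. \<Sum>j\<le>k. a1 j (k - j)) sums S1"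
  proof (rule double_sums_dominated)
    show "summable (\<lambda>m. A powr Re q / \<delta> * (cmod (?sb m) * A ^ m))" "summable (\<lambda>l. cmod (neg_binomial \<mu> l) * A ^ l)"
      using A \<xi> by (auto intro!: summable_mult summable_scaled_bcoef summable_neg_binomial)
    show "A powr Re q / \<delta> * (cmod (?sb m) * A ^ m) \<ge> 0" "cmod (neg_binomial \<mu> m) * A ^ m \<ge> 0" for m using A \<delta> by auto
    show "cmod (a1 m l) \<le> A powr Re q / \<delta> * (cmod (?sb m) * A ^ m) * (cmod (neg_binomial \<mu> l) * A ^ l)" for m l
    proof -
      have e: "q + of_nat m + of_nat l = q + of_nat (m + l)" by simp
      have "cmod (a1 m l) = cmod (?sb m * neg_binomial \<mu> l * of_real A powr (q + of_nat (m + l)) / (q + of_nat (m + l)))"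
        unfolding a1_def e by (simp add: mult.assoc)
      also have "\<dots> \<le> A powr Re q / \<delta> * (cmod (?sb m * neg_binomial \<mu> l) * A ^ (m + l))"
        by (rule finite_part_term_bound[OF A(1) \<delta>])
      also have "\<dots> = A powr Re q / \<delta> * (cmod (?sb m) * A ^ m) * (cmod (neg_binomial \<mu> l) * A ^ l)"
        by (simp only: norm_mult power_add mult_ac)
      finally show ?thesis .
    qed
  qed
  have a1l: "(\<Sum>l. a1 m l) = ?sb m * finite_part (neg_binomial \<mu>) (q + of_nat m) A" for m
    using sums_mult[OF finite_part_sums[OF qm A(1) summable_neg_binomial[of A \<mu>]], of "?sb m" m] A unfolding a1_def by (simp add: sums_iff)
  have S1low: "finite_part (profile_coeff \<mu> \<nu> \<xi>) q A = S1"
  proof -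
    have "(\<Sum>j\<le>k. a1 j (k - j)) = profile_coeff \<mu> \<nu> \<xi> k * of_real A powr (q + of_nat k) / (q + of_nat k)" for k
    proof -
      have "(\<Sum>j\<le>k. a1 j (k - j)) = (\<Sum>j\<le>k. ?sb j * neg_binomial \<mu> (k - j) * (of_real A powr (q + of_nat k) / (q + of_nat k)))"
      proof (intro sum.cong refl)
        fix j assume "j \<in> {..k}"
        then have e: "q + of_nat j + of_nat (k - j) = q + of_nat k" by (simp add: of_nat_diff)
        show "a1 j (k - j) = ?sb j * neg_binomial \<mu> (k - j) * (of_real A powr (q + of_nat k) / (q + of_nat k))"
          unfolding a1_def e by simp
      qed
      then show ?thesis unfolding profile_coeff_def sum_distrib_right[symmetric] by simp
    qed
    with S1(2) show ?thesis unfolding finite_part_def by (simp add: sums_iff)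
  qed
  \<comment> \<open>The double series of the added pieces, by rows for the Beta integrals and by columns for the Mellin
    transforms.\<close>
  obtain \<delta>' where \<delta>': "\<delta>' > 0" "\<And>n::int. cmod (of_real \<mu> - q + of_int n) \<ge> \<delta>'" using Ints_dist[OF q(2)] by blast
  define a2 where "a2 = (\<lambda>m l. ?sb m * (neg_binomial \<mu> l * of_real (1/2) powr (of_real \<mu> - (q + of_nat m) + of_nat l) / (of_real \<mu> - (q + of_nat m) + of_nat l)))"
  obtain S2 where S2: "(\<lambda>m. \<Sum>l. a2 m l) sums S2" "(\<lambda>l. \<Sum>m. a2 m l) sums S2"
  proof (rule double_sums_dominated)
    show "summable (\<lambda>m. (1/2) powr (\<mu> - Re q) / \<delta>' * (cmod (?sb m) * 2 ^ m))" "summable (\<lambda>l. cmod (neg_binomial \<mu> l) * (1/2) ^ l)"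
      using \<xi> by (auto intro!: summable_mult summable_scaled_bcoef summable_neg_binomial)
    show "(1/2) powr (\<mu> - Re q) / \<delta>' * (cmod (?sb m) * 2 ^ m) \<ge> 0" "cmod (neg_binomial \<mu> m) * (1/2) ^ m \<ge> 0" for m using \<delta>' by auto
    show "cmod (a2 m l) \<le> (1/2) powr (\<mu> - Re q) / \<delta>' * (cmod (?sb m) * 2 ^ m) * (cmod (neg_binomial \<mu> l) * (1/2) ^ l)" for m l
    proof -
      have b: "cmod (of_real \<mu> - (q + of_nat m) + of_nat l) \<ge> \<delta>'"
        using \<delta>'(2)[of "int l - int m"] by (simp add: algebra_simps)
      have "cmod (a2 m l) \<le> cmod (?sb m) * ((1/2) powr Re (of_real \<mu> - (q + of_nat m)) / \<delta>' * (cmod (neg_binomial \<mu> l) * (1/2) ^ l))"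
        unfolding a2_def by (subst norm_mult) (intro mult_left_mono finite_part_term_bound b \<delta>', auto)
      also have "(1/2 :: real) powr Re (of_real \<mu> - (q + of_nat m)) = (1/2) powr (\<mu> - Re q) * 2 ^ m"
      proof -
        have "Re (of_real \<mu> - (q + of_nat m)) = (\<mu> - Re q) + - real m" by simp
        then have "(1/2 :: real) powr Re (of_real \<mu> - (q + of_nat m)) = (1/2) powr (\<mu> - Re q) * (1/2) powr (- real m)"
          by (simp only: powr_add)
        also have "(1/2 :: real) powr (- real m) = 2 ^ m" by (simp add: powr_minus powr_realpow power_one_over)
        finally show ?thesis .
      qed
      finally show ?thesis by (simp add: mult_ac)
    qed
  qed
  have a2l: "(\<Sum>l. a2 m l) = ?sb m * finite_part (neg_binomial \<mu>) (of_real \<mu> - (q + of_nat m)) (1/2)" for m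
    using sums_mult[OF finite_part_sums[OF \<mu>qm _ summable_neg_binomial[of "1/2" \<mu>]], of "?sb m" m] unfolding a2_def by (simp add: sums_iff)
  have a2m: "(\<Sum>m. a2 m l) = - (neg_binomial \<mu> l * L l)" for l
  proof -
    have "a2 m l = - neg_binomial \<mu> l * (?sb m * of_real 2 powr (q - of_real \<mu> - of_nat l + of_nat m) / (q - of_real \<mu> - of_nat l + of_nat m))" for m
    proof -
      have e: "of_real \<mu> - (q + of_nat m) + of_nat l = - (q - of_real \<mu> - of_nat l + of_nat m)" by simp
      have g: "s * (b * t / - d) = - b * (s * t / d)" for s b t d :: complex by (simp add: mult_ac)
      show ?thesis unfolding a2_def e half_powr minus_minus by (rule g)
    qed
    moreover have "(\<lambda>m. - neg_binomial \<mu> l * (?sb m * of_real 2 powr (q - of_real \<mu> - of_nat l + of_nat m) / (q - of_real \<mu> - of_nat l + of_nat m))) sums (- neg_binomial \<mu> l * L l)"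
      unfolding L_def using \<xi> by (intro sums_mult finite_part_sums pl summable_scaled_bcoef) auto
    ultimately show ?thesis by (simp add: sums_iff)
  qed
  have Y: "(\<lambda>l. neg_binomial \<mu> l * C l) sums ((LINT x:{2..}|lborel. ?G x) - S2)"
  proof -
    have "(\<lambda>l. neg_binomial \<mu> l * I l - - (neg_binomial \<mu> l * L l)) sums ((LINT x:{2..}|lborel. ?G x) - S2)"
      by (rule sums_diff[OF T2 S2(2)[unfolded a2m]])
    then show ?thesis by (simp add: IL[symmetric] distrib_left)
  qed
  have X: "(\<lambda>m. ?sb m * (Gamma (q + of_nat m) * Gamma (of_real \<mu> - (q + of_nat m)) / Gamma (of_real \<mu>))) sums ((LINT x:{A..2}|lborel. ?G x) + S1 + S2)"
  proof -
    have "(\<lambda>m. ?sb m * J m + ?sb m * finite_part (neg_binomial \<mu>) (q + of_nat m) A + ?sb m * finite_part (neg_binomial \<mu>) (of_real \<mu> - (q + of_nat m)) (1/2))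
       sums ((LINT x:{A..2}|lborel. ?G x) + S1 + S2)"
      by (intro sums_add T1 S1(1)[unfolded a1l] S2(1)[unfolded a2l])
    moreover have "?sb m * J m + ?sb m * finite_part (neg_binomial \<mu>) (q + of_nat m) A + ?sb m * finite_part (neg_binomial \<mu>) (of_real \<mu> - (q + of_nat m)) (1/2)
       = ?sb m * (Gamma (q + of_nat m) * Gamma (of_real \<mu> - (q + of_nat m)) / Gamma (of_real \<mu>))" for m
      unfolding beta_mellin_eq[OF A \<mu> qm \<mu>qm, symmetric] beta_mellin_def J_def by (simp only: distrib_left)
    ultimately show ?thesis by (simp only:)
  qed
  show ?thesis
  proof (rule that[OF X Y[unfolded C_def]])
    show "mellin_fp \<mu> \<nu> \<xi> q A = (LINT x:{A..2}|lborel. ?G x) + S1 + S2 + ((LINT x:{2..}|lborel. ?G x) - S2)"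
      unfolding mellin_fp_def S1low LINT_split_Ici[OF iA A2] by simp
  qed
qed

lemma mellin_integrand_bound:
  assumes A: "A > 0" and \<xi>: "\<xi> > 0" and \<mu>: "\<mu> > 0"
  obtains K where "K \<ge> 0" "\<And>x. x \<ge> A \<Longrightarrow> cmod (of_real x powr (q - 1) * of_real ((1 + x) powr (- \<mu>)) * of_real (bessel_clifford \<nu> (\<xi> * x)))
     \<le> K * x powr (Re q - 1 - \<mu> - \<nu> / 2 - 1 / 4)"
proof -
  obtain K where K: "K \<ge> 0" "\<And>x. x \<ge> A \<Longrightarrow> \<bar>bessel_clifford \<nu> (\<xi> * x)\<bar> \<le> K * x powr (- \<nu> / 2 - 1 / 4)"
    using bessel_clifford_scaled_bound[OF A \<xi>] by blast
  show ?thesis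
  proof
    fix x assume "x \<ge> A"
    then have x: "x \<ge> A" "x > 0" using A by auto
    have "cmod (of_real x powr (q - 1) * of_real ((1 + x) powr (- \<mu>)) * of_real (bessel_clifford \<nu> (\<xi> * x)))
      = x powr (Re q - 1) * (1 + x) powr (- \<mu>) * \<bar>bessel_clifford \<nu> (\<xi> * x)\<bar>"
      using x by (simp add: norm_mult norm_of_real_powr)
    also have "\<dots> \<le> x powr (Re q - 1) * x powr (- \<mu>) * (K * x powr (- \<nu> / 2 - 1 / 4))"
      using x \<mu> K(1) by (intro mult_mono[OF mult_left_mono[OF powr_mono2'] K(2)]) auto
    also have "\<dots> = K * x powr ((Re q - 1) + (- \<mu>) + (- \<nu> / 2 - 1 / 4))" by (simp only: powr_add mult_ac)
    also have "(Re q - 1) + (- \<mu>) + (- \<nu> / 2 - 1 / 4) = Re q - 1 - \<mu> - \<nu> / 2 - 1 / 4" by simp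
    finally show "cmod (of_real x powr (q - 1) * of_real ((1 + x) powr (- \<mu>)) * of_real (bessel_clifford \<nu> (\<xi> * x)))
     \<le> K * x powr (Re q - 1 - \<mu> - \<nu> / 2 - 1 / 4)" .
  qed (rule K(1))
qed

lemma mellin_integrable:
  assumes A: "A > 0" and \<xi>: "\<xi> > 0" and \<mu>: "\<mu> > 0" and q: "Re q < \<mu> + \<nu> / 2 + 1 / 4"
  shows "set_integrable lborel {A..} (\<lambda>x. of_real x powr (q - 1) * of_real ((1 + x) powr (- \<mu>)) * complex_of_real (bessel_clifford \<nu> (\<xi> * x)))"
proof -
  obtain K where K: "K \<ge> 0" "\<And>x. x \<ge> A \<Longrightarrow> cmod (of_real x powr (q - 1) * of_real ((1 + x) powr (- \<mu>)) * of_real (bessel_clifford \<nu> (\<xi> * x)))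
     \<le> K * x powr (Re q - 1 - \<mu> - \<nu> / 2 - 1 / 4)"
    using mellin_integrand_bound[OF A \<xi> \<mu>] by blast
  show ?thesis
  proof (rule set_integrable_bound_continuous)
    show "set_integrable lborel {A..} (\<lambda>x. K * x powr (Re q - 1 - \<mu> - \<nu> / 2 - 1 / 4))"
      by (rule set_integrable_mult_right, rule set_integrable_powr_Ici) (use q A in auto)
    show "continuous_on {A..} (\<lambda>x. of_real x powr (q - 1) * of_real ((1 + x) powr (- \<mu>)) * complex_of_real (bessel_clifford \<nu> (\<xi> * x)))"
      using A by (intro continuous_intros continuous_on_of_real_powr) auto
  qed (use K in auto)
qed

lemma tendsto_of_real_powr:
  "A > 0 \<Longrightarrow> ((\<lambda>q. complex_of_real A powr f q) \<longlongrightarrow> complex_of_real A powr L) F" if "(f \<longlongrightarrow> L) F"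
  using that by (intro tendsto_powr_complex tendsto_const) auto

text \<open>
  Continuity in \<open>q\<close>, by Tannery's theorem for the finite part and by dominated convergence for the
  integral. It is needed where \<open>\<mu> - q\<close> is an integer: there the two series of \<open>mellin_fp_split\<close> have
  poles that cancel, and \<^const>\<open>H_fun\<close> is defined as a limit.
\<close>

lemma mellin_fp_tendsto:
  assumes A: "0 < A" "A < 1" and \<xi>: "\<xi> > 0" and \<mu>: "\<mu> > 0"
    and q0: "q0 \<notin> \<int>\<^sub>\<le>\<^sub>0" "Re q0 < \<mu> + \<nu> / 2 + 1 / 4"
  shows "((\<lambda>q. mellin_fp \<mu> \<nu> \<xi> q A) \<longlongrightarrow> mellin_fp \<mu> \<nu> \<xi> q0 A) (at q0)"
proof -
  obtain \<delta> where \<delta>: "\<delta> > 0" "\<And>m::nat. cmod (q0 + of_nat m) \<ge> \<delta>" using nonpos_Ints_dist[OF q0(1)] by blast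
  let ?g = "profile_coeff \<mu> \<nu> \<xi>"
  define M where "M = (\<lambda>k. A powr (Re q0 - 1) / (\<delta> / 2) * (cmod (?g k) * A ^ k))"
  have "((\<lambda>q. \<Sum>k. ?g k * of_real A powr (q + of_nat k) / (q + of_nat k)) \<longlongrightarrow> (\<Sum>k. ?g k * of_real A powr (q0 + of_nat k) / (q0 + of_nat k))) (at q0)"
  proof (rule tannerys_theorem[where M = M, THEN conjunct2, THEN conjunct2])
    show "((\<lambda>q. ?g k * of_real A powr (q + of_nat k) / (q + of_nat k)) \<longlongrightarrow> ?g k * of_real A powr (q0 + of_nat k) / (q0 + of_nat k)) (at q0)" for k
      using A nonpos_Ints_add_nat[OF q0(1)] by (intro tendsto_intros tendsto_of_real_powr) auto
    show "summable M" unfolding M_def using A \<xi> by (intro summable_mult summable_profile_coeff) auto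
    have "\<forall>\<^sub>F q in at q0. dist q q0 < min 1 (\<delta> / 2)"
      unfolding eventually_at using \<delta>(1) by (intro exI[of _ "min 1 (\<delta>/2)"]) auto
    then have "\<forall>\<^sub>F q in at q0. \<forall>k. norm (?g k * of_real A powr (q + of_nat k) / (q + of_nat k)) \<le> M k"
    proof eventually_elim
      case (elim q)
      show ?case
      proof
        fix k
        have "cmod (q0 + of_nat k) \<le> cmod (q + of_nat k) + cmod (q0 - q)"
          using norm_triangle_ineq[of "q + of_nat k" "q0 - q"] by (simp add: algebra_simps)
        then have "cmod (q + of_nat k) \<ge> \<delta> / 2"
          using \<delta>(2)[of k] elim by (simp add: dist_norm norm_minus_commute)
        then have "norm (?g k * of_real A powr (q + of_nat k) / (q + of_nat k)) \<le> A powr Re q / (\<delta> / 2) * (cmod (?g k) * A ^ k)"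
          using \<delta>(1) by (intro finite_part_term_bound A) auto
        also have "\<dots> \<le> M k"
        proof -
          have "cmod (q - q0) < 1" using elim by (simp add: dist_norm)
          moreover have "\<bar>Re q - Re q0\<bar> \<le> cmod (q - q0)" using abs_Re_le_cmod[of "q - q0"] by simp
          ultimately have "Re q0 - 1 \<le> Re q" by linarith
          then have "A powr Re q \<le> A powr (Re q0 - 1)" using A by (intro powr_mono') auto
          then show ?thesis unfolding M_def using \<delta>(1) A by (intro mult_right_mono divide_right_mono) auto
        qed
        finally show "norm (?g k * of_real A powr (q + of_nat k) / (q + of_nat k)) \<le> M k" .
      qed
    qed
    then have "\<forall>\<^sub>F (k::nat, q) in at_top \<times>\<^sub>F at q0. \<forall>k. norm (?g k * of_real A powr (q + of_nat k) / (q + of_nat k)) \<le> M k"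
      by (subst eventually_prod2) auto
    then show "\<forall>\<^sub>F (k, q) in at_top \<times>\<^sub>F at q0. norm (?g k * of_real A powr (q + of_nat k) / (q + of_nat k)) \<le> M k"
      by (rule eventually_mono) auto
  qed auto
  then have low: "((\<lambda>q. finite_part ?g q A) \<longlongrightarrow> finite_part ?g q0 A) (at q0)"
    unfolding finite_part_def .
  let ?G = "\<lambda>q x. of_real x powr (q - 1) * of_real ((1 + x) powr (- \<mu>)) * complex_of_real (bessel_clifford \<nu> (\<xi> * x))"
  have "((\<lambda>q. LINT x:{A..}|lborel. ?G q x) \<longlongrightarrow> (LINT x:{A..}|lborel. ?G q0 x)) (at q0)"
    unfolding tendsto_at_iff_sequentially comp_def
  proof (intro allI impI)
    fix X assume "X \<longlonglongrightarrow> q0"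
    \<comment> \<open>Half the distance to the abscissa of convergence; the integrands at \<open>Re q0 + \<eta>\<close> and \<open>Re q0 - \<eta>\<close>
      dominate those in between.\<close>
    define \<eta> where "\<eta> = (\<mu> + \<nu> / 2 + 1 / 4 - Re q0) / 2"
    have \<eta>: "\<eta> > 0" using q0(2) by (simp add: \<eta>_def)
    obtain N where N: "\<And>i. i \<ge> N \<Longrightarrow> dist (X i) q0 < \<eta>"
      using \<open>X \<longlonglongrightarrow> q0\<close> \<eta> unfolding lim_sequentially by blast
    have iG: "set_integrable lborel {A..} (?G q)" if "Re q < \<mu> + \<nu> / 2 + 1 / 4" for q
      by (rule mellin_integrable[OF A(1) \<xi> \<mu> that])
    have r1: "Re (q0 + of_real \<eta>) < \<mu> + \<nu> / 2 + 1 / 4" and r2: "Re (q0 - of_real \<eta>) < \<mu> + \<nu> / 2 + 1 / 4"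
      using q0(2) by (simp_all add: \<eta>_def field_simps)
    let ?w = "\<lambda>x. norm (indicator {A..} x *\<^sub>R ?G (q0 + of_real \<eta>) x) + norm (indicator {A..} x *\<^sub>R ?G (q0 - of_real \<eta>) x)"
    have w: "integrable lborel ?w"
      using iG[OF r1] iG[OF r2] unfolding set_integrable_def by (intro Bochner_Integration.integrable_add integrable_norm)
    have XN: "\<bar>Re (X (i + N)) - Re q0\<bar> < \<eta>" for i
      using N[of "i + N"] abs_Re_le_cmod[of "X (i + N) - q0"] by (simp add: dist_norm)
    have "(\<lambda>i. LINT x:{A..}|lborel. ?G (X (i + N)) x) \<longlonglongrightarrow> (LINT x:{A..}|lborel. ?G q0 x)"
      unfolding set_lebesgue_integral_def
    proof (rule integral_dominated_convergence[OF _ _ w])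
      show "(\<lambda>x. indicator {A..} x *\<^sub>R ?G q0 x) \<in> borel_measurable lborel"
        using iG[OF q0(2)] unfolding set_integrable_def by (rule borel_measurable_integrable)
      show "(\<lambda>x. indicator {A..} x *\<^sub>R ?G (X (i + N)) x) \<in> borel_measurable lborel" for i
      proof -
        have "Re (X (i + N)) < \<mu> + \<nu> / 2 + 1 / 4" using XN[of i] r1 unfolding plus_complex.sel Re_complex_of_real by linarith
        from iG[OF this] show ?thesis unfolding set_integrable_def by (rule borel_measurable_integrable)
      qed
      have XL: "(\<lambda>i. X (i + N)) \<longlonglongrightarrow> q0" using \<open>X \<longlonglongrightarrow> q0\<close> by (rule LIMSEQ_ignore_initial_segment)
      show "AE x in lborel. (\<lambda>i. indicator {A..} x *\<^sub>R ?G (X (i + N)) x) \<longlonglongrightarrow> indicator {A..} x *\<^sub>R ?G q0 x"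
      proof (rule AE_I2)
        fix x :: real
        show "(\<lambda>i. indicator {A..} x *\<^sub>R ?G (X (i + N)) x) \<longlonglongrightarrow> indicator {A..} x *\<^sub>R ?G q0 x"
        proof (cases "x \<ge> A")
          case True
          then have "x > 0" using A by simp
          then show ?thesis
            by (intro tendsto_scaleR tendsto_mult tendsto_const tendsto_of_real_powr tendsto_diff XL)
        qed simp
      qed
      show "AE x in lborel. norm (indicator {A..} x *\<^sub>R ?G (X (i + N)) x) \<le> ?w x" for i
      proof (rule AE_I2)
        fix x :: real
        show "norm (indicator {A..} x *\<^sub>R ?G (X (i + N)) x) \<le> ?w x"
        proof (cases "x \<ge> A")
          case True
          then have x: "x > 0" using A by simp
          have "x powr (Re (X (i + N)) - 1) \<le> x powr (Re q0 + \<eta> - 1) + x powr (Re q0 - \<eta> - 1)"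
          proof (cases "x \<ge> 1")
            case True
            then have "x powr (Re (X (i + N)) - 1) \<le> x powr (Re q0 + \<eta> - 1)"
              using XN[of i] by (intro powr_mono) auto
            then show ?thesis using powr_ge_zero[of x "Re q0 - \<eta> - 1"] by linarith
          next
            case False
            then have "x powr (Re (X (i + N)) - 1) \<le> x powr (Re q0 - \<eta> - 1)"
              using XN[of i] x by (intro powr_mono') auto
            then show ?thesis using powr_ge_zero[of x "Re q0 + \<eta> - 1"] by linarith
          qed
          then have "x powr (Re (X (i + N)) - 1) * ((1 + x) powr (- \<mu>) * \<bar>bessel_clifford \<nu> (\<xi> * x)\<bar>)
             \<le> (x powr (Re q0 + \<eta> - 1) + x powr (Re q0 - \<eta> - 1)) * ((1 + x) powr (- \<mu>) * \<bar>bessel_clifford \<nu> (\<xi> * x)\<bar>)"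
            by (intro mult_right_mono) auto
          then show ?thesis using True x
            by (simp add: norm_mult norm_of_real_powr distrib_right mult.assoc)
        qed simp
      qed
    qed
    then show "(\<lambda>i. LINT x:{A..}|lborel. ?G (X i) x) \<longlonglongrightarrow> (LINT x:{A..}|lborel. ?G q0 x)"
      by (rule LIMSEQ_offset)
  qed
  from tendsto_add[OF this low] show ?thesis unfolding mellin_fp_def .
qed

section \<open>The value of the finite part is the function H\<close>

lemma pochhammer_Gamma_mult: "z \<notin> \<int>\<^sub>\<le>\<^sub>0 \<Longrightarrow> Gamma z * pochhammer z n = Gamma (z + of_nat n)" for z :: complex
  by (simp add: pochhammer_Gamma Gamma_eq_zero_iff)

lemma sin_pi_minus_nat: "sin (of_real pi * (z - of_nat n)) = (-1) ^ n * sin (of_real pi * z :: complex)"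
proof (induction n)
  case (Suc n)
  have "of_real pi * (z - of_nat (Suc n)) = of_real pi * (z - of_nat n) - of_real pi"
    by (simp add: algebra_simps)
  then have "sin (of_real pi * (z - of_nat (Suc n))) = - sin (of_real pi * (z - of_nat n))"
    by (simp add: sin_diff)
  then show ?case using Suc by simp
qed simp

lemma rGamma_one_minus:
  fixes z :: complex
  assumes "z \<notin> \<int>\<^sub>\<le>\<^sub>0"
  shows "rGamma (1 - z) = Gamma z * sin (of_real pi * z) / of_real pi"
proof -
  have "Gamma z * (rGamma z * rGamma (1 - z)) = rGamma (1 - z)"
    using assms by (simp add: rGamma_inverse_Gamma Gamma_eq_zero_iff)
  then show ?thesis unfolding rGamma_reflection_complex by simp
qed

lemma sin_pi_not_Ints:
  fixes z :: complex
  assumes "z \<notin> \<int>"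
  shows "sin (of_real pi * z) \<noteq> 0"
proof
  assume "sin (of_real pi * z) = 0"
  then obtain n :: int where "of_real pi * z = of_real (of_int n * pi)"
    unfolding sin_eq_0 by auto
  then have "z = of_int n" by (simp add: mult.commute)
  with assms show False by simp
qed

text \<open>
  The two series of \<open>mellin_fp_split\<close> match the two hypergeometric series term by term. The reflection
  formula trades \<open>\<Gamma>(\<mu> - q - m)\<close> and \<open>\<Gamma>(q - \<mu> - l)\<close> for reciprocal Gamma functions; the factor
  \<open>sin \<pi>(\<mu> - q) / \<pi>\<close> that this produces is the one in the definition of \<open>H\<close>, up to alternating signs.
\<close>

lemma H_formula_eq_mellin_fp:
  assumes A: "0 < A" "A < 1" and b: "b > 0" and \<mu>: "\<mu> > 0"
    and q: "H_lambda \<gamma> \<nu> s \<notin> \<int>\<^sub>\<le>\<^sub>0" "of_real \<mu> - H_lambda \<gamma> \<nu> s \<notin> \<int>" "Re (H_lambda \<gamma> \<nu> s) < \<mu> + \<nu> / 2 + 1 / 4"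
  shows "H_formula b \<mu> \<gamma> \<nu> s = of_real ((b / 2) powr \<nu> / 2) * mellin_fp \<mu> \<nu> (b\<^sup>2 / 4) (H_lambda \<gamma> \<nu> s) A"
proof -
  define q where "q = H_lambda \<gamma> \<nu> s"
  define \<xi> where "\<xi> = b\<^sup>2 / 4"
  define S where "S = sin (of_real pi * (of_real \<mu> - q))"
  have \<xi>: "\<xi> > 0" using b by (simp add: \<xi>_def)
  have q': "q \<notin> \<int>\<^sub>\<le>\<^sub>0" "of_real \<mu> - q \<notin> \<int>" "Re q < \<mu> + \<nu> / 2 + 1 / 4" using q by (simp_all add: q_def)
  obtain X Y where X: "(\<lambda>m. scaled_bcoef \<nu> \<xi> m * (Gamma (q + of_nat m) * Gamma (of_real \<mu> - (q + of_nat m)) / Gamma (of_real \<mu>))) sums X"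
    and Y: "(\<lambda>l. neg_binomial \<mu> l * (of_real \<xi> powr (- (q - of_real \<mu> - of_nat l)) * Gamma (q - of_real \<mu> - of_nat l)
        * rGamma (of_real \<nu> + 1 - (q - of_real \<mu> - of_nat l)))) sums Y"
    and XY: "mellin_fp \<mu> \<nu> \<xi> q A = X + Y"
    using mellin_fp_split[OF A \<xi> \<mu> q'] by blast
  have S0: "S \<noteq> 0" unfolding S_def by (rule sin_pi_not_Ints[OF q'(2)])
  have Gq: "Gamma q \<noteq> 0" using q'(1) by (simp add: Gamma_eq_zero_iff)
  have G\<mu>: "Gamma (complex_of_real \<mu>) \<noteq> 0"
    using Gamma_real_pos[OF \<mu>] by (simp add: Gamma_complex_of_real)
  have int: "of_real \<mu> - q + of_int n \<notin> \<int>" for n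
  proof
    assume "of_real \<mu> - q + of_int n \<in> \<int>"
    from Ints_diff[OF this Ints_of_int[of n]] have "of_real \<mu> - q + of_int n - of_int n \<in> \<int>" .
    with q'(2) show False by simp
  qed
  have 1: "reg_hypergeom_1F2 q (1 + q - of_real \<mu>) (1 + of_real \<nu>) (of_real \<xi>) = Gamma (of_real \<mu>) * S / (of_real pi * Gamma q) * X"
  proof -
    have "pochhammer q n * rGamma (1 + q - of_real \<mu> + of_nat n) * rGamma (1 + of_real \<nu> + of_nat n) * of_real \<xi> ^ n / fact n
      = Gamma (of_real \<mu>) * S / (of_real pi * Gamma q) * (scaled_bcoef \<nu> \<xi> n * (Gamma (q + of_nat n) * Gamma (of_real \<mu> - (q + of_nat n)) / Gamma (of_real \<mu>)))" for n
    proof -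
      have ni: "of_real \<mu> - (q + of_nat n) \<notin> \<int>\<^sub>\<le>\<^sub>0"
        using int[of "- int n"] nonpos_Ints_Int[of "of_real \<mu> - (q + of_nat n)"] by (auto simp: algebra_simps)
      have "1 + q - of_real \<mu> + of_nat n = 1 - (of_real \<mu> - (q + of_nat n))" by simp
      then have "rGamma (1 + q - of_real \<mu> + of_nat n) = Gamma (of_real \<mu> - (q + of_nat n)) * sin (of_real pi * (of_real \<mu> - (q + of_nat n))) / of_real pi"
        using rGamma_one_minus[OF ni] by (simp only:)
      also have "sin (of_real pi * (of_real \<mu> - (q + of_nat n))) = (-1) ^ n * S"
        using sin_pi_minus_nat[of "of_real \<mu> - q" n] by (simp add: S_def diff_diff_eq)
      finally have r: "rGamma (1 + q - of_real \<mu> + of_nat n) = Gamma (of_real \<mu> - (q + of_nat n)) * ((-1) ^ n * S) / of_real pi" .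
      have sb: "scaled_bcoef \<nu> \<xi> n = (-1) ^ n * rGamma (1 + of_real \<nu> + of_nat n) / fact n * of_real \<xi> ^ n"
      proof -
        have "rGamma (1 + of_real \<nu> + of_nat n) = complex_of_real (rGamma (\<nu> + 1 + real n))"
          by (simp flip: rGamma_complex_of_real add: add_ac)
        then show ?thesis unfolding scaled_bcoef_def bcoef_def by simp
      qed
      show ?thesis unfolding r sb pochhammer_Gamma_mult[OF q'(1), symmetric]
        using Gq G\<mu> by simp
    qed
    then have "(\<lambda>n. pochhammer q n * rGamma (1 + q - of_real \<mu> + of_nat n) * rGamma (1 + of_real \<nu> + of_nat n) * of_real \<xi> ^ n / fact n)
       sums (Gamma (of_real \<mu>) * S / (of_real pi * Gamma q) * X)"
      using sums_mult[OF X, of "Gamma (of_real \<mu>) * S / (of_real pi * Gamma q)"] by (simp only:)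
    then show ?thesis unfolding reg_hypergeom_1F2_def by (simp add: sums_iff)
  qed
  have 2: "reg_hypergeom_1F2 (of_real \<mu>) (1 - q + of_real \<mu>) (1 - q + of_real \<mu> + of_real \<nu>) (of_real \<xi>)
     = - S / of_real pi * of_real \<xi> powr (q - of_real \<mu>) * Y"
  proof -
    have "pochhammer (of_real \<mu>) n * rGamma (1 - q + of_real \<mu> + of_nat n) * rGamma (1 - q + of_real \<mu> + of_real \<nu> + of_nat n) * of_real \<xi> ^ n / fact n
      = - S / of_real pi * of_real \<xi> powr (q - of_real \<mu>) * (neg_binomial \<mu> n * (of_real \<xi> powr (- (q - of_real \<mu> - of_nat n)) * Gamma (q - of_real \<mu> - of_nat n)
        * rGamma (of_real \<nu> + 1 - (q - of_real \<mu> - of_nat n))))" for n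
    proof -
      have ni: "q - of_real \<mu> - of_nat n \<notin> \<int>\<^sub>\<le>\<^sub>0"
      proof
        assume "q - of_real \<mu> - of_nat n \<in> \<int>\<^sub>\<le>\<^sub>0"
        then have "- (q - of_real \<mu> - of_nat n) \<in> \<int>" by (intro Ints_minus nonpos_Ints_Int)
        moreover have "- (q - of_real \<mu> - of_nat n) = of_real \<mu> - q + of_int (int n)" by simp
        ultimately show False using int[of "int n"] by (simp only:)
      qed
      have "1 - q + of_real \<mu> + of_nat n = 1 - (q - of_real \<mu> - of_nat n)" by simp
      then have "rGamma (1 - q + of_real \<mu> + of_nat n) = Gamma (q - of_real \<mu> - of_nat n) * sin (of_real pi * (q - of_real \<mu> - of_nat n)) / of_real pi"
        using rGamma_one_minus[OF ni] by (simp only:)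
      also have "sin (of_real pi * (q - of_real \<mu> - of_nat n)) = (-1) ^ n * - S"
      proof -
        have "of_real pi * (q - of_real \<mu>) = - (of_real pi * (of_real \<mu> - q))" by (simp add: algebra_simps)
        then have "sin (of_real pi * (q - of_real \<mu>)) = - S" unfolding S_def by (simp only: sin_minus)
        then show ?thesis unfolding sin_pi_minus_nat by simp
      qed
      finally have r: "rGamma (1 - q + of_real \<mu> + of_nat n) = Gamma (q - of_real \<mu> - of_nat n) * ((-1) ^ n * - S) / of_real pi" .
      have bi: "neg_binomial \<mu> n = (-1) ^ n * pochhammer (of_real \<mu>) n / fact n"
        unfolding neg_binomial_def gbinomial_pochhammer by (simp add: pochhammer_of_real[symmetric])
      have e: "of_real \<nu> + 1 - (q - of_real \<mu> - of_nat n) = 1 - q + of_real \<mu> + of_real \<nu> + of_nat n" by simp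
      have x: "of_real \<xi> powr (- (q - of_real \<mu> - of_nat n)) = of_real \<xi> ^ n / complex_of_real \<xi> powr (q - of_real \<mu>)"
      proof -
        have "- (q - of_real \<mu> - of_nat n) = - (q - of_real \<mu>) + of_nat n" by simp
        then have "of_real \<xi> powr (- (q - of_real \<mu> - of_nat n)) = complex_of_real \<xi> powr (- (q - of_real \<mu>)) * of_real \<xi> ^ n"
          using of_real_powr_add_nat[OF \<xi>] by metis
        then show ?thesis by (simp add: powr_minus divide_inverse del: minus_diff_eq)
      qed
      have xi0: "complex_of_real \<xi> powr (q - of_real \<mu>) \<noteq> 0" using \<xi> by simp
      show ?thesis unfolding r bi e x using xi0 by simp
    qed
    then have "(\<lambda>n. pochhammer (of_real \<mu>) n * rGamma (1 - q + of_real \<mu> + of_nat n) * rGamma (1 - q + of_real \<mu> + of_real \<nu> + of_nat n) * of_real \<xi> ^ n / fact n)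
       sums (- S / of_real pi * of_real \<xi> powr (q - of_real \<mu>) * Y)"
      using sums_mult[OF Y, of "- S / of_real pi * of_real \<xi> powr (q - of_real \<mu>)"] by (simp only:)
    then show ?thesis unfolding reg_hypergeom_1F2_def by (simp add: sums_iff)
  qed
  have x1: "complex_of_real \<xi> powr (of_real \<mu> - q) * of_real \<xi> powr (q - of_real \<mu>) = 1"
    using \<xi> by (simp flip: powr_add)
  have pi0: "complex_of_real pi \<noteq> 0" by simp
  define G where "G = Gamma (complex_of_real \<mu>)"
  have "H_formula b \<mu> \<gamma> \<nu> s = of_real pi * of_real ((b / 2) powr \<nu> / (2 * Gamma \<mu>)) / S *
           (Gamma q * (G * S / (of_real pi * Gamma q) * X)
            - of_real \<xi> powr (of_real \<mu> - q) * G * (- S / of_real pi * of_real \<xi> powr (q - of_real \<mu>) * Y))"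
    unfolding H_formula_def Let_def q_def[symmetric] \<xi>_def[symmetric] S_def[symmetric] 1 2 G_def ..
  also have "of_real \<xi> powr (of_real \<mu> - q) * G * (- S / of_real pi * of_real \<xi> powr (q - of_real \<mu>) * Y)
     = (complex_of_real \<xi> powr (of_real \<mu> - q) * of_real \<xi> powr (q - of_real \<mu>)) * (- (G * S / of_real pi * Y))"
    by simp
  also have "Gamma q * (G * S / (of_real pi * Gamma q) * X) = G * S / of_real pi * X"
    using Gq by simp
  also have "of_real pi * of_real ((b / 2) powr \<nu> / (2 * Gamma \<mu>)) / S * (G * S / of_real pi * X -
       (complex_of_real \<xi> powr (of_real \<mu> - q) * of_real \<xi> powr (q - of_real \<mu>)) * (- (G * S / of_real pi * Y)))
     = of_real ((b / 2) powr \<nu> / (2 * Gamma \<mu>)) * G * (X + Y)"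
  proof -
    have "p * c / S * (G * S / p * X - 1 * (- (G * S / p * Y))) = c * G * (X + Y)"
      if "S \<noteq> 0" "p \<noteq> 0" for p c S G :: complex
      using that by (simp add: field_simps)
    from this[OF S0 pi0] show ?thesis unfolding x1 .
  qed
  also have "of_real ((b / 2) powr \<nu> / (2 * Gamma \<mu>)) * G = of_real ((b / 2) powr \<nu> / 2)"
    unfolding G_def Gamma_complex_of_real using Gamma_real_pos[OF \<mu>] by simp
  finally show ?thesis unfolding XY[symmetric] q_def \<xi>_def .
qed

text \<open>
  The hypothesis on \<open>\<gamma> + \<nu>\<close> says that \<open>\<lambda>(1)\<close> is not a pole of \<open>\<Gamma>\<close>, and \<open>2 \<mu> - \<gamma> > 1/2\<close> that the point 1 lies to
  the left of the abscissa of convergence at infinity. If \<open>\<mu> - \<lambda>(1)\<close> is an integer, it is the only such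
  point nearby, and the value is the limit of the generic ones.
\<close>

lemma H_fun_eq_mellin_fp:
  fixes b \<mu> \<gamma> \<nu> A :: real
  assumes A: "0 < A" "A < 1" and b: "b > 0" and \<mu>: "\<mu> > 0" and c: "2 * \<mu> - \<gamma> > 1 / 2"
    and nz: "\<forall>m::nat. \<gamma> + \<nu> \<noteq> - (2 * real m + 1)"
  shows "H_fun b \<mu> \<gamma> \<nu> 1 = of_real ((b / 2) powr \<nu> / 2) * mellin_fp \<mu> \<nu> (b\<^sup>2 / 4) (of_real ((1 + \<gamma> + \<nu>) / 2)) A"
proof -
  define q0 where "q0 = complex_of_real ((1 + \<gamma> + \<nu>) / 2)"
  have l1: "H_lambda \<gamma> \<nu> 1 = q0" by (simp add: H_lambda_def q0_def)
  have q0n: "q0 \<notin> \<int>\<^sub>\<le>\<^sub>0"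
  proof
    assume "q0 \<in> \<int>\<^sub>\<le>\<^sub>0"
    then have "(1 + \<gamma> + \<nu>) / 2 \<in> \<int>\<^sub>\<le>\<^sub>0" unfolding q0_def of_real_in_nonpos_Ints_iff .
    then obtain m where "(1 + \<gamma> + \<nu>) / 2 = - of_nat m" by (rule nonpos_Ints_cases')
    then have "\<gamma> + \<nu> = - (2 * real m + 1)" by (simp add: field_simps)
    with nz show False by blast
  qed
  have q0r: "Re q0 < \<mu> + \<nu> / 2 + 1 / 4" using c by (simp add: q0_def field_simps)
  show ?thesis
  proof (cases "of_real \<mu> - q0 \<in> \<int>")
    case False
    then show ?thesis
      using H_formula_eq_mellin_fp[OF A b \<mu>, of \<gamma> \<nu> 1] q0n q0r unfolding H_fun_def l1 by (simp add: q0_def)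
  next
    case True
    let ?m = "\<lambda>s. of_real ((b / 2) powr \<nu> / 2) * mellin_fp \<mu> \<nu> (b\<^sup>2 / 4) (H_lambda \<gamma> \<nu> s) A"
    have lt: "(H_lambda \<gamma> \<nu> \<longlongrightarrow> q0) (at 1)"
      unfolding H_lambda_def l1[symmetric] by (intro tendsto_intros) auto
    have ne: "\<forall>\<^sub>F s in at 1. H_lambda \<gamma> \<nu> s \<noteq> q0"
      unfolding eventually_at by (intro exI[of _ 1]) (auto simp: H_lambda_def q0_def)
    have fl: "filterlim (H_lambda \<gamma> \<nu>) (at q0) (at 1)"
      using lt ne by (simp add: filterlim_at)
    have "b\<^sup>2 / 4 > 0" using b by simp
    from mellin_fp_tendsto[OF A this \<mu> q0n q0r]
    have lim: "(?m \<longlongrightarrow> of_real ((b / 2) powr \<nu> / 2) * mellin_fp \<mu> \<nu> (b\<^sup>2 / 4) q0 A) (at 1)"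
      by (intro tendsto_mult tendsto_const filterlim_compose[OF _ fl])
    have "\<forall>\<^sub>F q in at q0. q \<notin> \<int>\<^sub>\<le>\<^sub>0 \<and> Re q < \<mu> + \<nu> / 2 + 1 / 4 \<and> of_real \<mu> - q \<notin> \<int>"
    proof (intro eventually_conj)
      have "open (- (\<int>\<^sub>\<le>\<^sub>0 :: complex set))" by (rule open_Compl[OF closed_nonpos_Ints])
      then show "\<forall>\<^sub>F q in at q0. q \<notin> \<int>\<^sub>\<le>\<^sub>0" using q0n eventually_at_in_open'[of "- \<int>\<^sub>\<le>\<^sub>0" q0] by auto
      show "\<forall>\<^sub>F q in at q0. Re q < \<mu> + \<nu> / 2 + 1 / 4"
        using q0r eventually_at_in_open'[OF open_halfspace_Re_lt, of q0 "\<mu> + \<nu> / 2 + 1 / 4"] by auto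
      show "\<forall>\<^sub>F q in at q0. of_real \<mu> - q \<notin> \<int>"
      proof -
        have "\<forall>\<^sub>F q in at q0. dist q q0 < 1 \<and> q \<noteq> q0"
          unfolding eventually_at by (intro exI[of _ 1]) auto
        then show ?thesis
        proof eventually_elim
          case (elim q)
          show ?case
          proof
            assume "of_real \<mu> - q \<in> \<int>"
            then obtain n where n: "of_real \<mu> - q = of_int n" by (auto elim: Ints_cases)
            obtain n0 where n0: "of_real \<mu> - q0 = of_int n0" using True by (auto elim: Ints_cases)
            have "q - q0 = of_int (n0 - n)" using n n0 by (simp add: algebra_simps)
            then have "real_of_int \<bar>n0 - n\<bar> < 1" using elim by (simp add: dist_norm del: of_int_diff)
            then have "n0 = n" by linarith
            with \<open>q - q0 = of_int (n0 - n)\<close> elim show False by simp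
          qed
        qed
      qed
    qed
    from eventually_compose_filterlim[OF this fl]
    have "\<forall>\<^sub>F s in at 1. ?m s = H_formula b \<mu> \<gamma> \<nu> s"
      by eventually_elim (use H_formula_eq_mellin_fp[OF A b \<mu>] in auto)
    from Lim_transform_eventually[OF lim this]
    have "(H_formula b \<mu> \<gamma> \<nu> \<longlongrightarrow> of_real ((b / 2) powr \<nu> / 2) * mellin_fp \<mu> \<nu> (b\<^sup>2 / 4) q0 A) (at 1)" .
    then have "Lim (at 1) (H_formula b \<mu> \<gamma> \<nu>) = of_real ((b / 2) powr \<nu> / 2) * mellin_fp \<mu> \<nu> (b\<^sup>2 / 4) q0 A"
      by (intro tendsto_Lim) auto
    then show ?thesis unfolding H_fun_def l1 using True by (simp add: q0_def)
  qed
qed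

section \<open>The summand as a holomorphic function on the right half-plane\<close>

lemma neg_binomial_pochhammer: "neg_binomial \<mu> m = of_real ((-1) ^ m * pochhammer \<mu> m / fact m)"
  by (simp add: neg_binomial_def gbinomial_pochhammer)

lemma neg_binomial_sums_complex: "cmod w < 1 \<Longrightarrow> (\<lambda>m. neg_binomial \<mu> m * w ^ m) sums ((1 + w) powr (- of_real \<mu>))"
proof -
  assume "cmod w < 1"
  then have "(\<lambda>m. ((- of_real \<mu>) gchoose m) * w ^ m) sums ((1 + w) powr (- of_real \<mu>))"
    by (rule gen_binomial_complex)
  moreover have "((- complex_of_real \<mu>) gchoose m) = neg_binomial \<mu> m" for m
    by (simp add: neg_binomial_pochhammer gbinomial_pochhammer pochhammer_of_real)
  ultimately show ?thesis by simp
qed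

lemma profile_coeff_sums:
  assumes w: "cmod w < 1" and \<xi>: "\<xi> \<ge> 0"
  shows "(\<lambda>k. profile_coeff \<mu> \<nu> \<xi> k * w ^ k) sums (bessel_clifford \<nu> (of_real \<xi> * w) * (1 + w) powr (- of_real \<mu>))"
proof -
  have b: "(\<lambda>m. scaled_bcoef \<nu> \<xi> m * w ^ m) sums bessel_clifford \<nu> (of_real \<xi> * w)"
    using bessel_clifford_sums[of \<nu> "of_real \<xi> * w"] by (simp add: scaled_bcoef_def power_mult_distrib mult.assoc)
  have s1: "summable (\<lambda>m. norm (scaled_bcoef \<nu> \<xi> m * w ^ m))"
    using summable_scaled_bcoef[OF \<xi>, of "cmod w" \<nu>] by (simp add: norm_mult norm_power)
  have s2: "summable (\<lambda>m. norm (neg_binomial \<mu> m * w ^ m))"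
    using summable_neg_binomial[OF _ w, of \<mu>] by (simp add: norm_mult norm_power)
  have "(\<lambda>k. \<Sum>i\<le>k. (scaled_bcoef \<nu> \<xi> i * w ^ i) * (neg_binomial \<mu> (k - i) * w ^ (k - i))) sums
      (bessel_clifford \<nu> (of_real \<xi> * w) * (1 + w) powr (- of_real \<mu>))"
    using Cauchy_product_sums[OF s1 s2] b neg_binomial_sums_complex[OF w, of \<mu>] by (simp add: sums_iff)
  moreover have "(\<Sum>i\<le>k. (scaled_bcoef \<nu> \<xi> i * w ^ i) * (neg_binomial \<mu> (k - i) * w ^ (k - i))) = profile_coeff \<mu> \<nu> \<xi> k * w ^ k" for k
    unfolding profile_coeff_def sum_distrib_right
  proof (intro sum.cong refl)
    fix i assume "i \<in> {..k}"
    then have "w ^ k = w ^ i * w ^ (k - i)" by (simp flip: power_add)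
    then show "(scaled_bcoef \<nu> \<xi> i * w ^ i) * (neg_binomial \<mu> (k - i) * w ^ (k - i)) = scaled_bcoef \<nu> \<xi> i * neg_binomial \<mu> (k - i) * w ^ k"
      by (simp only: mult_ac)
  qed
  ultimately show ?thesis by simp
qed

text \<open>
  Taylor's theorem for \<open>E\<^sub>\<nu>(\<xi> w) (1 + w) powr -\<mu>\<close>, uniformly on a disc. The bound holds for complex \<open>w\<close>, which
  is what permits Cauchy estimates for the derivatives later on.
\<close>

lemma profile_coeff_tail_bound:
  assumes R: "0 < R" "R < 1" and \<xi>: "\<xi> \<ge> 0"
  obtains C where "C \<ge> 0" "\<And>w. cmod w \<le> R \<Longrightarrow>
     cmod (bessel_clifford \<nu> (of_real \<xi> * w) * (1 + w) powr (- of_real \<mu>) - (\<Sum>k<M. profile_coeff \<mu> \<nu> \<xi> k * w ^ k)) \<le> C * cmod w ^ M"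
proof -
  let ?g = "profile_coeff \<mu> \<nu> \<xi>"
  have sR: "summable (\<lambda>k. cmod (?g (k + M)) * R ^ k)"
  proof -
    have "summable (\<lambda>k. cmod (?g (k + M)) * R ^ (k + M))"
      using summable_ignore_initial_segment[OF summable_profile_coeff[of R \<xi> \<mu> \<nu>], of M] R \<xi> by simp
    from summable_mult2[OF this, of "1 / R ^ M"] show ?thesis using R by (simp add: power_add)
  qed
  define C where "C = (\<Sum>k. cmod (?g (k + M)) * R ^ k)"
  show ?thesis
  proof
    show "C \<ge> 0" unfolding C_def using R by (intro suminf_nonneg sR) auto
    fix w assume w: "cmod w \<le> R"
    then have w1: "cmod w < 1" using R by simp
    let ?F = "bessel_clifford \<nu> (of_real \<xi> * w) * (1 + w) powr (- of_real \<mu>)"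
    have "(\<lambda>k. ?g (k + M) * w ^ (k + M)) sums (?F - (\<Sum>k<M. ?g k * w ^ k))"
      using sums_split_initial_segment[OF profile_coeff_sums[OF w1 \<xi>, of \<mu> \<nu>], of M] by simp
    then have s: "(\<lambda>k. w ^ M * (?g (k + M) * w ^ k)) sums (?F - (\<Sum>k<M. ?g k * w ^ k))"
      by (simp add: power_add mult_ac)
    have le: "cmod (?g (k + M) * w ^ k) \<le> cmod (?g (k + M)) * R ^ k" for k
      using w by (simp add: norm_mult norm_power mult_left_mono power_mono)
    have sn: "summable (\<lambda>k. cmod (?g (k + M) * w ^ k))"
      by (rule summable_comparison_test'[OF sR, of 0]) (use le in simp)
    have "?F - (\<Sum>k<M. ?g k * w ^ k) = w ^ M * (\<Sum>k. ?g (k + M) * w ^ k)"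
      using s sums_mult[OF summable_sums[OF summable_norm_cancel[OF sn]], of "w ^ M"] sums_unique2 by blast
    then have "cmod (?F - (\<Sum>k<M. ?g k * w ^ k)) = cmod w ^ M * cmod (\<Sum>k. ?g (k + M) * w ^ k)"
      by (simp add: norm_mult norm_power)
    also have "cmod (\<Sum>k. ?g (k + M) * w ^ k) \<le> (\<Sum>k. cmod (?g (k + M) * w ^ k))" by (rule summable_norm[OF sn])
    also have "\<dots> \<le> C" unfolding C_def by (rule suminf_le[OF le sn sR])
    finally have "cmod (?F - (\<Sum>k<M. ?g k * w ^ k)) \<le> cmod w ^ M * C" by (simp add: mult_left_mono)
    then show "cmod (?F - (\<Sum>k<M. ?g k * w ^ k)) \<le> C * cmod w ^ M" by (simp only: mult.commute)
  qed
qed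

text \<open>
  The exponent \<open>a\<close> and the orders \<open>\<nu>\<close> and \<open>\<mu>\<close> are independent parameters, so that the family is
  closed under differentiation up to linear combinations.
\<close>

definition profile :: "real \<Rightarrow> real \<Rightarrow> real \<Rightarrow> real \<Rightarrow> complex \<Rightarrow> complex" where
  "profile \<xi> a \<nu> \<mu> z = z powr of_real a * (bessel_clifford \<nu> (of_real \<xi> * z\<^sup>2) * (1 + z\<^sup>2) powr (- of_real \<mu>))"

abbreviation rhp :: "complex set" where "rhp \<equiv> {z. Re z > 0}"

lemma rhp_facts: "open rhp" "convex rhp"
  by (simp_all add: open_halfspace_Re_gt convex_halfspace_Re_gt)

lemma rhp_not_nonpos: "z \<in> rhp \<Longrightarrow> z \<notin> \<real>\<^sub>\<le>\<^sub>0"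
  by (auto simp: complex_nonpos_Reals_iff)

lemma rhp_one_plus_square: "z \<in> rhp \<Longrightarrow> 1 + z\<^sup>2 \<notin> \<real>\<^sub>\<le>\<^sub>0"
proof
  assume z: "z \<in> rhp" and "1 + z\<^sup>2 \<in> \<real>\<^sub>\<le>\<^sub>0"
  then have "Re (1 + z\<^sup>2) \<le> 0" "Im (1 + z\<^sup>2) = 0" by (auto simp: complex_nonpos_Reals_iff)
  then have "1 + ((Re z)\<^sup>2 - (Im z)\<^sup>2) \<le> 0" "2 * Re z * Im z = 0"
    by (simp_all only: plus_complex.sel one_complex.sel Re_power2 Im_power2 add_0)
  moreover from this z have "Im z = 0" by simp
  ultimately have "1 + (Re z)\<^sup>2 \<le> 0" by simp
  moreover have "(Re z)\<^sup>2 \<ge> 0" by simp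
  ultimately show False by linarith
qed

lemma DERIV_profile:
  assumes z: "z \<in> rhp"
  shows "(profile \<xi> a \<nu> \<mu> has_field_derivative
     of_real a * profile \<xi> (a - 1) \<nu> \<mu> z - of_real (2 * \<xi>) * profile \<xi> (a + 1) (\<nu> + 1) \<mu> z
       - of_real (2 * \<mu>) * profile \<xi> (a + 1) \<nu> (\<mu> + 1) z) (at z)"
proof -
  note n = rhp_not_nonpos[OF z] rhp_one_plus_square[OF z]
  have z0: "z \<noteq> 0" using z by auto
  let ?B = "bessel_clifford \<nu> (of_real \<xi> * z\<^sup>2)" and ?P = "(1 + z\<^sup>2) powr (- of_real \<mu>)"
  have 1: "((\<lambda>z. z powr of_real a) has_field_derivative of_real a * z powr (of_real a - 1)) (at z)"
    by (rule has_field_derivative_powr[OF n(1)])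
  have 2: "((\<lambda>z. bessel_clifford \<nu> (of_real \<xi> * z\<^sup>2)) has_field_derivative
      - bessel_clifford (\<nu> + 1) (of_real \<xi> * z\<^sup>2) * (of_real \<xi> * (2 * z))) (at z)"
    by (rule DERIV_bessel_clifford') (auto intro!: derivative_eq_intros)
  have "((\<lambda>z. 1 + z\<^sup>2) has_field_derivative 2 * z) (at z)" by (auto intro!: derivative_eq_intros)
  from DERIV_chain2[OF has_field_derivative_powr[OF n(2)] this]
  have 3: "((\<lambda>z. (1 + z\<^sup>2) powr (- of_real \<mu>)) has_field_derivative
      - of_real \<mu> * (1 + z\<^sup>2) powr (- of_real \<mu> - 1) * (2 * z)) (at z)" .
  have za: "z powr of_real (a - 1) = z powr (of_real a - 1)" by simp
  have zp: "z powr of_real (a + 1) = z powr of_real a * z" using z0 by (simp add: powr_add)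
  have m: "(1 + z\<^sup>2) powr (- of_real (\<mu> + 1)) = (1 + z\<^sup>2) powr (- of_real \<mu> - 1)" by simp
  have "(profile \<xi> a \<nu> \<mu> has_field_derivative
     of_real a * z powr (of_real a - 1) * (?B * ?P) +
     (- bessel_clifford (\<nu> + 1) (of_real \<xi> * z\<^sup>2) * (of_real \<xi> * (2 * z)) * ?P
       + - of_real \<mu> * (1 + z\<^sup>2) powr (- of_real \<mu> - 1) * (2 * z) * ?B) * z powr of_real a) (at z)"
    unfolding profile_def[abs_def] by (rule DERIV_mult[OF 1 DERIV_mult[OF 2 3]])
  then show ?thesis
    by (rule DERIV_cong) (unfold profile_def za zp m, simp add: algebra_simps)
qed

lemma holomorphic_profile: "profile \<xi> a \<nu> \<mu> holomorphic_on rhp"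
  unfolding holomorphic_on_open[OF rhp_facts(1)] using DERIV_profile by blast

lemma profile_of_real:
  assumes "x > 0"
  shows "profile \<xi> a \<nu> \<mu> (of_real x) = of_real (x powr a * bessel_clifford \<nu> (\<xi> * x\<^sup>2) * (1 + x\<^sup>2) powr (- \<mu>))"
proof -
  have "complex_of_real x powr of_real a = of_real (x powr a)" using assms by (simp add: powr_of_real)
  moreover have "(1 + (complex_of_real x)\<^sup>2) powr (- of_real \<mu>) = of_real ((1 + x\<^sup>2) powr (- \<mu>))"
    using powr_of_real[of "1 + x\<^sup>2" "- \<mu>"] by simp
  moreover have "bessel_clifford \<nu> (of_real \<xi> * (complex_of_real x)\<^sup>2) = of_real (bessel_clifford \<nu> (\<xi> * x\<^sup>2))"
    using bessel_clifford_of_real[of \<nu> "\<xi> * x\<^sup>2"] by simp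
  ultimately show ?thesis unfolding profile_def by simp
qed

text \<open>
  Each of the three terms of the derivative belongs to the same family and decays at least as fast as
  the function itself, so induction works. Differentiation does not improve the decay, since the
  Bessel factor oscillates.
\<close>

lemma profile_derivs_bound:
  assumes \<xi>: "\<xi> > 0" and \<mu>: "\<mu> > 0"
  shows "\<exists>K\<ge>0. \<forall>x\<ge>1/2. cmod ((deriv ^^ N) (profile \<xi> a \<nu> \<mu>) (of_real x)) \<le> K * x powr (a - \<nu> - 1 / 2 - 2 * \<mu>)"
  using \<mu>
proof (induction N arbitrary: a \<nu> \<mu>)
  case 0
  obtain K where K: "K \<ge> 0" "\<And>y. y \<ge> 1/4 \<Longrightarrow> \<bar>bessel_clifford \<nu> (\<xi> * y)\<bar> \<le> K * y powr (- \<nu> / 2 - 1 / 4)"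
    using bessel_clifford_scaled_bound[of "1/4" \<xi> \<nu>] \<xi> by auto
  have "cmod (profile \<xi> a \<nu> \<mu> (of_real x)) \<le> K * x powr (a - \<nu> - 1 / 2 - 2 * \<mu>)" if "x \<ge> 1/2" for x
  proof -
    have x: "x > 0" using that by simp
    have "(1/2)\<^sup>2 \<le> x\<^sup>2" using that by (intro power_mono) auto
    then have x4: "x\<^sup>2 \<ge> 1/4" by (simp add: power_divide)
    have x2: "(x\<^sup>2) powr e = x powr (2 * e)" for e
      using x powr_powr[of x 2 e] by (simp add: powr_realpow)
    have "cmod (profile \<xi> a \<nu> \<mu> (of_real x)) = x powr a * \<bar>bessel_clifford \<nu> (\<xi> * x\<^sup>2)\<bar> * (1 + x\<^sup>2) powr (- \<mu>)"
      unfolding profile_of_real[OF x] norm_of_real by (simp add: abs_mult)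
    also have "\<dots> \<le> x powr a * (K * (x\<^sup>2) powr (- \<nu> / 2 - 1 / 4)) * (x\<^sup>2) powr (- \<mu>)"
      using 0 x K(1) by (intro mult_mono[OF mult_left_mono[OF K(2)[OF x4]]] powr_mono2') auto
    also have "\<dots> = K * (x powr a * x powr (2 * (- \<nu> / 2 - 1 / 4)) * x powr (2 * (- \<mu>)))"
      unfolding x2 by (simp only: mult_ac)
    also have "x powr a * x powr (2 * (- \<nu> / 2 - 1 / 4)) * x powr (2 * (- \<mu>)) = x powr (a - \<nu> - 1 / 2 - 2 * \<mu>)"
    proof -
      have "a + 2 * (- \<nu> / 2 - 1 / 4) + 2 * (- \<mu>) = a - \<nu> - 1 / 2 - 2 * \<mu>" by simp
      then show ?thesis by (simp only: powr_add[symmetric])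
    qed
    finally show ?thesis .
  qed
  with K(1) show ?case by auto
next
  case (Suc N)
  let ?e = "a - \<nu> - 1 / 2 - 2 * \<mu>"
  obtain K1 where K1: "K1 \<ge> 0" "\<And>x. x \<ge> 1/2 \<Longrightarrow> cmod ((deriv ^^ N) (profile \<xi> (a - 1) \<nu> \<mu>) (of_real x)) \<le> K1 * x powr (a - 1 - \<nu> - 1 / 2 - 2 * \<mu>)"
    using Suc.IH[OF Suc.prems, of "a - 1" \<nu>] by blast
  obtain K2 where K2: "K2 \<ge> 0" "\<And>x. x \<ge> 1/2 \<Longrightarrow> cmod ((deriv ^^ N) (profile \<xi> (a + 1) (\<nu> + 1) \<mu>) (of_real x)) \<le> K2 * x powr (a + 1 - (\<nu> + 1) - 1 / 2 - 2 * \<mu>)"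
    using Suc.IH[OF Suc.prems, of "a + 1" "\<nu> + 1"] by blast
  have "\<mu> + 1 > 0" using Suc.prems by simp
  then obtain K3 where K3: "K3 \<ge> 0" "\<And>x. x \<ge> 1/2 \<Longrightarrow> cmod ((deriv ^^ N) (profile \<xi> (a + 1) \<nu> (\<mu> + 1)) (of_real x)) \<le> K3 * x powr (a + 1 - \<nu> - 1 / 2 - 2 * (\<mu> + 1))"
    using Suc.IH[of "\<mu> + 1" "a + 1" \<nu>] by blast
  define K where "K = \<bar>a\<bar> * (2 * K1) + \<bar>2 * \<xi>\<bar> * K2 + \<bar>2 * \<mu>\<bar> * (2 * K3)"
  have "cmod ((deriv ^^ Suc N) (profile \<xi> a \<nu> \<mu>) (of_real x)) \<le> K * x powr ?e" if x: "x \<ge> 1/2" for x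
  proof -
    have x0: "x > 0" using x by simp
    have xr: "complex_of_real x \<in> rhp" using x0 by simp
    let ?p1 = "profile \<xi> (a - 1) \<nu> \<mu>" and ?p2 = "profile \<xi> (a + 1) (\<nu> + 1) \<mu>" and ?p3 = "profile \<xi> (a + 1) \<nu> (\<mu> + 1)"
    let ?d = "\<lambda>z. of_real a * ?p1 z - of_real (2 * \<xi>) * ?p2 z - of_real (2 * \<mu>) * ?p3 z"
    have h: "(\<lambda>z. c * profile \<xi> a' \<nu>' \<mu>' z) holomorphic_on rhp" for c a' \<nu>' \<mu>'
      by (intro holomorphic_on_mult holomorphic_on_const holomorphic_profile)
    have "(deriv ^^ Suc N) (profile \<xi> a \<nu> \<mu>) (of_real x) = (deriv ^^ N) (deriv (profile \<xi> a \<nu> \<mu>)) (of_real x)"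
      by (simp only: funpow_Suc_right o_apply)
    also have "\<dots> = (deriv ^^ N) ?d (of_real x)"
    proof (rule higher_deriv_transform_within_open[OF _ _ rhp_facts(1) xr])
      show "deriv (profile \<xi> a \<nu> \<mu>) holomorphic_on rhp" by (intro holomorphic_deriv holomorphic_profile rhp_facts)
      show "?d holomorphic_on rhp" by (intro holomorphic_on_diff h)
      show "deriv (profile \<xi> a \<nu> \<mu>) w = ?d w" if "w \<in> rhp" for w by (rule DERIV_imp_deriv[OF DERIV_profile[OF that]])
    qed
    also have "\<dots> = of_real a * (deriv ^^ N) ?p1 (of_real x) - of_real (2 * \<xi>) * (deriv ^^ N) ?p2 (of_real x) - of_real (2 * \<mu>) * (deriv ^^ N) ?p3 (of_real x)"
      by (simp only: higher_deriv_diff[OF holomorphic_on_diff[OF h h] h rhp_facts(1) xr] higher_deriv_diff[OF h h rhp_facts(1) xr]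
        higher_deriv_cmult[OF holomorphic_profile xr rhp_facts(1)])
    finally have e: "(deriv ^^ Suc N) (profile \<xi> a \<nu> \<mu>) (of_real x) = of_real a * (deriv ^^ N) ?p1 (of_real x) - of_real (2 * \<xi>) * (deriv ^^ N) ?p2 (of_real x) - of_real (2 * \<mu>) * (deriv ^^ N) ?p3 (of_real x)" .
    have dec: "x powr (e - 1) \<le> 2 * x powr e" for e
    proof -
      have "x powr (e - 1) = x powr e * (1 / x)" using x0 by (simp add: powr_diff)
      also have "\<dots> \<le> x powr e * 2" using x by (intro mult_left_mono) (auto simp: field_simps)
      finally show ?thesis by simp
    qed
    have 1: "cmod ((deriv ^^ N) ?p1 (of_real x)) \<le> 2 * K1 * x powr ?e"
    proof -
      have "a - 1 - \<nu> - 1 / 2 - 2 * \<mu> = ?e - 1" by simp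
      then have "cmod ((deriv ^^ N) ?p1 (of_real x)) \<le> K1 * x powr (?e - 1)" using K1(2)[OF x] by (simp only:)
      also have "\<dots> \<le> K1 * (2 * x powr ?e)" using K1(1) dec by (intro mult_left_mono)
      finally show ?thesis by simp
    qed
    have 2: "cmod ((deriv ^^ N) ?p2 (of_real x)) \<le> K2 * x powr ?e"
    proof -
      have "a + 1 - (\<nu> + 1) - 1 / 2 - 2 * \<mu> = ?e" by simp
      then show ?thesis using K2(2)[OF x] by (simp only:)
    qed
    have 3: "cmod ((deriv ^^ N) ?p3 (of_real x)) \<le> 2 * K3 * x powr ?e"
    proof -
      have "a + 1 - \<nu> - 1 / 2 - 2 * (\<mu> + 1) = ?e - 1" by simp
      then have "cmod ((deriv ^^ N) ?p3 (of_real x)) \<le> K3 * x powr (?e - 1)" using K3(2)[OF x] by (simp only:)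
      also have "\<dots> \<le> K3 * (2 * x powr ?e)" using K3(1) dec by (intro mult_left_mono)
      finally show ?thesis by simp
    qed
    have "cmod ((deriv ^^ Suc N) (profile \<xi> a \<nu> \<mu>) (of_real x))
       \<le> cmod (of_real a * (deriv ^^ N) ?p1 (of_real x)) + cmod (of_real (2 * \<xi>) * (deriv ^^ N) ?p2 (of_real x)) + cmod (of_real (2 * \<mu>) * (deriv ^^ N) ?p3 (of_real x))"
      unfolding e by (intro order.trans[OF norm_triangle_ineq4] add_mono norm_triangle_ineq4 order.refl)
    also have "\<dots> \<le> \<bar>a\<bar> * (2 * K1 * x powr ?e) + \<bar>2 * \<xi>\<bar> * (K2 * x powr ?e) + \<bar>2 * \<mu>\<bar> * (2 * K3 * x powr ?e)"
      unfolding norm_mult norm_of_real by (intro add_mono mult_left_mono 1 2 3) auto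
    also have "\<dots> = K * x powr ?e" unfolding K_def by (simp add: algebra_simps)
    finally show ?thesis .
  qed
  moreover have "K \<ge> 0" unfolding K_def using K1(1) K2(1) K3(1) by simp
  ultimately show ?case by blast
qed

lemma higher_deriv_of_chain:
  fixes R :: "nat \<Rightarrow> complex \<Rightarrow> complex"
  assumes S: "open S" and R: "\<And>i z. z \<in> S \<Longrightarrow> (R i has_field_derivative R (Suc i) z) (at z)" and z: "z \<in> S"
  shows "(deriv ^^ i) (R 0) z = R i z"
  using z
proof (induction i arbitrary: z)
  case (Suc i)
  have "eventually (\<lambda>w. w \<in> S) (nhds z)" using S Suc.prems by (rule eventually_nhds_in_open)
  then have "eventually (\<lambda>w. (deriv ^^ i) (R 0) w = R i w) (nhds z)"
    by eventually_elim (rule Suc.IH)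
  then have "deriv ((deriv ^^ i) (R 0)) z = deriv (R i) z" by (intro deriv_cong_ev refl)
  also have "\<dots> = R (Suc i) z" by (rule DERIV_imp_deriv[OF R[OF Suc.prems]])
  finally show ?case by simp
qed simp

lemma cmod_powr_of_real: "z \<noteq> 0 \<Longrightarrow> cmod (z powr of_real r) = cmod z powr r"
  by (simp add: norm_powr_complex)

lemma powr_le_on_disc:
  fixes t :: real
  assumes x: "x > 0" and t: "x / 2 \<le> t" "t \<le> 3 / 2 * x"
  shows "t powr r \<le> ((1/2) powr r + (3/2) powr r) * x powr r"
proof (cases "r \<ge> 0")
  case True
  then have "t powr r \<le> (3 / 2 * x) powr r" using x t by (intro powr_mono2) auto
  also have "\<dots> = (3/2) powr r * x powr r" using x by (intro powr_mult)
  also have "\<dots> \<le> ((1/2) powr r + (3/2) powr r) * x powr r" by (intro mult_right_mono) auto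
  finally show ?thesis .
next
  case False
  then have "t powr r \<le> (1 / 2 * x) powr r" using x t by (intro powr_mono2') auto
  also have "\<dots> = (1/2) powr r * x powr r" using x by (intro powr_mult)
  also have "\<dots> \<le> ((1/2) powr r + (3/2) powr r) * x powr r" by (intro mult_right_mono) auto
  finally show ?thesis .
qed

section \<open>The asymptotic expansion\<close>

lemma has_vector_derivative_LINT_Ici:
  fixes \<phi> :: "real \<Rightarrow> complex"
  assumes int: "\<And>A. A > 0 \<Longrightarrow> set_integrable lborel {A..} \<phi>" and cont: "continuous_on {0<..} \<phi>" and y: "y > 0"
  shows "((\<lambda>y. LINT x:{y..}|lborel. \<phi> x) has_vector_derivative - \<phi> y) (at y)"
proof -
  define A B where "A = y / 2" and "B = 2 * y"
  have AB: "0 < A" "A < y" "y < B" using y by (auto simp: A_def B_def)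
  have c: "continuous_on {A..B} \<phi>" by (rule continuous_on_subset[OF cont]) (use AB in auto)
  have "((\<lambda>u. integral {A..u} \<phi>) has_vector_derivative \<phi> y) (at y within {A..B})"
    using AB by (intro integral_has_vector_derivative[OF c]) auto
  then have "((\<lambda>u. integral {A..u} \<phi>) has_vector_derivative \<phi> y) (at y)"
  proof (subst (asm) at_within_interior)
    show "y \<in> interior {A..B}" using AB by simp
  qed
  from has_vector_derivative_diff[OF has_vector_derivative_const this]
  have "((\<lambda>u. (LINT x:{A..}|lborel. \<phi> x) - integral {A..u} \<phi>) has_vector_derivative - \<phi> y) (at y)" by (simp only: diff_0)
  then show ?thesis
  proof (rule has_vector_derivative_transform_within_open[of _ _ _ "{A<..}"])
    fix u assume "u \<in> {A<..}"
    then have u: "A \<le> u" by simp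
    have "set_integrable lborel {A..u} \<phi>" by (rule set_integrable_subset[OF int[OF AB(1)]]) auto
    from set_borel_integral_eq_integral(2)[OF this]
    show "(LINT x:{A..}|lborel. \<phi> x) - integral {A..u} \<phi> = (LINT x:{u..}|lborel. \<phi> x)"
      by (simp only: LINT_split_Ici[OF int[OF AB(1)] u] add_diff_cancel_left')
  qed (use AB in auto)
qed

lemma LINT_Ici_tendsto_0:
  fixes \<phi> :: "real \<Rightarrow> complex"
  assumes int: "set_integrable lborel {A..} \<phi>"
  shows "((\<lambda>y. LINT x:{y..}|lborel. \<phi> x) \<longlongrightarrow> 0) at_top"
proof -
  have "((\<lambda>y. LINT x:{A..y}|lborel. \<phi> x) \<longlongrightarrow> (LINT x:{A..}|lborel. \<phi> x)) at_top"
    by (rule tendsto_set_lebesgue_integral_at_top[OF _ int]) simp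
  from tendsto_diff[OF tendsto_const this, of "LINT x:{A..}|lborel. \<phi> x"]
  have "((\<lambda>y. (LINT x:{A..}|lborel. \<phi> x) - (LINT x:{A..y}|lborel. \<phi> x)) \<longlongrightarrow> 0) at_top" by (simp only: diff_self)
  then show ?thesis
  proof (rule Lim_transform_eventually)
    show "\<forall>\<^sub>F y in at_top. (LINT x:{A..}|lborel. \<phi> x) - (LINT x:{A..y}|lborel. \<phi> x) = (LINT x:{y..}|lborel. \<phi> x)"
      using eventually_ge_at_top[of A]
    proof eventually_elim
      case (elim y)
      show ?case by (simp only: LINT_split_Ici[OF int elim] add_diff_cancel_left')
    qed
  qed
qed

text \<open>
  The generalized Euler--Maclaurin formula for the summand. Its sequence \<open>G\<close> consists of a holomorphic
  primitive of the profile, normalized to vanish at infinity, followed by the derivatives of the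
  profile.
\<close>

lemma profile_asymptotics:
  fixes \<xi> \<mu> \<gamma> \<nu> :: real and I :: complex and K :: nat
  assumes \<xi>: "\<xi> > 0" and \<mu>: "\<mu> > 0" and c: "2 * \<mu> - \<gamma> > 1 / 2"
    and nz: "\<And>m::nat. \<gamma> + \<nu> \<noteq> - (2 * real m + 1)"
    and I: "\<And>A. 0 < A \<Longrightarrow> A < 1 \<Longrightarrow> I = mellin_fp \<mu> \<nu> \<xi> (of_real ((1 + \<gamma> + \<nu>) / 2)) A / 2"
  shows "\<exists>C. \<forall>h. 0 < h \<and> h \<le> 1 / 2 \<longrightarrow>
    (\<exists>s. (\<lambda>n. of_real h * profile \<xi> (\<gamma> + \<nu>) \<nu> \<mu> (of_real (real (Suc n) * h))) sums s \<and>
       cmod (s - I - (\<Sum>k<K. profile_coeff \<mu> \<nu> \<xi> k * of_real (h powr (\<gamma> + \<nu> + 2 * real k + 1)) * riemann_zeta (- of_real (\<gamma> + \<nu> + 2 * real k))))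
         \<le> C * h powr (\<gamma> + \<nu> + 2 * real K + 1))"
proof -
  define om where "om = \<gamma> + \<nu>"
  define \<epsilon> where "\<epsilon> = om + 2 * real K + 1"
  define \<sigma> where "\<sigma> = om - \<nu> - 1 / 2 - 2 * \<mu>"
  define q where "q = complex_of_real ((1 + om) / 2)"
  define f where "f = profile \<xi> om \<nu> \<mu>"
  define g where "g = profile_coeff \<mu> \<nu> \<xi>"
  define \<rho> where "\<rho> = (\<lambda>k. om + 2 * real k + 1)"
  have \<rho>0: "\<rho> k \<noteq> 0" for k using nz[of k] by (auto simp: \<rho>_def om_def)
  have \<sigma>: "\<sigma> < -1" using c by (simp add: \<sigma>_def om_def)
  obtain N :: nat where N: "N \<ge> 2" "\<epsilon> - real N < -1" "real N + \<sigma> \<ge> \<epsilon>"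
  proof -
    obtain n :: nat where "real n \<ge> \<bar>\<epsilon>\<bar> + \<bar>\<sigma>\<bar>" using real_arch_simple by blast
    then have "real (n + 2) \<ge> \<bar>\<epsilon>\<bar> + \<bar>\<sigma>\<bar> + 2" by simp
    then show ?thesis by (intro that[of "n + 2"]) (simp, linarith, linarith)
  qed
  \<comment> \<open>On the real axis the primitive is minus the tail integral, written in the variable \<open>x\<^sup>2\<close> of the Mellin
    transform; holomorphy comes from a primitive on the convex right half-plane, which differs from it
    by a constant.\<close>
  define \<phi> where "\<phi> = (\<lambda>x. of_real x powr (q - 1) * of_real ((1 + x) powr (- \<mu>)) * complex_of_real (bessel_clifford \<nu> (\<xi> * x)))"
  have q: "Re q < \<mu> + \<nu> / 2 + 1 / 4" using c by (simp add: q_def om_def field_simps)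
  have int: "set_integrable lborel {A..} \<phi>" if "A > 0" for A
    unfolding \<phi>_def by (rule mellin_integrable[OF that \<xi> \<mu> q])
  have c\<phi>: "continuous_on {0<..} \<phi>" unfolding \<phi>_def by (intro continuous_intros continuous_on_of_real_powr) auto
  define P where "P = (\<lambda>x. - (LINT y:{x\<^sup>2..}|lborel. \<phi> y) / 2)"
  have dP: "(P has_vector_derivative f (of_real x)) (at x)" if x: "x > 0" for x
  proof -
    have "((\<lambda>x. x\<^sup>2) has_vector_derivative 2 * x) (at x)"
      unfolding has_real_derivative_iff_has_vector_derivative[symmetric] by (auto intro!: derivative_eq_intros)
    from vector_diff_chain_at[OF this has_vector_derivative_LINT_Ici[OF int c\<phi>]] x
    have "((\<lambda>x. LINT y:{x\<^sup>2..}|lborel. \<phi> y) has_vector_derivative (2 * x) *\<^sub>R - \<phi> (x\<^sup>2)) (at x)" by (simp add: o_def)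
    from has_vector_derivative_divide[OF has_vector_derivative_minus[OF this], of 2]
    have "(P has_vector_derivative - ((2 * x) *\<^sub>R - \<phi> (x\<^sup>2)) / 2) (at x)" unfolding P_def .
    also have "- ((2 * x) *\<^sub>R - \<phi> (x\<^sup>2)) / 2 = of_real x * \<phi> (x\<^sup>2)" by (simp add: scaleR_conv_of_real)
    also have "\<dots> = f (of_real x)"
    proof -
      have "complex_of_real (x\<^sup>2) powr (q - 1) = of_real ((x\<^sup>2) powr ((om - 1) / 2))"
      proof -
        have e: "q - 1 = of_real ((om - 1) / 2)" by (simp add: q_def field_simps)
        show ?thesis unfolding e by (rule powr_of_real) simp
      qed
      also have "(x\<^sup>2) powr ((om - 1) / 2) = x powr om / x"
      proof -
        have "(x\<^sup>2) powr ((om - 1) / 2) = x powr (2 * ((om - 1) / 2))"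
          using x powr_powr[of x 2 "(om - 1) / 2"] by (simp add: powr_realpow)
        also have "2 * ((om - 1) / 2) = om - 1" by simp
        finally show ?thesis using x by (simp only: powr_diff powr_one)
      qed
      finally have "complex_of_real (x\<^sup>2) powr (q - 1) = of_real (x powr om / x)" .
      then show ?thesis unfolding \<phi>_def f_def profile_of_real[OF x] using x by simp
    qed
    finally show ?thesis .
  qed
  have limP: "(P \<longlongrightarrow> 0) at_top"
  proof -
    have "filterlim (\<lambda>x::real. x\<^sup>2) at_top at_top" by (intro filterlim_pow_at_top filterlim_ident) auto
    then have "((\<lambda>x. LINT y:{x\<^sup>2..}|lborel. \<phi> y) \<longlongrightarrow> 0) at_top"
      by (rule filterlim_compose[OF LINT_Ici_tendsto_0[OF int[OF zero_less_one]]])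
    then have "(P \<longlongrightarrow> - 0 / 2) at_top"
      unfolding P_def by (intro tendsto_divide tendsto_minus tendsto_const) auto
    then show ?thesis by simp
  qed
  have hf: "f holomorphic_on rhp" unfolding f_def by (rule holomorphic_profile)
  obtain F where F': "\<And>z. z \<in> rhp \<Longrightarrow> (F has_field_derivative f z) (at z within rhp)"
    using holomorphic_convex_primitive'[OF rhp_facts(2,1) hf] by blast
  have F: "(F has_field_derivative f z) (at z)" if "z \<in> rhp" for z
    using F'[OF that] unfolding at_within_open[OF that rhp_facts(1)] .
  obtain c0 where c0: "\<And>x. x > 0 \<Longrightarrow> F (of_real x) - P x = c0"
  proof -
    have d: "((\<lambda>x. F (of_real x) - P x) has_vector_derivative 0) (at x within {0<..})" if "x \<in> {0<..}" for x
    proof -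
      have x: "x > 0" "complex_of_real x \<in> rhp" using that by auto
      from has_vector_derivative_diff[OF has_vector_derivative_real_field[OF F[OF x(2)]] dP[OF x(1)]]
      show ?thesis by (simp add: has_vector_derivative_at_within)
    qed
    obtain c where "\<And>x. x \<in> {0<..} \<Longrightarrow> F (of_real x) - P x = c"
      by (rule has_vector_derivative_zero_constant[OF convex_real_interval(3) d]) blast+
    then show ?thesis by (intro that) simp
  qed
  define G where "G = (\<lambda>j z. case j of 0 \<Rightarrow> F z - c0 | Suc i \<Rightarrow> (deriv ^^ i) f z)"
  have G0: "G 0 (of_real x) = P x" if "x > 0" for x using c0[OF that] by (simp add: G_def algebra_simps)
  have G1: "G (Suc i) = (deriv ^^ i) f" for i by (simp add: G_def)
  have dG: "(G j has_field_derivative G (Suc j) z) (at z)" if z: "z \<in> rhp" for j z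
  proof (cases j)
    case 0
    have "((\<lambda>z. F z - c0) has_field_derivative f z - 0) (at z)" by (intro DERIV_diff F z DERIV_const)
    then show ?thesis unfolding 0 by (simp add: G_def)
  next
    case (Suc i)
    show ?thesis unfolding Suc G1 by (rule has_field_derivative_higher_deriv[OF hf rhp_facts(1) z])
  qed
  define r where "r = (\<lambda>j z. G j z - (\<Sum>k<K. g k * powr_jet (of_real (\<rho> k)) j z))"
  have dr: "(r j has_field_derivative r (Suc j) z) (at z)" if z: "z \<in> rhp" for j z
    unfolding r_def by (intro DERIV_diff dG z DERIV_sum DERIV_cmult DERIV_powr_jet rhp_not_nonpos)
  \<comment> \<open>Near the origin: the remainder of the profile is bounded by its Taylor series, and the remainders of its
    derivatives by Cauchy estimates on the disc around \<open>x\<close> of radius \<open>x / 2\<close>. The radius \<open>9/16\<close> is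
    \<open>(3/4)\<^sup>2\<close>, since such discs reach up to \<open>3 x / 2 \<le> 3/4\<close>.\<close>
  have h9: "0 < (9/16::real)" "9/16 < (1::real)" by auto
  obtain C0 where C0': "C0 \<ge> 0" "\<And>w. cmod w \<le> 9/16 \<Longrightarrow>
     cmod (bessel_clifford \<nu> (of_real \<xi> * w) * (1 + w) powr (- of_real \<mu>) - (\<Sum>k<K. profile_coeff \<mu> \<nu> \<xi> k * w ^ k)) \<le> C0 * cmod w ^ K"
    by (rule profile_coeff_tail_bound[OF h9 less_imp_le[OF \<xi>], of \<nu> \<mu> K]) (rule that)
  note C0 = C0'[folded g_def]
  have r1: "cmod (r 1 z) \<le> C0 * cmod z powr (om + 2 * real K)" if z: "z \<in> rhp" "cmod z \<le> 3/4" for z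
  proof -
    have z0: "z \<noteq> 0" using z by auto
    have pj: "powr_jet (of_real (\<rho> k)) 1 z = z powr of_real om * (z\<^sup>2) ^ k" for k
    proof -
      have "complex_of_real (\<rho> k) - 1 = of_real om + of_nat (2 * k)" by (simp add: \<rho>_def)
      then have "z powr (of_real (\<rho> k) - 1) = z powr of_real om * z powr of_nat (2 * k)" by (simp only: powr_add)
      also have "z powr of_nat (2 * k) = (z\<^sup>2) ^ k" unfolding powr_nat using z0 by (simp add: power_mult)
      finally show ?thesis using powr_jet_1[of "of_real (\<rho> k)" z] \<rho>0[of k] by simp
    qed
    have "(\<Sum>k<K. g k * powr_jet (of_real (\<rho> k)) 1 z) = z powr of_real om * (\<Sum>k<K. g k * (z\<^sup>2) ^ k)"
      unfolding pj sum_distrib_left by (intro sum.cong refl) (simp only: mult_ac)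
    moreover have "G 1 z = z powr of_real om * (bessel_clifford \<nu> (of_real \<xi> * z\<^sup>2) * (1 + z\<^sup>2) powr (- of_real \<mu>))"
      unfolding One_nat_def G1 by (simp add: f_def profile_def)
    ultimately have "r 1 z = z powr of_real om * (bessel_clifford \<nu> (of_real \<xi> * z\<^sup>2) * (1 + z\<^sup>2) powr (- of_real \<mu>) - (\<Sum>k<K. g k * (z\<^sup>2) ^ k))"
      unfolding r_def by (simp only: right_diff_distrib)
    then have "cmod (r 1 z) = cmod z powr om * cmod (bessel_clifford \<nu> (of_real \<xi> * z\<^sup>2) * (1 + z\<^sup>2) powr (- of_real \<mu>) - (\<Sum>k<K. g k * (z\<^sup>2) ^ k))"
      by (simp only: norm_mult cmod_powr_of_real[OF z0])
    also have "\<dots> \<le> cmod z powr om * (C0 * cmod (z\<^sup>2) ^ K)"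
    proof (intro mult_left_mono C0(2))
      have "cmod z ^ 2 \<le> (3/4) ^ 2" using z by (intro power_mono) auto
      then show "cmod (z\<^sup>2) \<le> 9/16" by (simp add: norm_power power_divide)
    qed simp
    also have "cmod (z\<^sup>2) ^ K = cmod z powr (2 * real K)"
    proof -
      have "cmod (z\<^sup>2) ^ K = cmod z ^ (2 * K)" by (simp only: norm_power power_mult)
      also have "\<dots> = cmod z powr real (2 * K)" using z0 by (intro powr_realpow[symmetric]) simp
      finally show ?thesis by simp
    qed
    also have "cmod z powr om * (C0 * cmod z powr (2 * real K)) = C0 * cmod z powr (om + 2 * real K)"
      by (simp only: powr_add mult_ac)
    finally show ?thesis .
  qed
  define D where "D = C0 * ((1/2) powr (om + 2 * real K) + (3/2) powr (om + 2 * real K))"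
  have D: "D \<ge> 0" using C0(1) by (simp add: D_def)
  have rs: "cmod (r (Suc i) (of_real x)) \<le> fact i * 2 ^ i * D * x powr (\<epsilon> - real (Suc i))" if x: "0 < x" "x \<le> 1/2" for i x
  proof -
    have xr: "complex_of_real x \<in> rhp" using x by simp
    have sub: "cball (complex_of_real x) (x / 2) \<subseteq> rhp"
    proof
      fix z assume "z \<in> cball (complex_of_real x) (x / 2)"
      then have "cmod (of_real x - z) \<le> x / 2" by (simp add: dist_norm)
      then have "\<bar>Re (of_real x - z)\<bar> \<le> x / 2" using abs_Re_le_cmod order.trans by blast
      then have "\<bar>x - Re z\<bar> \<le> x / 2" by simp
      then have "x / 2 \<le> Re z" by linarith
      then show "z \<in> rhp" using x by simp
    qed
    have hr: "r 1 holomorphic_on rhp" unfolding holomorphic_on_open[OF rhp_facts(1)] using dr by blast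
    have "(deriv ^^ i) (r (Suc 0)) (of_real x) = r (Suc i) (of_real x)"
      using higher_deriv_of_chain[of rhp "\<lambda>i. r (Suc i)" "of_real x" i] rhp_facts(1) dr xr by blast
    then have "cmod (r (Suc i) (of_real x)) = cmod ((deriv ^^ i) (r 1) (of_real x))" by simp
    also have "\<dots> \<le> fact i * (D * x powr (om + 2 * real K)) / (x / 2) ^ i"
    proof (rule Cauchy_inequality)
      show "r 1 holomorphic_on ball (of_real x) (x / 2)"
        using hr by (rule holomorphic_on_subset) (use sub ball_subset_cball in blast)
      show "continuous_on (cball (of_real x) (x / 2)) (r 1)"
        by (rule holomorphic_on_imp_continuous_on[OF holomorphic_on_subset[OF hr sub]])
      show "x / 2 > 0" using x by simp
      fix z assume z: "cmod (of_real x - z) = x / 2"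
      then have "z \<in> cball (complex_of_real x) (x / 2)" by (simp add: dist_norm)
      then have zr: "z \<in> rhp" using sub by blast
      have "cmod z \<le> cmod (of_real x) + cmod (of_real x - z)"
        using norm_triangle_ineq4[of "of_real x" "of_real x - z"] by simp
      then have z1: "cmod z \<le> 3 / 2 * x" using x z by simp
      have "cmod (of_real x) \<le> cmod z + cmod (of_real x - z)"
        using norm_triangle_ineq[of z "of_real x - z"] by simp
      then have z2: "x / 2 \<le> cmod z" using x z by simp
      have "cmod (r 1 z) \<le> C0 * cmod z powr (om + 2 * real K)"
        using z1 x by (intro r1 zr) auto
      also have "\<dots> \<le> C0 * (((1/2) powr (om + 2 * real K) + (3/2) powr (om + 2 * real K)) * x powr (om + 2 * real K))"
        by (intro mult_left_mono powr_le_on_disc x z1 z2 C0)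
      finally show "cmod (r 1 z) \<le> D * x powr (om + 2 * real K)" by (simp add: D_def mult.assoc)
    qed
    also have "\<dots> = fact i * 2 ^ i * D * (x powr (om + 2 * real K) / x ^ i)" by (simp add: power_divide)
    also have "x powr (om + 2 * real K) / x ^ i = x powr (\<epsilon> - real (Suc i))"
    proof -
      have "\<epsilon> - real (Suc i) = (om + 2 * real K) - real i" by (simp add: \<epsilon>_def)
      then show ?thesis using x by (simp only: powr_diff powr_realpow)
    qed
    finally show ?thesis .
  qed
  \<comment> \<open>The primitive near the origin: choosing \<open>A = x\<^sup>2\<close> in the finite part \<open>I\<close> identifies it as \<open>-I\<close> plus
    the termwise integrated series.\<close>
  define E where "E = (\<Sum>k. cmod (g (k + K)) * (1/4) ^ k / \<bar>\<rho> (k + K)\<bar>)"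
  have qn: "q \<notin> \<int>\<^sub>\<le>\<^sub>0"
  proof
    assume "q \<in> \<int>\<^sub>\<le>\<^sub>0"
    then have "(1 + om) / 2 \<in> \<int>\<^sub>\<le>\<^sub>0" unfolding q_def of_real_in_nonpos_Ints_iff .
    then obtain m where "(1 + om) / 2 = - of_nat m" by (rule nonpos_Ints_cases')
    then have "\<gamma> + \<nu> = - (2 * real m + 1)" by (simp add: om_def field_simps)
    with nz show False by blast
  qed
  have qk: "q + of_nat k = of_real (\<rho> k / 2)" for k by (simp add: q_def \<rho>_def field_simps)
  obtain \<delta> where \<delta>: "\<delta> > 0" "\<And>m::nat. cmod (q + of_nat m) \<ge> \<delta>" using nonpos_Ints_dist[OF qn] by blast
  have \<rho>\<delta>: "\<bar>\<rho> k\<bar> \<ge> 2 * \<delta>" for k using \<delta>(2)[of k] unfolding qk norm_of_real by simp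
  have sg: "summable (\<lambda>k. cmod (g (k + K)) * (1/4) ^ k)"
  proof -
    have "summable (\<lambda>k. cmod (g (k + K)) * (1/4) ^ (k + K))"
      using summable_ignore_initial_segment[OF summable_profile_coeff[of "1/4" \<xi> \<mu> \<nu>], of K] \<xi> unfolding g_def by simp
    from summable_mult2[OF this, of "4 ^ K"] show ?thesis by (simp add: power_add power_one_over)
  qed
  have sE: "summable (\<lambda>k. cmod (g (k + K)) * (1/4) ^ k / \<bar>\<rho> (k + K)\<bar>)"
  proof (rule summable_comparison_test'[OF summable_divide[OF sg, of "2 * \<delta>"], of 0])
    fix k
    have "\<bar>\<rho> (k + K)\<bar> > 0" using \<rho>0[of "k + K"] by simp
    then have "cmod (g (k + K)) * (1/4) ^ k / \<bar>\<rho> (k + K)\<bar> \<le> cmod (g (k + K)) * (1/4) ^ k / (2 * \<delta>)"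
      using \<rho>\<delta>[of "k + K"] \<delta>(1) by (intro divide_left_mono mult_pos_pos) auto
    then show "norm (cmod (g (k + K)) * (1/4) ^ k / \<bar>\<rho> (k + K)\<bar>) \<le> cmod (g (k + K)) * (1/4) ^ k / (2 * \<delta>)" by simp
  qed
  have E0: "E \<ge> 0" unfolding E_def by (intro suminf_nonneg sE) auto
  have r0: "cmod (r 0 (of_real x) + I) \<le> E * x powr \<epsilon>" if x: "0 < x" "x \<le> 1/2" for x
  proof -
    have "x\<^sup>2 \<le> (1/2)\<^sup>2" using x by (intro power_mono) auto
    then have x4: "0 < x\<^sup>2" "x\<^sup>2 \<le> 1/4" using x by (auto simp: power_divide)
    have tm: "g k * of_real (x\<^sup>2) powr (q + of_nat k) / (q + of_nat k) / 2 = g k * of_real (x powr \<rho> k / \<rho> k)" for k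
    proof -
      have "complex_of_real (x\<^sup>2) powr (q + of_nat k) = of_real ((x\<^sup>2) powr (\<rho> k / 2))"
        unfolding qk using powr_of_real[of "x\<^sup>2" "\<rho> k / 2"] by simp
      also have "(x\<^sup>2) powr (\<rho> k / 2) = x powr \<rho> k" using x powr_powr[of x 2 "\<rho> k / 2"] by (simp add: powr_realpow)
      finally show ?thesis unfolding qk by simp
    qed
    have "(\<lambda>k. g k * of_real (x\<^sup>2) powr (q + of_nat k) / (q + of_nat k)) sums finite_part g q (x\<^sup>2)"
      unfolding g_def using x4 \<xi> by (intro finite_part_sums qn summable_profile_coeff) auto
    from sums_divide[OF this, of 2]
    have s: "(\<lambda>k. g k * of_real (x powr \<rho> k / \<rho> k)) sums (finite_part g q (x\<^sup>2) / 2)" unfolding tm .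
    have "I = - P x + finite_part g q (x\<^sup>2) / 2"
      using I[of "x\<^sup>2"] x4 unfolding mellin_fp_def P_def g_def q_def \<phi>_def om_def by (simp add: add_divide_distrib add.assoc)
    moreover have "r 0 (of_real x) = P x - (\<Sum>k<K. g k * of_real (x powr \<rho> k / \<rho> k))"
      unfolding r_def G0[OF x(1)] powr_jet_def using x powr_of_real[of x "\<rho> _"] by simp
    ultimately have "r 0 (of_real x) + I = finite_part g q (x\<^sup>2) / 2 - (\<Sum>k<K. g k * of_real (x powr \<rho> k / \<rho> k))" by simp
    then have s2: "(\<lambda>k. g (k + K) * of_real (x powr \<rho> (k + K) / \<rho> (k + K))) sums (r 0 (of_real x) + I)"
      using sums_split_initial_segment[OF s, of K] by simp
    have le: "cmod (g (k + K) * of_real (x powr \<rho> (k + K) / \<rho> (k + K))) \<le> x powr \<epsilon> * (cmod (g (k + K)) * (1/4) ^ k / \<bar>\<rho> (k + K)\<bar>)" for k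
    proof -
      have "x powr \<rho> (k + K) = x powr \<epsilon> * (x\<^sup>2) ^ k"
      proof -
        have "\<rho> (k + K) = \<epsilon> + real (2 * k)" by (simp add: \<rho>_def \<epsilon>_def)
        then show ?thesis using x by (simp only: powr_add powr_realpow power_mult)
      qed
      then have "cmod (g (k + K) * of_real (x powr \<rho> (k + K) / \<rho> (k + K))) = x powr \<epsilon> * (cmod (g (k + K)) * (x\<^sup>2) ^ k / \<bar>\<rho> (k + K)\<bar>)"
        unfolding norm_mult norm_of_real by (simp add: abs_mult)
      also have "\<dots> \<le> x powr \<epsilon> * (cmod (g (k + K)) * (1/4) ^ k / \<bar>\<rho> (k + K)\<bar>)"
        using x4 by (intro mult_left_mono divide_right_mono power_mono) auto
      finally show ?thesis .
    qed
    have sm: "summable (\<lambda>k. x powr \<epsilon> * (cmod (g (k + K)) * (1/4) ^ k / \<bar>\<rho> (k + K)\<bar>))" by (rule summable_mult[OF sE])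
    have sn: "summable (\<lambda>k. cmod (g (k + K) * of_real (x powr \<rho> (k + K) / \<rho> (k + K))))"
      by (rule summable_comparison_test'[OF sm, of 0]) (use le in simp)
    have "cmod (r 0 (of_real x) + I) \<le> (\<Sum>k. cmod (g (k + K) * of_real (x powr \<rho> (k + K) / \<rho> (k + K))))"
      unfolding sums_unique[OF s2] by (rule summable_norm[OF sn])
    also have "\<dots> \<le> (\<Sum>k. x powr \<epsilon> * (cmod (g (k + K)) * (1/4) ^ k / \<bar>\<rho> (k + K)\<bar>))" by (rule suminf_le[OF le sn sm])
    also have "\<dots> = E * x powr \<epsilon>" unfolding E_def suminf_mult[OF sE] by (rule mult.commute)
    finally show ?thesis .
  qed
  \<comment> \<open>Bounds on \<open>x \<ge> 1/2\<close>, where the subtracted powers are all dominated by the first omitted one.\<close>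
  have Gb: "\<exists>L\<ge>0. \<forall>x\<ge>1/2. cmod (G (Suc i) (of_real x)) \<le> L * x powr \<sigma>" for i
    using profile_derivs_bound[OF \<xi> \<mu>, of i om \<nu>] unfolding G1 f_def \<sigma>_def .
  obtain N' where N': "N = Suc N'" using N(1) by (cases N) auto
  obtain L where L: "L \<ge> 0" "\<And>x. x \<ge> 1/2 \<Longrightarrow> cmod (G N (of_real x)) \<le> L * x powr \<sigma>" using Gb[of N'] unfolding N' by blast
  define Q where "Q = (\<Sum>k<K. cmod (g k) * cmod ((\<Prod>i<N. of_real (\<rho> k) - of_nat i) / of_real (\<rho> k)) * 4 ^ K)"
  have Q: "Q \<ge> 0" unfolding Q_def by (intro sum_nonneg) auto
  define C1 where "C1 = E + fact N * 2 ^ N * D + L + Q"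
  have C1: "C1 \<ge> 0" "E \<le> C1" "fact N * 2 ^ N * D \<le> C1" "L \<le> C1" "Q \<le> C1"
    using E0 D L(1) Q by (simp_all add: C1_def)
  have fN: "fact i * 2 ^ i * D \<le> C1" if "i \<le> N" for i
  proof -
    have "fact i * (2::real) ^ i \<le> fact N * 2 ^ N" using that by (intro mult_mono fact_mono power_increasing) auto
    then have "fact i * 2 ^ i * D \<le> fact N * 2 ^ N * D" using D by (rule mult_right_mono)
    then show ?thesis using C1(3) by linarith
  qed
  have "\<exists>C. \<forall>h. 0 < h \<and> h \<le> 1 / 2 \<longrightarrow>
    (\<exists>s. (\<lambda>n. of_real h * G 1 (of_real (real (Suc n) * h))) sums s \<and>
       cmod (s - I - (\<Sum>k<K. g k * of_real (h powr (om + 2 * real k + 1)) * riemann_zeta (- of_real (om + 2 * real k))))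
         \<le> C * h powr (om + 2 * real K + 1))"
  proof (rule generalized_euler_maclaurin[where N = N and \<sigma> = \<sigma> and ?C1.0 = C1])
    show "N \<ge> 2" "om + 2 * real K + 1 - real N < - 1" "om + 2 * real K + 1 \<le> real N + \<sigma>" "\<sigma> < -1"
      using N \<sigma> by (auto simp: \<epsilon>_def)
    show "om + 2 * real k + 1 \<noteq> 0" for k using \<rho>0[of k] by (simp add: \<rho>_def)
    show "(G j has_field_derivative G (Suc j) (of_real t)) (at (of_real t))" if "t > 0" for j t
      using that by (intro dG) simp
    show "((\<lambda>x::real. G j (of_real x)) \<longlongrightarrow> 0) at_top" for j
    proof (cases j)
      case 0
      from limP show ?thesis
      proof (rule Lim_transform_eventually)
        show "\<forall>\<^sub>F x in at_top. P x = G j (of_real x)"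
          using eventually_gt_at_top[of 0] by eventually_elim (simp add: 0 G0)
      qed
    next
      case (Suc i)
      obtain L' where L': "L' \<ge> 0" "\<And>x. x \<ge> 1/2 \<Longrightarrow> cmod (G (Suc i) (of_real x)) \<le> L' * x powr \<sigma>" using Gb[of i] by blast
      show ?thesis unfolding Suc
      proof (rule Lim_null_comparison)
        show "((\<lambda>x. L' * x powr \<sigma>) \<longlongrightarrow> 0) at_top"
          using \<sigma> by (intro tendsto_mult_right_zero tendsto_neg_powr filterlim_ident) simp
        show "\<forall>\<^sub>F x in at_top. norm (G (Suc i) (of_real x)) \<le> L' * x powr \<sigma>"
          using eventually_ge_at_top[of "1/2"] by eventually_elim (rule L'(2))
      qed
    qed
    show "C1 \<ge> 0" by (rule C1(1))
  next
    fix j :: nat and x :: real assume j: "1 \<le> j" "j < N" and x: "0 < x" "x \<le> 1 / 2"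
    obtain i where i: "j = Suc i" using j by (cases j) auto
    have "cmod (r j (of_real x)) \<le> fact i * 2 ^ i * D * x powr (\<epsilon> - real j)" unfolding i by (rule rs[OF x])
    also have "\<dots> \<le> C1 * x powr (\<epsilon> - real j)" using i j by (intro mult_right_mono fN) auto
    finally show "cmod (G j (of_real x) - (\<Sum>k<K. g k * powr_jet (of_real (om + 2 * real k + 1)) j (of_real x))) \<le> C1 * x powr (om + 2 * real K + 1 - real j)"
      unfolding r_def \<rho>_def \<epsilon>_def .
  next
    fix x :: real assume x: "0 < x" "x \<le> 1 / 2"
    have "cmod (r 0 (of_real x) + I) \<le> E * x powr \<epsilon>" by (rule r0[OF x])
    also have "\<dots> \<le> C1 * x powr \<epsilon>" by (intro mult_right_mono C1) auto
    finally show "cmod (G 0 (of_real x) - (\<Sum>k<K. g k * powr_jet (of_real (om + 2 * real k + 1)) 0 (of_real x)) + I) \<le> C1 * x powr (om + 2 * real K + 1)"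
      unfolding r_def \<rho>_def \<epsilon>_def .
  next
    fix x :: real assume x: "0 < x"
    have "cmod (r N (of_real x)) \<le> C1 * (x powr (\<epsilon> - real N) + x powr \<sigma>)"
    proof (cases "x \<le> 1/2")
      case True
      have "cmod (r N (of_real x)) \<le> fact N' * 2 ^ N' * D * x powr (\<epsilon> - real N)" unfolding N' by (rule rs[OF x True])
      also have "\<dots> \<le> C1 * x powr (\<epsilon> - real N)" using N' by (intro mult_right_mono fN) auto
      also have "\<dots> \<le> C1 * (x powr (\<epsilon> - real N) + x powr \<sigma>)" using C1(1) by (intro mult_left_mono) auto
      finally show ?thesis .
    next
      case False
      then have x2: "x \<ge> 1/2" by simp
      have pj: "cmod (g k * powr_jet (of_real (\<rho> k)) N (of_real x))
         \<le> cmod (g k) * cmod ((\<Prod>i<N. of_real (\<rho> k) - of_nat i) / of_real (\<rho> k)) * 4 ^ K * x powr (\<epsilon> - real N)" if k: "k < K" for k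
      proof -
        have "x powr (\<rho> k - real N) \<le> 4 ^ K * x powr (\<epsilon> - real N)"
        proof -
          have e: "\<epsilon> - real N = (\<rho> k - real N) + real (2 * (K - k))" using k by (simp add: \<epsilon>_def \<rho>_def of_nat_diff)
          have "(1::real) \<le> 4 ^ k * (4 * x\<^sup>2) ^ (K - k)"
          proof -
            have "(1/2)\<^sup>2 \<le> x\<^sup>2" using x2 by (intro power_mono) auto
            then have "1 \<le> (4 * x\<^sup>2) ^ (K - k)" by (intro one_le_power) (simp add: power_divide)
            then have "1 * 1 \<le> 4 ^ k * (4 * x\<^sup>2) ^ (K - k)" by (intro mult_mono) auto
            then show ?thesis by simp
          qed
          also have "4 ^ k * (4 * x\<^sup>2) ^ (K - k) = 4 ^ K * (x\<^sup>2) ^ (K - k)"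
            using k by (simp add: power_mult_distrib flip: mult.assoc power_add)
          finally have "x powr (\<rho> k - real N) * 1 \<le> x powr (\<rho> k - real N) * (4 ^ K * (x\<^sup>2) ^ (K - k))"
            by (intro mult_left_mono) auto
          also have "\<dots> = 4 ^ K * x powr (\<epsilon> - real N)"
          proof -
            have "(x\<^sup>2) ^ (K - k) = x powr real (2 * (K - k))" using x by (simp only: powr_realpow power_mult)
            then show ?thesis unfolding e powr_add by simp
          qed
          finally show ?thesis by simp
        qed
        then have "cmod (g k) * (cmod ((\<Prod>i<N. of_real (\<rho> k) - of_nat i) / of_real (\<rho> k)) * x powr (\<rho> k - real N))
           \<le> cmod (g k) * (cmod ((\<Prod>i<N. of_real (\<rho> k) - of_nat i) / of_real (\<rho> k)) * (4 ^ K * x powr (\<epsilon> - real N)))"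
          by (intro mult_left_mono) auto
        then show ?thesis unfolding norm_mult norm_powr_jet[OF x] Re_complex_of_real by (simp only: mult.assoc)
      qed
      have "cmod (r N (of_real x)) \<le> cmod (G N (of_real x)) + (\<Sum>k<K. cmod (g k * powr_jet (of_real (\<rho> k)) N (of_real x)))"
        unfolding r_def by (intro order.trans[OF norm_triangle_ineq4] add_left_mono norm_sum)
      also have "\<dots> \<le> L * x powr \<sigma> + (\<Sum>k<K. cmod (g k) * cmod ((\<Prod>i<N. of_real (\<rho> k) - of_nat i) / of_real (\<rho> k)) * 4 ^ K * x powr (\<epsilon> - real N))"
        by (intro add_mono L x2 sum_mono pj) auto
      also have "\<dots> = L * x powr \<sigma> + Q * x powr (\<epsilon> - real N)" unfolding Q_def sum_distrib_right ..
      also have "\<dots> \<le> C1 * x powr \<sigma> + C1 * x powr (\<epsilon> - real N)" by (intro add_mono mult_right_mono C1) auto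
      finally show ?thesis by (simp add: algebra_simps)
    qed
    then show "cmod (G N (of_real x) - (\<Sum>k<K. g k * powr_jet (of_real (om + 2 * real k + 1)) N (of_real x))) \<le> C1 * (x powr (om + 2 * real K + 1 - real N) + x powr \<sigma>)"
      unfolding r_def \<rho>_def \<epsilon>_def .
  qed
  then show ?thesis unfolding One_nat_def G1 f_def g_def om_def funpow_0 .
qed

text \<open>
  The formula that defines the quotient at negative integers \<open>\<nu>\<close> holds for all \<open>\<nu>\<close>.
\<close>

lemma F_over_Gamma_eq:
  "F_over_Gamma \<mu> \<nu> k \<xi> = (\<Sum>j\<le>k. pochhammer (- real k) j * rGamma (1 + \<nu> + real j)
              / pochhammer (1 - \<mu> - real k) j * (\<xi> ^ j / fact j))"
proof (cases "1 + \<nu> \<in> \<int>\<^sub>\<le>\<^sub>0")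
  case False
  have "F_poly \<mu> \<nu> k \<xi> / Gamma (1 + \<nu>) = F_poly \<mu> \<nu> k \<xi> * rGamma (1 + \<nu>)"
    by (simp add: rGamma_inverse_Gamma divide_inverse)
  also have "\<dots> = (\<Sum>j\<le>k. pochhammer (- real k) j * rGamma (1 + \<nu> + real j)
              / pochhammer (1 - \<mu> - real k) j * (\<xi> ^ j / fact j))"
    unfolding F_poly_def sum_distrib_right
  proof (intro sum.cong refl)
    fix j assume "j \<in> {..k}"
    have "pochhammer (1 + \<nu>) j \<noteq> 0" using False by (auto simp: pochhammer_eq_0_iff)
    moreover have "rGamma (1 + \<nu>) = pochhammer (1 + \<nu>) j * rGamma (1 + \<nu> + real j)" by (rule pochhammer_rGamma)
    ultimately show "pochhammer (- real k) j / (pochhammer (1 - \<mu> - real k) j * pochhammer (1 + \<nu>) j) * (\<xi> ^ j / fact j) * rGamma (1 + \<nu>)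
      = pochhammer (- real k) j * rGamma (1 + \<nu> + real j) / pochhammer (1 - \<mu> - real k) j * (\<xi> ^ j / fact j)"
      by simp
  qed
  finally show ?thesis using False by (simp add: F_over_Gamma_def)
qed (simp add: F_over_Gamma_def)

text \<open>
  Both sides are sums over \<open>j \<le> k\<close> of the same terms, after \<open>(-k)\<^sub>j\<close> and \<open>(1 - \<mu> - k)\<^sub>j\<close> are reversed
  into \<open>k!/(k - j)!\<close> and \<open>(\<mu>)\<^sub>k / (\<mu>)\<^bsub>k-j\<^esub>\<close>; the signs of the two reversals cancel.
\<close>

lemma profile_coeff_eq_F_over_Gamma:
  assumes \<mu>: "\<mu> > 0"
  shows "profile_coeff \<mu> \<nu> \<xi> k = of_real ((-1) ^ k / fact k * pochhammer \<mu> k * F_over_Gamma \<mu> \<nu> k \<xi>)"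
proof -
  have "(-1) ^ k / fact k * pochhammer \<mu> k * F_over_Gamma \<mu> \<nu> k \<xi>
     = (\<Sum>j\<le>k. bcoef \<nu> j * \<xi> ^ j * ((-1) ^ (k - j) * pochhammer \<mu> (k - j) / fact (k - j)))"
    unfolding F_over_Gamma_eq sum_distrib_left
  proof (intro sum.cong refl)
    fix j assume "j \<in> {..k}"
    then have j: "j \<le> k" by simp
    have kj: "real (k - j) = real k - real j" using j by (simp add: of_nat_diff)
    have kk: "k - (k - j) = j" using j by simp
    have 1: "pochhammer (- real k) j = (-1) ^ j * (fact k / fact (k - j))"
    proof -
      have "fact k = (fact (k - j) :: real) * pochhammer (1 + real (k - j)) j"
        using pochhammer_product[of "k - j" k "1::real"] unfolding pochhammer_fact[symmetric] kk by simp
      then have "pochhammer (real k - real j + 1) j = (fact k / fact (k - j) :: real)"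
        unfolding kj by (simp add: add.commute)
      then show ?thesis unfolding pochhammer_minus[of "real k" j] by simp
    qed
    have p0: "pochhammer (\<mu> + real (k - j)) j > 0" using \<mu> by (intro pochhammer_pos) simp
    have 2: "pochhammer (1 - \<mu> - real k) j = (-1) ^ j * pochhammer (\<mu> + real (k - j)) j"
    proof -
      have e: "1 - \<mu> - real k = - (\<mu> + real k - 1)" by simp
      have e': "\<mu> + real k - 1 - of_nat j + 1 = \<mu> + real (k - j)" unfolding kj by simp
      show ?thesis unfolding e by (rule pochhammer_minus[of "\<mu> + real k - 1" j, unfolded e'])
    qed
    have 3: "pochhammer \<mu> k = pochhammer \<mu> (k - j) * pochhammer (\<mu> + real (k - j)) j"
      using pochhammer_product[of "k - j" k \<mu>] unfolding kk by simp
    have s: "(-1::real) ^ k = (-1) ^ j * (-1) ^ (k - j)" unfolding power_add[symmetric] using j by simp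
    have q: "1 + \<nu> + real j = \<nu> + 1 + real j" by simp
    have alg: "s1 * s2 / F * (m * p) * (s1 * (F / D) * r / (s1 * p) * (x / J)) = s1 * r / J * x * (s2 * m / D)"
      if "s1 \<noteq> 0" "F \<noteq> 0" "p \<noteq> 0" for s1 s2 F m p D r x J :: real
      using that by (simp add: mult_ac)
    show "(-1) ^ k / fact k * pochhammer \<mu> k * (pochhammer (- real k) j * rGamma (1 + \<nu> + real j) / pochhammer (1 - \<mu> - real k) j * (\<xi> ^ j / fact j))
      = bcoef \<nu> j * \<xi> ^ j * ((-1) ^ (k - j) * pochhammer \<mu> (k - j) / fact (k - j))"
      unfolding s 1 2 3 q bcoef_def by (rule alg) (use p0 in simp_all)
  qed
  then show ?thesis unfolding profile_coeff_def scaled_bcoef_def neg_binomial_pochhammer by simp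
qed

text \<open>
  The terms of \<open>S\<^sub>\<nu>\<close> are the values of the profile at \<open>n/a\<close> times \<open>a powr (\<gamma> - 2 \<mu>) (b/2)\<^sup>\<nu>\<close>, so the
  claim is the expansion of the profile sum with \<open>h = 1/a\<close>, multiplied by \<open>w = a powr (\<gamma> - 2 \<mu> + 1) (b/2)\<^sup>\<nu>\<close>.
\<close>

theorem theorem1:
  fixes b \<mu> \<gamma> \<nu> :: real
  assumes "b > 0" and "\<mu> > 0"
    and "2 * \<mu> - \<gamma> > 1 / 2"
    and "\<forall>m::nat. \<gamma> + \<nu> \<noteq> - (2 * real m + 1)"
  shows "\<forall>K::nat.
    (\<lambda>a::real.
        complex_of_real (S_sum \<mu> \<gamma> \<nu> a b)
        - complex_of_real (a powr (\<gamma> - 2 * \<mu> + 1)) * H_fun b \<mu> \<gamma> \<nu> 1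
        - complex_of_real (a powr (- \<nu> - 2 * \<mu>) * (b / 2) powr \<nu>) *
          (\<Sum>k<K. (-1) ^ k / fact k
             * complex_of_real (pochhammer \<mu> k)
             * riemann_zeta (- complex_of_real (\<gamma> + \<nu> + 2 * real k))
             * complex_of_real (F_over_Gamma \<mu> \<nu> k (b\<^sup>2 / 4))
             * complex_of_real (a powr (- 2 * real k))))
    \<in> O[at_top](\<lambda>a. complex_of_real (a powr (- \<nu> - 2 * \<mu> - 2 * real K)))"
proof
  fix K :: nat
  define \<xi> where "\<xi> = b\<^sup>2 / 4"
  define c where "c = (b / 2) powr \<nu>"
  define H where "H = H_fun b \<mu> \<gamma> \<nu> 1"
  define I where "I = H / of_real c"
  define Z where "Z = (\<lambda>k. riemann_zeta (- of_real (\<gamma> + \<nu> + 2 * real k)))"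
  have \<xi>: "\<xi> > 0" using assms(1) by (simp add: \<xi>_def)
  have c: "c > 0" using assms(1) by (simp add: c_def)
  have I: "I = mellin_fp \<mu> \<nu> \<xi> (of_real ((1 + \<gamma> + \<nu>) / 2)) A / 2" if "0 < A" "A < 1" for A
    unfolding I_def H_def H_fun_eq_mellin_fp[OF that assms] \<xi>_def c_def[symmetric] using c by simp
  have nz: "\<gamma> + \<nu> \<noteq> - (2 * real m + 1)" for m using assms(4) by simp
  obtain C where C: "\<forall>h. 0 < h \<and> h \<le> 1 / 2 \<longrightarrow>
    (\<exists>s. (\<lambda>n. of_real h * profile \<xi> (\<gamma> + \<nu>) \<nu> \<mu> (of_real (real (Suc n) * h))) sums s \<and>
       cmod (s - I - (\<Sum>k<K. profile_coeff \<mu> \<nu> \<xi> k * of_real (h powr (\<gamma> + \<nu> + 2 * real k + 1)) * Z k))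
         \<le> C * h powr (\<gamma> + \<nu> + 2 * real K + 1))"
    unfolding Z_def by (rule exE[OF profile_asymptotics[OF \<xi> assms(2,3) nz I, of K]])
  have bound: "cmod (complex_of_real (S_sum \<mu> \<gamma> \<nu> a b)
        - complex_of_real (a powr (\<gamma> - 2 * \<mu> + 1)) * H
        - complex_of_real (a powr (- \<nu> - 2 * \<mu>) * c) *
          (\<Sum>k<K. (-1) ^ k / fact k * complex_of_real (pochhammer \<mu> k) * Z k
             * complex_of_real (F_over_Gamma \<mu> \<nu> k \<xi>) * complex_of_real (a powr (- 2 * real k))))
     \<le> c * C * cmod (complex_of_real (a powr (- \<nu> - 2 * \<mu> - 2 * real K)))" if a: "a \<ge> 2" for a
  proof -
    define h where "h = 1 / a"
    have a0: "a > 0" using a by simp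
    have h: "0 < h" "h \<le> 1 / 2" using a by (simp_all add: h_def field_simps)
    have hp: "h powr e = a powr (- e)" for e using a0 by (simp add: h_def powr_divide powr_minus_divide)
    obtain s where s: "(\<lambda>n. of_real h * profile \<xi> (\<gamma> + \<nu>) \<nu> \<mu> (of_real (real (Suc n) * h))) sums s"
      and err: "cmod (s - I - (\<Sum>k<K. profile_coeff \<mu> \<nu> \<xi> k * of_real (h powr (\<gamma> + \<nu> + 2 * real k + 1)) * Z k)) \<le> C * h powr (\<gamma> + \<nu> + 2 * real K + 1)"
      using C[rule_format, OF conjI[OF h]] by (elim exE conjE)
    define w where "w = a powr (\<gamma> - 2 * \<mu> + 1) * c"
    have S: "complex_of_real (S_sum \<mu> \<gamma> \<nu> a b) = of_real w * s"
    proof -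
      have t: "of_real w * (of_real h * profile \<xi> (\<gamma> + \<nu>) \<nu> \<mu> (of_real (real (Suc n) * h)))
         = of_real (real (Suc n) powr \<gamma> * bessel_J \<nu> (real (Suc n) * b / a) / ((real (Suc n))\<^sup>2 + a\<^sup>2) powr \<mu>)" for n
      proof -
        define y where "y = real (Suc n) * h"
        have y: "y > 0" using h unfolding y_def by (simp del: of_nat_Suc)
        have n: "real (Suc n) = a * y" using a0 unfolding y_def h_def by (simp del: of_nat_Suc)
        have J: "bessel_J \<nu> (b * y) = c * y powr \<nu> * bessel_clifford \<nu> (\<xi> * y\<^sup>2)"
        proof -
          have "(b * y / 2) powr \<nu> = c * y powr \<nu>"
            using assms(1) y powr_mult[of "b / 2" y \<nu>] by (simp add: c_def)
          moreover have "(b * y)\<^sup>2 / 4 = \<xi> * y\<^sup>2" by (simp add: \<xi>_def power_mult_distrib)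
          ultimately show ?thesis using bessel_J_eq[of "b * y" \<nu>] assms(1) y by simp
        qed
        have "a\<^sup>2 powr \<mu> = a powr (2 * \<mu>)"
          using powr_powr[of a 2 \<mu>] a0 by simp
        moreover have "(a * y)\<^sup>2 + a\<^sup>2 = a\<^sup>2 * (1 + y\<^sup>2)" by (simp add: power_mult_distrib algebra_simps)
        ultimately have D: "((a * y)\<^sup>2 + a\<^sup>2) powr \<mu> = a powr (2 * \<mu>) * (1 + y\<^sup>2) powr \<mu>"
          by (simp add: powr_mult)
        have e: "a * y * b / a = b * y" using a0 by simp
        have wa: "w * h = a powr \<gamma> / a powr (2 * \<mu>) * c"
          unfolding w_def h_def using a0 by (simp add: powr_add powr_diff del: diff_divide_distrib)
        have "a powr \<gamma> * y powr \<gamma> = (a * y) powr \<gamma>" using a0 y by (simp add: powr_mult)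
        then have "w * h * (y powr (\<gamma> + \<nu>) * bessel_clifford \<nu> (\<xi> * y\<^sup>2) * (1 + y\<^sup>2) powr (- \<mu>))
           = (a * y) powr \<gamma> * bessel_J \<nu> (a * y * b / a) / ((a * y)\<^sup>2 + a\<^sup>2) powr \<mu>"
          unfolding e J D wa powr_add by (simp add: powr_minus divide_inverse mult_ac)
        then show ?thesis
          unfolding y_def[symmetric] unfolding profile_of_real[OF y] n of_real_mult[symmetric] by (simp only: mult.assoc)
      qed
      have "(\<lambda>n. of_real (real (Suc n) powr \<gamma> * bessel_J \<nu> (real (Suc n) * b / a) / ((real (Suc n))\<^sup>2 + a\<^sup>2) powr \<mu>)) sums (of_real w * s)"
        using sums_mult[OF s, of "of_real w"] unfolding t .
      note sc = this
      have sr: "(\<lambda>n. real (Suc n) powr \<gamma> * bessel_J \<nu> (real (Suc n) * b / a) / ((real (Suc n))\<^sup>2 + a\<^sup>2) powr \<mu>) sums Re (of_real w * s)"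
        using sums_Re[OF sc] unfolding Re_complex_of_real .
      have "complex_of_real (S_sum \<mu> \<gamma> \<nu> a b) = of_real (Re (of_real w * s))"
        unfolding S_sum_def using sums_unique[OF sr] by simp
      also have "\<dots> = of_real w * s"
        by (rule sums_unique2[OF sums_of_real[OF sr] sc])
      finally show ?thesis .
    qed
    have T: "complex_of_real (a powr (- \<nu> - 2 * \<mu>) * c) *
          (\<Sum>k<K. (-1) ^ k / fact k * complex_of_real (pochhammer \<mu> k) * Z k
             * complex_of_real (F_over_Gamma \<mu> \<nu> k \<xi>) * complex_of_real (a powr (- 2 * real k)))
       = of_real w * (\<Sum>k<K. profile_coeff \<mu> \<nu> \<xi> k * of_real (h powr (\<gamma> + \<nu> + 2 * real k + 1)) * Z k)"
      unfolding sum_distrib_left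
    proof (intro sum.cong refl)
      fix k
      have "a powr (\<gamma> - 2 * \<mu> + 1) * h powr (\<gamma> + \<nu> + 2 * real k + 1) = a powr (- \<nu> - 2 * \<mu>) * a powr (- 2 * real k)"
        unfolding hp powr_add[symmetric] by (simp add: algebra_simps)
      then have "w * h powr (\<gamma> + \<nu> + 2 * real k + 1) = a powr (- \<nu> - 2 * \<mu>) * a powr (- 2 * real k) * c"
        unfolding w_def by (simp add: mult_ac)
      then have e: "of_real w * of_real (h powr (\<gamma> + \<nu> + 2 * real k + 1)) = complex_of_real (a powr (- \<nu> - 2 * \<mu>) * a powr (- 2 * real k) * c)"
        by (simp only: of_real_mult[symmetric])
      have r: "of_real w * (profile_coeff \<mu> \<nu> \<xi> k * of_real (h powr (\<gamma> + \<nu> + 2 * real k + 1)) * Z k)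
         = (of_real w * of_real (h powr (\<gamma> + \<nu> + 2 * real k + 1))) * profile_coeff \<mu> \<nu> \<xi> k * Z k"
        by (simp only: mult_ac)
      show "complex_of_real (a powr (- \<nu> - 2 * \<mu>) * c) * ((-1) ^ k / fact k * complex_of_real (pochhammer \<mu> k) * Z k
             * complex_of_real (F_over_Gamma \<mu> \<nu> k \<xi>) * complex_of_real (a powr (- 2 * real k)))
        = of_real w * (profile_coeff \<mu> \<nu> \<xi> k * of_real (h powr (\<gamma> + \<nu> + 2 * real k + 1)) * Z k)"
        unfolding r unfolding e profile_coeff_eq_F_over_Gamma[OF assms(2)] by (simp add: mult_ac)
    qed
    have Hw: "complex_of_real (a powr (\<gamma> - 2 * \<mu> + 1)) * H = of_real w * I"
      unfolding w_def I_def using c by simp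
    have w0: "w \<ge> 0" using c by (simp add: w_def)
    have "cmod (of_real w * s - of_real w * I - of_real w * (\<Sum>k<K. profile_coeff \<mu> \<nu> \<xi> k * of_real (h powr (\<gamma> + \<nu> + 2 * real k + 1)) * Z k))
       = w * cmod (s - I - (\<Sum>k<K. profile_coeff \<mu> \<nu> \<xi> k * of_real (h powr (\<gamma> + \<nu> + 2 * real k + 1)) * Z k))"
      unfolding right_diff_distrib[symmetric] norm_mult using w0 by simp
    also have "\<dots> \<le> w * (C * h powr (\<gamma> + \<nu> + 2 * real K + 1))"
      by (rule mult_left_mono[OF err w0])
    also have "\<dots> = c * C * a powr (- \<nu> - 2 * \<mu> - 2 * real K)"
    proof -
      have "a powr (\<gamma> - 2 * \<mu> + 1) * h powr (\<gamma> + \<nu> + 2 * real K + 1) = a powr (- \<nu> - 2 * \<mu> - 2 * real K)"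
        unfolding hp powr_add[symmetric] by (simp add: algebra_simps)
      then show ?thesis unfolding w_def by (simp add: mult_ac)
    qed
    finally show ?thesis unfolding S T Hw by simp
  qed
  show "(\<lambda>a::real.
        complex_of_real (S_sum \<mu> \<gamma> \<nu> a b)
        - complex_of_real (a powr (\<gamma> - 2 * \<mu> + 1)) * H_fun b \<mu> \<gamma> \<nu> 1
        - complex_of_real (a powr (- \<nu> - 2 * \<mu>) * (b / 2) powr \<nu>) *
          (\<Sum>k<K. (-1) ^ k / fact k
             * complex_of_real (pochhammer \<mu> k)
             * riemann_zeta (- complex_of_real (\<gamma> + \<nu> + 2 * real k))
             * complex_of_real (F_over_Gamma \<mu> \<nu> k (b\<^sup>2 / 4))
             * complex_of_real (a powr (- 2 * real k))))
    \<in> O[at_top](\<lambda>a. complex_of_real (a powr (- \<nu> - 2 * \<mu> - 2 * real K)))"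
    unfolding \<xi>_def[symmetric] c_def[symmetric] H_def[symmetric]
  proof (rule bigoI)
    show "\<forall>\<^sub>F a in at_top. cmod (complex_of_real (S_sum \<mu> \<gamma> \<nu> a b) - complex_of_real (a powr (\<gamma> - 2 * \<mu> + 1)) * H
        - complex_of_real (a powr (- \<nu> - 2 * \<mu>) * c) *
          (\<Sum>k<K. (-1) ^ k / fact k * complex_of_real (pochhammer \<mu> k) * riemann_zeta (- complex_of_real (\<gamma> + \<nu> + 2 * real k))
             * complex_of_real (F_over_Gamma \<mu> \<nu> k \<xi>) * complex_of_real (a powr (- 2 * real k))))
      \<le> c * C * cmod (complex_of_real (a powr (- \<nu> - 2 * \<mu> - 2 * real K)))"
      using eventually_ge_at_top[of 2] by (rule eventually_mono) (rule bound[unfolded Z_def])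
  qed
qed

end
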